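(* Let $m\ge 2$ be an integer, let $n_1,\dots,n_m\ge 2$ be integers, and let $N=\prod_{j=1}^m n_j$. Let $\phi: M_N\rightarrow M_N$ be a (complex-)linear map. The following are equivalent. (a) $w(\phi(A_1\otimes\cdots\otimes A_m)) = w(A_1\otimes\cdots\otimes A_m)$ for all $(A_1,\dots,A_m)\in M_{n_1}\times\cdots\times M_{n_m}$. (b) There exist a unitary matrix $U\in M_N$, a complex number $\xi$ with $|\xi|=1$, and maps $\varphi_k: M_{n_k}\to M_{n_k}$, $k=1,\dots,m$, each of which is either the identity map $X\mapsto X$ or the transposition map $X\mapsto X^t$, such that $$\phi(A_1\otimes\cdots\otimes A_m) = \xi\, U(\varphi_1(A_1)\otimes\cdots\otimes\varphi_m(A_m))U^*$$ for all $(A_1,\dots,A_m)\in M_{n_1}\times\cdots\times M_{n_m}$, and the maps $\varphi_j$ for those indices $j$ with $n_j\ge 3$ are all of the same type (all identity maps or all transposition maps).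
   Context: $M_k$ denotes the set of $k\times k$ complex matrices. $\otimes$ denotes the tensor (Kronecker) product of matrices, so $A_1\otimes\cdots\otimes A_m\in M_N$. $X^t$ is the transpose and $X^*$ the conjugate transpose of $X$. For $A\in M_k$, the numerical range is $W(A)=\{u^*Au : u\in\mathbb{C}^k,\ u^*u=1\}\subseteq\mathbb{C}$, and the numerical radius is $w(A)=\sup\{|\mu| : \mu\in W(A)\}$. *)

theory Defs
  imports "Jordan_Normal_Form.Schur_Decomposition"
begin

definition numerical_range :: "complex mat \<Rightarrow> complex set" where
  "numerical_range A =
    {conjugate u \<bullet> (A *\<^sub>v u) | u. u \<in> carrier_vec (dim_row A) \<and> conjugate u \<bullet> u = 1}"

(* The supremum is taken over a bounded set, which is non-empty unless A is 0 x 0. *)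
definition numerical_radius :: "complex mat \<Rightarrow> real" where
  "numerical_radius A = (SUP \<mu>\<in>numerical_range A. cmod \<mu>)"

definition unitary_mat :: "complex mat \<Rightarrow> bool" where
  "unitary_mat U \<longleftrightarrow>
    square_mat U \<and> inverts_mat U (mat_adjoint U) \<and> inverts_mat (mat_adjoint U) U"

(* Block convention: the (i, j) block of the product is A(i,j) B. *)
definition kronecker :: "'a :: times mat \<Rightarrow> 'a mat \<Rightarrow> 'a mat"  (infixl \<open>\<otimes>\<^sub>K\<close> 70) where
  "A \<otimes>\<^sub>K B = mat (dim_row A * dim_row B) (dim_col A * dim_col B)
    (\<lambda>(i, j). A $$ (i div dim_row B, j div dim_col B) * B $$ (i mod dim_row B, j mod dim_col B))"

(* The factors of an m-fold product are indexed by 0, ..., m - 1; the empty product is the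
   1 x 1 identity, a left unit for the Kronecker product. *)
primrec kronecker_family :: "nat \<Rightarrow> (nat \<Rightarrow> 'a :: comm_ring_1 mat) \<Rightarrow> 'a mat" where
  "kronecker_family 0 A = 1\<^sub>m 1"
| "kronecker_family (Suc m) A = kronecker_family m A \<otimes>\<^sub>K A m"

lemma kronecker_carrier [simp]:
  assumes "A \<in> carrier_mat r c" and "B \<in> carrier_mat r' c'"
  shows "A \<otimes>\<^sub>K B \<in> carrier_mat (r * r') (c * c')"
  using assms by (auto simp: kronecker_def)

lemma kronecker_one_left:
  fixes A :: "'a :: comm_ring_1 mat"
  shows "1\<^sub>m 1 \<otimes>\<^sub>K A = A"
  by (rule eq_matI) (auto simp: kronecker_def)

lemma kronecker_family_carrier:
  assumes "\<And>j. j < m \<Longrightarrow> A j \<in> carrier_mat (n j) (n j)"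
  shows "kronecker_family m A \<in> carrier_mat (\<Prod>j<m. n j) (\<Prod>j<m. n j)"
  using assms
proof (induction m)
  case (Suc m)
  then show ?case
    by (metis kronecker_carrier kronecker_family.simps(2) less_Suc_eq prod.lessThan_Suc)
qed simp

abbreviation linear_map_mat :: "nat \<Rightarrow> (complex mat \<Rightarrow> complex mat) \<Rightarrow> bool" where
  "linear_map_mat N \<phi> \<equiv>
    linear_map class_ring (module_mat TYPE(complex) N N) (module_mat TYPE(complex) N N) \<phi>"

lemma linear_map_mat_iff:
  "linear_map_mat N \<phi> \<longleftrightarrow>
    (\<forall>X\<in>carrier_mat N N. \<phi> X \<in> carrier_mat N N) \<and>
    (\<forall>X\<in>carrier_mat N N. \<forall>Y\<in>carrier_mat N N. \<phi> (X + Y) = \<phi> X + \<phi> Y) \<and>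
    (\<forall>c. \<forall>X\<in>carrier_mat N N. \<phi> (c \<cdot>\<^sub>m X) = c \<cdot>\<^sub>m \<phi> X)"
  using matrix_vs[where 'a = complex, of N N]
  by (auto simp: linear_map_def mod_hom_def mod_hom_axioms_def vectorspace_def
      LinearCombinations.module_hom_def module_mat_simps Pi_iff)

end

theory Submission
  imports "HOL-Analysis.Analysis" Defs "Jordan_Normal_Form.Spectral_Radius"
begin

text \<open>
  One direction is direct: the numerical radius is invariant under unitary similarity, under
  unimodular scalars and under transposition, and a two-by-two matrix is unitarily similar to its
  transpose (\<open>numerical_radius_partial_transpose\<close>).

  For the converse, consider the images \<open>Q I\<close> of the diagonal matrix units. All diagonal unitaries that
  are Kronecker products have images of numerical radius 1. Averaging over a torus of such unitaries
  shows that a unit vector at which the form of \<open>Q I\<close> attains its maximal modulus is annihilated by all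
  other \<open>Q J\<close> and their adjoints (\<open>torus_extremal_vector\<close>). So the \<open>Q I\<close> are unimodular multiples of the
  rank-one projections of one orthonormal basis. The same holds for every product basis, because
  conjugation by a Kronecker product of unitaries preserves the hypotheses.

  A linear functional that is unimodular on all rank-one projections is a multiple of the trace
  (\<open>unimodular_functional_is_trace\<close>). Applied to the traces of the images, slot by slot, this shows that
  the unimodular factors of all product bases coincide. After division by this scalar, product bases
  of projections go to bases of projections (\<open>frame_map\<close>). Kronecker products of Hermitian matrices are
  diagonal in some product basis. By multilinearity, the restrictions of the map to the single tensor
  factors therefore have commuting ranges, multiply to the whole map, and are Jordan homomorphisms.

  A Jordan homomorphism of a matrix algebra may be a direct sum of a homomorphism and an
  antihomomorphism. Here this cannot happen: the trace of the homomorphic part against a product of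
  rank-one projections is 0 or 1, and by the result on unimodular functionals it does not depend on
  these projections (\<open>slot_dichotomy\<close>). So each factor is treated multiplicatively or
  antimultiplicatively, and after transpositions in the factors of the second kind the map carries
  matrix units to matrix units, that is, it is a unitary similarity (\<open>normal_form\<close>). Finally, a weighted
  shift of size three distinguishes the transposition of one of two factors of size at least three
  from the identity (\<open>partial_transpose_changes_radius\<close>).
\<close>

unbundle no inner_syntax and no vec_syntax

section \<open>Matrices, adjoints and the numerical radius\<close>

notation mat_adjoint (\<open>(_\<^sup>\<dagger>)\<close> [1000] 999)

lemma dim_mat_adjoint [simp]: "dim_row (A\<^sup>\<dagger>) = dim_col A" "dim_col (A\<^sup>\<dagger>) = dim_row A"
  by (simp_all add: mat_adjoint_def)

lemma index_mat_adjoint [simp]: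
  fixes A :: "complex mat"
  assumes "i < dim_col A" "j < dim_row A"
  shows "A\<^sup>\<dagger> $$ (i, j) = cnj (A $$ (j, i))"
  using assms by (simp add: mat_adjoint_def mat_of_rows_def conjugate_complex_def)

lemma mat_adjoint_carrier [simp]: "A \<in> carrier_mat r c \<Longrightarrow> A\<^sup>\<dagger> \<in> carrier_mat c r"
  by (intro carrier_matI) simp_all

lemma index_mult_sum:
  fixes A :: "'a :: comm_semiring_0 mat"
  assumes "A \<in> carrier_mat n k" "B \<in> carrier_mat k l" "i < n" "j < l"
  shows "(A * B) $$ (i, j) = (\<Sum>t<k. A $$ (i, t) * B $$ (t, j))"
  using assms by (simp add: scalar_prod_def atLeast0LessThan)

lemma adjoint_adjoint [simp]: "(A\<^sup>\<dagger>)\<^sup>\<dagger> = (A :: complex mat)"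
  by (rule eq_matI) simp_all

lemma adjoint_one [simp]: "(1\<^sub>m n)\<^sup>\<dagger> = (1\<^sub>m n :: complex mat)"
  by (rule eq_matI) simp_all

lemma adjoint_zero [simp]: "(0\<^sub>m r c)\<^sup>\<dagger> = (0\<^sub>m c r :: complex mat)"
  by (rule eq_matI) simp_all

lemma adjoint_add:
  fixes A B :: "complex mat"
  shows "A \<in> carrier_mat r c \<Longrightarrow> B \<in> carrier_mat r c \<Longrightarrow> (A + B)\<^sup>\<dagger> = A\<^sup>\<dagger> + B\<^sup>\<dagger>"
  by (rule eq_matI) simp_all

lemma adjoint_smult: "(c \<cdot>\<^sub>m A)\<^sup>\<dagger> = cnj c \<cdot>\<^sub>m (A :: complex mat)\<^sup>\<dagger>"
  by (rule eq_matI) simp_all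

lemma adjoint_mult:
  fixes A B :: "complex mat"
  assumes "A \<in> carrier_mat n k" "B \<in> carrier_mat k l"
  shows "(A * B)\<^sup>\<dagger> = B\<^sup>\<dagger> * A\<^sup>\<dagger>"
proof (rule eq_matI)
  fix i j assume "i < dim_row (B\<^sup>\<dagger> * A\<^sup>\<dagger>)" "j < dim_col (B\<^sup>\<dagger> * A\<^sup>\<dagger>)"
  then have ij: "i < l" "j < n" using assms by auto
  have "(A * B)\<^sup>\<dagger> $$ (i, j) = cnj (\<Sum>t<k. A $$ (j, t) * B $$ (t, i))"
    using assms ij by (simp add: index_mult_sum[OF assms] del: index_mult_mat(1))
  also have "\<dots> = (\<Sum>t<k. B\<^sup>\<dagger> $$ (i, t) * A\<^sup>\<dagger> $$ (t, j))"
    using assms ij by (simp add: mult.commute)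
  also have "\<dots> = (B\<^sup>\<dagger> * A\<^sup>\<dagger>) $$ (i, j)"
    using index_mult_sum[of "B\<^sup>\<dagger>" l k "A\<^sup>\<dagger>" n i j] assms ij by simp
  finally show "(A * B)\<^sup>\<dagger> $$ (i, j) = (B\<^sup>\<dagger> * A\<^sup>\<dagger>) $$ (i, j)" .
qed (use assms in simp_all)

lemma adjoint_transpose: "(transpose_mat A)\<^sup>\<dagger> = transpose_mat ((A :: complex mat)\<^sup>\<dagger>)"
  by (rule eq_matI) simp_all

lemma mult_carrier_square [simp]:
  "A \<in> carrier_mat n n \<Longrightarrow> B \<in> carrier_mat n n \<Longrightarrow> A * B \<in> carrier_mat n n"
  by (rule mult_carrier_mat)

definition unitaries :: "nat \<Rightarrow> complex mat set" where
  "unitaries n = {U \<in> carrier_mat n n. U\<^sup>\<dagger> * U = 1\<^sub>m n}"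

lemma unitariesD:
  assumes "U \<in> unitaries n"
  shows "U \<in> carrier_mat n n" "U\<^sup>\<dagger> * U = 1\<^sub>m n" "U * U\<^sup>\<dagger> = 1\<^sub>m n" "U\<^sup>\<dagger> \<in> unitaries n"
  using assms mat_mult_left_right_inverse[of "U\<^sup>\<dagger>" n U] by (auto simp: unitaries_def)

lemma unitaries_iff:
  assumes U: "U \<in> carrier_mat n n"
  shows "unitary_mat U \<longleftrightarrow> U \<in> unitaries n"
proof
  assume "unitary_mat U"
  then have "U\<^sup>\<dagger> * U = 1\<^sub>m n"
    using U by (simp add: unitary_mat_def inverts_mat_def)
  then show "U \<in> unitaries n" using U by (simp add: unitaries_def)
next
  assume "U \<in> unitaries n"
  from unitariesD(2,3)[OF this] show "unitary_mat U"
    using U by (simp add: unitary_mat_def inverts_mat_def)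
qed

lemma unitaries_one [simp]: "1\<^sub>m n \<in> unitaries n"
  by (simp add: unitaries_def)

lemma unitaries_mult:
  assumes "U \<in> unitaries n" "V \<in> unitaries n"
  shows "U * V \<in> unitaries n"
proof -
  note U = unitariesD[OF assms(1)] and V = unitariesD[OF assms(2)]
  have "(U * V)\<^sup>\<dagger> * (U * V) = V\<^sup>\<dagger> * (U\<^sup>\<dagger> * (U * V))"
    using U V by (simp add: adjoint_mult[of _ n n _ n] assoc_mult_mat[of _ n n _ n _ n])
  also have "U\<^sup>\<dagger> * (U * V) = V"
    using U V by (simp add: assoc_mult_mat[of _ n n _ n _ n, symmetric])
  finally show ?thesis using U V by (simp add: unitaries_def)
qed

lemma unitary_conj_mult:
  assumes "U \<in> unitaries n" "X \<in> carrier_mat n n" "Y \<in> carrier_mat n n"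
  shows "(U * X * U\<^sup>\<dagger>) * (U * Y * U\<^sup>\<dagger>) = U * (X * Y) * U\<^sup>\<dagger>"
proof -
  note U = unitariesD[OF assms(1)]
  have "U\<^sup>\<dagger> * (U * (Y * U\<^sup>\<dagger>)) = Y * U\<^sup>\<dagger>"
    using U assms(2,3) by (simp add: assoc_mult_mat[of _ n n _ n _ n, symmetric])
  then show ?thesis
    using U assms(2,3) by (simp add: assoc_mult_mat[of _ n n _ n _ n])
qed

lemma unitary_conj_adjoint:
  assumes "U \<in> unitaries n" "X \<in> carrier_mat n n"
  shows "(U * X * U\<^sup>\<dagger>)\<^sup>\<dagger> = U * X\<^sup>\<dagger> * U\<^sup>\<dagger>"
  using unitariesD[OF assms(1)] assms(2)
  by (simp add: adjoint_mult[of _ n n _ n] assoc_mult_mat[of _ n n _ n _ n])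

lemma unitary_conj_cancel:
  assumes "U \<in> unitaries n" "X \<in> carrier_mat n n"
  shows "U\<^sup>\<dagger> * (U * X * U\<^sup>\<dagger>) * U = X" "U * (U\<^sup>\<dagger> * X * U) * U\<^sup>\<dagger> = X"
proof -
  note U = unitariesD[OF assms(1)]
  have "U\<^sup>\<dagger> * (U * X * U\<^sup>\<dagger>) * U = (U\<^sup>\<dagger> * U) * X * (U\<^sup>\<dagger> * U)"
    "U * (U\<^sup>\<dagger> * X * U) * U\<^sup>\<dagger> = (U * U\<^sup>\<dagger>) * X * (U * U\<^sup>\<dagger>)"
    using U(1) assms(2) by (simp_all add: assoc_mult_mat[of _ n n _ n _ n])
  then show "U\<^sup>\<dagger> * (U * X * U\<^sup>\<dagger>) * U = X" "U * (U\<^sup>\<dagger> * X * U) * U\<^sup>\<dagger> = X"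
    using U assms(2) by simp_all
qed

definition trace_mat :: "'a :: comm_monoid_add mat \<Rightarrow> 'a" where
  "trace_mat A = (\<Sum>i<dim_row A. A $$ (i, i))"

lemma trace_mat_add:
  "A \<in> carrier_mat n n \<Longrightarrow> B \<in> carrier_mat n n \<Longrightarrow> trace_mat (A + B) = trace_mat A + trace_mat B"
  by (simp add: trace_mat_def sum.distrib)

lemma trace_mat_smult:
  "A \<in> carrier_mat n n \<Longrightarrow> trace_mat (c \<cdot>\<^sub>m A) = c * trace_mat (A :: 'a :: semiring_0 mat)"
  by (simp add: trace_mat_def sum_distrib_left)

lemma trace_mat_mult_commute:
  fixes A B :: "'a :: comm_semiring_0 mat"
  assumes "A \<in> carrier_mat n k" "B \<in> carrier_mat k n"
  shows "trace_mat (A * B) = trace_mat (B * A)"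
proof -
  have "trace_mat (A * B) = (\<Sum>i<n. \<Sum>t<k. A $$ (i, t) * B $$ (t, i))"
    using assms index_mult_sum[OF assms] by (simp add: trace_mat_def)
  also have "\<dots> = (\<Sum>t<k. \<Sum>i<n. B $$ (t, i) * A $$ (i, t))"
    by (subst sum.swap) (simp add: mult.commute)
  also have "\<dots> = trace_mat (B * A)"
    using assms index_mult_sum[OF assms(2,1)] by (simp add: trace_mat_def)
  finally show ?thesis .
qed

lemma trace_unitary_conj:
  assumes "U \<in> unitaries n" "X \<in> carrier_mat n n"
  shows "trace_mat (U * X * U\<^sup>\<dagger>) = trace_mat X"
proof -
  note U = unitariesD[OF assms(1)]
  have "trace_mat (U * X * U\<^sup>\<dagger>) = trace_mat (U\<^sup>\<dagger> * (U * X))"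
    by (rule trace_mat_mult_commute[of _ n n]) (use U assms in auto)
  also have "U\<^sup>\<dagger> * (U * X) = X"
    using U assms(2) by (simp add: assoc_mult_mat[of _ n n _ n _ n, symmetric])
  finally show ?thesis .
qed

text \<open>The trace of \<open>Z * Z\<^sup>\<dagger>\<close> is the square of the Hilbert--Schmidt norm of \<open>Z\<close>.\<close>
lemma trace_mult_adjoint_eq_0:
  fixes Z :: "complex mat"
  assumes "Z \<in> carrier_mat r c" "trace_mat (Z * Z\<^sup>\<dagger>) = 0"
  shows "Z = 0\<^sub>m r c"
proof -
  have "trace_mat (Z * Z\<^sup>\<dagger>) = (\<Sum>i<r. \<Sum>j<c. Z $$ (i, j) * cnj (Z $$ (i, j)))"
    using assms(1) index_mult_sum[of Z r c "Z\<^sup>\<dagger>" r] by (simp add: trace_mat_def)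
  also have "\<dots> = complex_of_real (\<Sum>i<r. \<Sum>j<c. (cmod (Z $$ (i, j)))\<^sup>2)"
    by (simp only: complex_norm_square of_real_sum)
  finally have "(\<Sum>i<r. \<Sum>j<c. (cmod (Z $$ (i, j)))\<^sup>2) = 0"
    using assms(2) by (metis of_real_eq_0_iff)
  then have "\<And>i j. i < r \<Longrightarrow> j < c \<Longrightarrow> Z $$ (i, j) = 0"
    by (simp add: sum_nonneg_eq_0_iff sum_nonneg)
  then show ?thesis using assms(1) by (intro eq_matI) auto
qed

definition unit_mat :: "nat \<Rightarrow> nat \<Rightarrow> nat \<Rightarrow> complex mat" where
  "unit_mat n a b = mat n n (\<lambda>(i, j). if i = a \<and> j = b then 1 else 0)"

lemma unit_mat_carrier [simp]: "unit_mat n a b \<in> carrier_mat n n"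
  by (simp add: unit_mat_def)

lemma unit_mat_dim [simp]: "dim_row (unit_mat n a b) = n" "dim_col (unit_mat n a b) = n"
  by (simp_all add: unit_mat_def)

lemma unit_mat_index [simp]:
  "i < n \<Longrightarrow> j < n \<Longrightarrow> unit_mat n a b $$ (i, j) = (if i = a \<and> j = b then 1 else 0)"
  by (simp add: unit_mat_def)

lemma adjoint_unit_mat [simp]: "(unit_mat n a b)\<^sup>\<dagger> = unit_mat n b a"
  by (rule eq_matI) auto

lemma transpose_unit_mat [simp]: "transpose_mat (unit_mat n a b) = unit_mat n b a"
  by (rule eq_matI) auto

lemma trace_unit_mat: "a < n \<Longrightarrow> b < n \<Longrightarrow> trace_mat (unit_mat n a b) = (if a = b then 1 else 0)"
  by (auto simp: trace_mat_def)

lemma unit_mat_mult: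
  assumes "b < n" "c < n"
  shows "unit_mat n a b * unit_mat n c d = (if b = c then unit_mat n a d else 0\<^sub>m n n)"
proof (rule eq_matI)
  fix i j assume "i < dim_row (if b = c then unit_mat n a d else 0\<^sub>m n n)"
    "j < dim_col (if b = c then unit_mat n a d else 0\<^sub>m n n)"
  then have ij: "i < n" "j < n" by (auto split: if_splits)
  have "(unit_mat n a b * unit_mat n c d) $$ (i, j)
      = (\<Sum>t<n. (if t = b then (if i = a \<and> t = c \<and> j = d then 1 else 0) else 0))"
    by (subst index_mult_sum[of _ n n _ n]) (use ij in \<open>auto intro!: sum.cong simp del: sum.delta sum.delta'\<close>)
  also have "\<dots> = (if b = c then unit_mat n a d else 0\<^sub>m n n) $$ (i, j)"
    using ij assms by simp
  finally show "(unit_mat n a b * unit_mat n c d) $$ (i, j)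
      = (if b = c then unit_mat n a d else 0\<^sub>m n n) $$ (i, j)" .
qed auto

subsection \<open>The numerical radius as a norm of a quadratic form\<close>

text \<open>Vectors are functions on the indices, of which only the first \<open>n\<close> values count: this spares the
  membership conditions of a vector type.\<close>

definition form :: "nat \<Rightarrow> complex mat \<Rightarrow> (nat \<Rightarrow> complex) \<Rightarrow> (nat \<Rightarrow> complex) \<Rightarrow> complex" where
  "form n A v u = (\<Sum>i<n. \<Sum>j<n. cnj (v i) * A $$ (i, j) * u j)"

definition normsq :: "nat \<Rightarrow> (nat \<Rightarrow> complex) \<Rightarrow> real" where
  "normsq n v = (\<Sum>i<n. (cmod (v i))\<^sup>2)"

lemma normsq_nonneg [simp]: "normsq n v \<ge> 0"
  by (simp add: normsq_def sum_nonneg)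

lemma normsq_eq_0: "normsq n v = 0 \<Longrightarrow> i < n \<Longrightarrow> v i = 0"
  by (simp add: normsq_def sum_nonneg_eq_0_iff)

lemma normsq_complex: "complex_of_real (normsq n v) = (\<Sum>i<n. cnj (v i) * v i)"
  by (simp only: normsq_def of_real_sum complex_norm_square) (simp add: mult.commute)

lemma form_add: "A \<in> carrier_mat n n \<Longrightarrow> B \<in> carrier_mat n n \<Longrightarrow>
    form n (A + B) v u = form n A v u + form n B v u"
  by (simp add: form_def algebra_simps sum.distrib)

lemma form_smult: "A \<in> carrier_mat n n \<Longrightarrow> form n (c \<cdot>\<^sub>m A) v u = c * form n A v u"
  by (simp add: form_def sum_distrib_left algebra_simps)

lemma form_adjoint: "A \<in> carrier_mat n n \<Longrightarrow> form n (A\<^sup>\<dagger>) v u = cnj (form n A u v)"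
  unfolding form_def by (subst sum.swap) (simp add: mult_ac)

lemma form_scale: "form n A (\<lambda>i. c * v i) (\<lambda>i. d * u i) = cnj c * d * form n A v u"
  by (simp add: form_def sum_distrib_left algebra_simps)

lemma normsq_scale: "normsq n (\<lambda>i. c * v i) = (cmod c)\<^sup>2 * normsq n v"
  by (simp add: normsq_def sum_distrib_left norm_mult power_mult_distrib)

lemma numerical_range_eq:
  assumes A: "A \<in> carrier_mat n n"
  shows "numerical_range A = (\<lambda>u. form n A u u) ` {u. normsq n u = 1}"
proof -
  have sprod: "conjugate u \<bullet> w = (\<Sum>i<n. cnj (u $ i) * w $ i)"
    if "u \<in> carrier_vec n" "w \<in> carrier_vec n" for u w :: "complex vec"
    using that by (simp add: scalar_prod_def atLeast0LessThan conjugate_complex_def)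
  have form: "conjugate u \<bullet> (A *\<^sub>v u) = form n A (($) u) (($) u)" if u: "u \<in> carrier_vec n" for u
  proof -
    have "(A *\<^sub>v u) $ i = (\<Sum>j<n. A $$ (i, j) * u $ j)" if "i < n" for i
      using that u A by (simp add: scalar_prod_def atLeast0LessThan)
    moreover have "A *\<^sub>v u \<in> carrier_vec n" using A u by simp
    ultimately show ?thesis
      using u by (simp add: sprod form_def sum_distrib_left mult.assoc)
  qed
  have norm: "conjugate u \<bullet> u = complex_of_real (normsq n (($) u))" if "u \<in> carrier_vec n" for u
    unfolding normsq_complex using that by (simp add: sprod)
  have in1: "form n A u u \<in> numerical_range A" if "normsq n u = 1" for u
  proof -
    have 1: "form n A (($) (vec n u)) (($) (vec n u)) = form n A u u"
      unfolding form_def by (intro sum.cong) auto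
    have 2: "normsq n (($) (vec n u)) = normsq n u"
      unfolding normsq_def by (intro sum.cong) auto
    have "conjugate (vec n u) \<bullet> vec n u = 1"
      using norm[of "vec n u"] 2 that by simp
    moreover have "form n A u u = conjugate (vec n u) \<bullet> (A *\<^sub>v vec n u)"
      using form[of "vec n u"] 1 by simp
    ultimately show ?thesis unfolding numerical_range_def
      by (intro CollectI exI[of _ "vec n u"] conjI) (use A in simp_all)
  qed
  have in2: "x \<in> (\<lambda>u. form n A u u) ` {u. normsq n u = 1}" if x: "x \<in> numerical_range A" for x
  proof -
    from x obtain u where u: "u \<in> carrier_vec n" "conjugate u \<bullet> u = 1" "x = conjugate u \<bullet> (A *\<^sub>v u)"
      using A unfolding numerical_range_def by auto
    have "complex_of_real (normsq n (($) u)) = 1"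
      using norm[OF u(1)] u(2) by (rule trans[OF sym])
    then have "normsq n (($) u) = 1" by (simp only: of_real_eq_1_iff)
    moreover have "x = form n A (($) u) (($) u)" using form[OF u(1)] u(3) by simp
    ultimately show ?thesis by (intro image_eqI CollectI)
  qed
  show ?thesis
  proof (rule equalityI; rule subsetI)
    fix x assume "x \<in> (\<lambda>u. form n A u u) ` {u. normsq n u = 1}"
    then show "x \<in> numerical_range A" by (rule imageE) (simp add: in1)
  qed (rule in2)
qed

text \<open>The unit sphere is compact in the product topology, so the supremum is a maximum.\<close>

lemma numerical_radius_attained:
  assumes A: "A \<in> carrier_mat n n" and "n > 0"
  obtains u where "normsq n u = 1" "cmod (form n A u u) = numerical_radius A"
    "\<forall>v. normsq n v = 1 \<longrightarrow> cmod (form n A v v) \<le> numerical_radius A"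
proof -
  have coord: "continuous_on UNIV (\<lambda>u :: nat \<Rightarrow> complex. u i)" for i
    by (rule continuous_on_product_coordinates)
  define S :: "(nat \<Rightarrow> complex) set"
    where "S = PiE UNIV (\<lambda>i. if i < n then cball 0 1 else {0}) \<inter> {u. normsq n u = 1}"
  have "compactin (product_topology (\<lambda>i. euclidean) UNIV)
      (PiE UNIV (\<lambda>i::nat. if i < n then cball (0::complex) 1 else {0}))"
    by (simp add: compactin_PiE)
  then have "compact (PiE UNIV (\<lambda>i::nat. if i < n then cball (0::complex) 1 else {0}))"
    by (simp add: euclidean_product_topology flip: compactin_euclidean_iff)
  moreover have "continuous_on UNIV (normsq n)"
    unfolding normsq_def by (intro continuous_intros coord)
  then have "closed {u. normsq n u = 1}"
    by (intro closed_Collect_eq continuous_on_const)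
  ultimately have compact: "compact S"
    unfolding S_def by (rule compact_Int_closed)
  have "normsq n (\<lambda>i. if i = 0 then 1 else 0) = (\<Sum>i<n. if i = 0 then 1 else 0)"
    unfolding normsq_def by (intro sum.cong) simp_all
  then have "(\<lambda>i. if i = 0 then 1 else 0) \<in> S"
    using \<open>n > 0\<close> unfolding S_def by (simp add: PiE_iff)
  then have nonempty: "S \<noteq> {}" by blast
  have "continuous_on UNIV (\<lambda>u. cmod (form n A u u))"
    unfolding form_def by (intro continuous_intros coord)
  then have "continuous_on S (\<lambda>u. cmod (form n A u u))"
    by (rule continuous_on_subset) simp
  from continuous_attains_sup[OF compact nonempty this]
  obtain u where u: "u \<in> S" "\<forall>v\<in>S. cmod (form n A v v) \<le> cmod (form n A u u)"
    by blast
  have max: "cmod (form n A v v) \<le> cmod (form n A u u)" if v: "normsq n v = 1" for v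
  proof -
    let ?v = "\<lambda>i. if i < n then v i else 0"
    have "cmod (v i) \<le> 1" if "i < n" for i
    proof -
      have "(cmod (v i))\<^sup>2 \<le> normsq n v"
        unfolding normsq_def using that by (intro member_le_sum) auto
      with v show ?thesis by (simp add: power_le_one_iff)
    qed
    moreover have "normsq n ?v = 1" using v by (simp add: normsq_def)
    ultimately have "?v \<in> S" unfolding S_def by (simp add: PiE_iff)
    with u(2) have "cmod (form n A ?v ?v) \<le> cmod (form n A u u)" by blast
    then show ?thesis by (simp add: form_def)
  qed
  have u1: "normsq n u = 1" using u(1) by (simp add: S_def)
  have radius: "numerical_radius A = cmod (form n A u u)"
    unfolding numerical_radius_def numerical_range_eq[OF A] image_image
  proof (rule cSup_eq_maximum)
    show "cmod (form n A u u) \<in> (\<lambda>u. cmod (form n A u u)) ` {u. normsq n u = 1}"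
      using u1 by (intro imageI CollectI)
  next
    fix y assume "y \<in> (\<lambda>u. cmod (form n A u u)) ` {u. normsq n u = 1}"
    then show "y \<le> cmod (form n A u u)" by (rule imageE) (simp add: max)
  qed
  show ?thesis
  proof (rule that[OF u1])
    show "cmod (form n A u u) = numerical_radius A" by (rule radius[symmetric])
    show "\<forall>v. normsq n v = 1 \<longrightarrow> cmod (form n A v v) \<le> numerical_radius A"
      unfolding radius using max by simp
  qed
qed

lemma form_le_numerical_radius:
  assumes A: "A \<in> carrier_mat n n"
  shows "cmod (form n A v v) \<le> numerical_radius A * normsq n v"
proof (cases "normsq n v = 0")
  case True
  then have "form n A v v = 0" using normsq_eq_0[of n v] by (simp add: form_def)
  then show ?thesis using True by simp
next
  case False
  then have pos: "normsq n v > 0" using normsq_nonneg[of n v] by linarith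
  then have "n > 0" by (auto simp: normsq_def intro: gr0I)
  obtain u where "normsq n u = 1" "cmod (form n A u u) = numerical_radius A"
    and u: "\<forall>v. normsq n v = 1 \<longrightarrow> cmod (form n A v v) \<le> numerical_radius A"
    by (rule numerical_radius_attained[OF A \<open>n > 0\<close>])
  define c where "c = complex_of_real (1 / sqrt (normsq n v))"
  have c: "(cmod c)\<^sup>2 = 1 / normsq n v" "cnj c * c = complex_of_real (1 / normsq n v)"
    using pos by (simp_all add: c_def norm_divide power_divide flip: of_real_mult)
  have "normsq n (\<lambda>i. c * v i) = 1" using c pos by (simp add: normsq_scale)
  with u have "cmod (form n A (\<lambda>i. c * v i) (\<lambda>i. c * v i)) \<le> numerical_radius A"
    by blast
  then have "cmod (cnj c * c * form n A v v) \<le> numerical_radius A"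
    by (simp only: form_scale)
  then have "1 / normsq n v * cmod (form n A v v) \<le> numerical_radius A"
    using pos unfolding c(2) by (simp add: norm_mult norm_divide)
  then show ?thesis using pos by (simp add: field_simps)
qed

lemma numerical_radius_leI:
  assumes A: "A \<in> carrier_mat n n" and "n > 0"
    and "\<And>v. cmod (form n A v v) \<le> r * normsq n v"
  shows "numerical_radius A \<le> r"
proof -
  obtain u where "normsq n u = 1" "cmod (form n A u u) = numerical_radius A"
    by (rule numerical_radius_attained[OF A \<open>n > 0\<close>])
  then show ?thesis using assms(3)[of u] by simp
qed

section \<open>Linear functionals and spanning sets of matrices\<close>

definition linear_functional :: "nat \<Rightarrow> (complex mat \<Rightarrow> complex) \<Rightarrow> bool" where
  "linear_functional n l \<longleftrightarrow>
    (\<forall>X\<in>carrier_mat n n. \<forall>Y\<in>carrier_mat n n. l (X + Y) = l X + l Y) \<and>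
    (\<forall>c. \<forall>X\<in>carrier_mat n n. l (c \<cdot>\<^sub>m X) = c * l X)"

lemma linear_functionalI:
  assumes "\<And>X Y. X \<in> carrier_mat n n \<Longrightarrow> Y \<in> carrier_mat n n \<Longrightarrow> l (X + Y) = l X + l Y"
    and "\<And>c X. X \<in> carrier_mat n n \<Longrightarrow> l (c \<cdot>\<^sub>m X) = c * l X"
  shows "linear_functional n l"
  using assms by (simp add: linear_functional_def)

lemma linear_functional_add:
  "linear_functional n l \<Longrightarrow> X \<in> carrier_mat n n \<Longrightarrow> Y \<in> carrier_mat n n \<Longrightarrow> l (X + Y) = l X + l Y"
  by (simp add: linear_functional_def)

lemma linear_functional_smult:
  "linear_functional n l \<Longrightarrow> X \<in> carrier_mat n n \<Longrightarrow> l (c \<cdot>\<^sub>m X) = c * l X"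
  by (simp add: linear_functional_def)

lemma linear_functional_zero:
  assumes "linear_functional n l" shows "l (0\<^sub>m n n) = 0"
  using linear_functional_smult[OF assms zero_carrier_mat, of 0] by simp

lemma linear_functional_diff:
  assumes "linear_functional n l" "linear_functional n k"
  shows "linear_functional n (\<lambda>X. l X - k X)"
  using assms by (simp add: linear_functional_def algebra_simps)

lemma linear_functional_supported:
  assumes l: "linear_functional n l" and "finite S" "S \<subseteq> {..<n} \<times> {..<n}"
  shows "l (mat n n (\<lambda>p. if p \<in> S then f p else 0))
    = (\<Sum>p\<in>S. f p * l (unit_mat n (fst p) (snd p)))"
  using assms(2,3)
proof (induction S rule: finite_induct)
  case empty
  have "mat n n (\<lambda>p. if p \<in> {} then f p else 0) = 0\<^sub>m n n"
    by (rule eq_matI) simp_all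
  then show ?case using linear_functional_zero[OF l] by simp
next
  case (insert q S)
  have "mat n n (\<lambda>p. if p \<in> insert q S then f p else 0)
      = mat n n (\<lambda>p. if p \<in> S then f p else 0) + f q \<cdot>\<^sub>m unit_mat n (fst q) (snd q)"
    using insert.hyps(2) by (intro eq_matI) (auto simp: prod_eq_iff)
  also have "l \<dots> = l (mat n n (\<lambda>p. if p \<in> S then f p else 0)) + f q * l (unit_mat n (fst q) (snd q))"
    by (simp add: linear_functional_add[OF l] linear_functional_smult[OF l])
  finally show ?case using insert by simp
qed

lemma linear_functional_expand:
  assumes l: "linear_functional n l" and X: "X \<in> carrier_mat n n"
  shows "l X = (\<Sum>a<n. \<Sum>b<n. X $$ (a, b) * l (unit_mat n a b))"
proof -
  have "X = mat n n (\<lambda>p. if p \<in> {..<n} \<times> {..<n} then X $$ p else 0)"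
    using X by (intro eq_matI) simp_all
  then have "l X = l (mat n n (\<lambda>p. if p \<in> {..<n} \<times> {..<n} then X $$ p else 0))"
    by (rule arg_cong)
  also have "\<dots> = (\<Sum>p\<in>{..<n} \<times> {..<n}. X $$ p * l (unit_mat n (fst p) (snd p)))"
    by (rule linear_functional_supported[OF l]) simp_all
  also have "\<dots> = (\<Sum>a<n. \<Sum>b<n. X $$ (a, b) * l (unit_mat n a b))"
    by (simp add: sum.cartesian_product split_def)
  finally show ?thesis .
qed

lemma linear_functional_diag:
  assumes l: "linear_functional n l"
  shows "l (mat_diag n d) = (\<Sum>a<n. d a * l (unit_mat n a a))"
proof -
  have "l (mat_diag n d) = (\<Sum>a<n. \<Sum>b<n. mat_diag n d $$ (a, b) * l (unit_mat n a b))"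
    by (rule linear_functional_expand[OF l]) simp
  also have "\<dots> = (\<Sum>a<n. \<Sum>b<n. if b = a then d a * l (unit_mat n a a) else 0)"
    by (intro sum.cong refl) (simp add: mat_diag_def)
  finally show ?thesis by simp
qed

text \<open>The dual form of spanning. It replaces linear combinations of matrices, which would need a
  zero matrix of a type that does not determine the size.\<close>
definition spanning :: "nat \<Rightarrow> complex mat set \<Rightarrow> bool" where
  "spanning n B \<longleftrightarrow> (\<forall>l. linear_functional n l \<longrightarrow> (\<forall>X\<in>B. l X = 0) \<longrightarrow> (\<forall>X\<in>carrier_mat n n. l X = 0))"

lemma spanning_unit_mats: "spanning n {unit_mat n a b | a b. a < n \<and> b < n}"
  unfolding spanning_def
proof (intro allI impI ballI)
  fix l :: "complex mat \<Rightarrow> complex" and X :: "complex mat"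
  assume l: "linear_functional n l" and 0: "\<forall>X\<in>{unit_mat n a b | a b. a < n \<and> b < n}. l X = 0"
    and X: "X \<in> carrier_mat n n"
  have "l (unit_mat n a b) = 0" if "a < n" "b < n" for a b
    using 0 that by blast
  then show "l X = 0" by (simp add: linear_functional_expand[OF l X])
qed

definition hermitians :: "nat \<Rightarrow> complex mat set" where
  "hermitians n = {X \<in> carrier_mat n n. X\<^sup>\<dagger> = X}"

lemma spanning_hermitians: "spanning n (hermitians n)"
  unfolding spanning_def
proof (intro allI impI ballI)
  fix l :: "complex mat \<Rightarrow> complex" and X :: "complex mat"
  assume l: "linear_functional n l" and 0: "\<forall>X\<in>hermitians n. l X = 0"
    and X: "X \<in> carrier_mat n n"
  define H where "H = (1/2) \<cdot>\<^sub>m (X + X\<^sup>\<dagger>)"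
  define K where "K = (- \<i>/2) \<cdot>\<^sub>m (X + (-1) \<cdot>\<^sub>m X\<^sup>\<dagger>)"
  have car: "H \<in> carrier_mat n n" "K \<in> carrier_mat n n" using X by (simp_all add: H_def K_def)
  have "H\<^sup>\<dagger> = H" "K\<^sup>\<dagger> = K" unfolding H_def K_def
    by (rule eq_matI; use X in \<open>simp add: algebra_simps\<close>)+
  then have H: "H \<in> hermitians n" "K \<in> hermitians n" using car by (simp_all add: hermitians_def)
  have "X = H + \<i> \<cdot>\<^sub>m K" unfolding H_def K_def
    by (rule eq_matI; use X in \<open>simp add: field_simps\<close>)
  then have "l X = l H + \<i> * l K"
    using car by (simp add: linear_functional_add[OF l] linear_functional_smult[OF l])
  then show "l X = 0" using 0 H by simp
qed

section \<open>Kronecker products in mixed-radix coordinates\<close>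

definition families :: "nat \<Rightarrow> (nat \<Rightarrow> nat) \<Rightarrow> (nat \<Rightarrow> complex mat) set" where
  "families m n = {A. \<forall>j<m. A j \<in> carrier_mat (n j) (n j)}"

lemma familiesD: "A \<in> families m n \<Longrightarrow> j < m \<Longrightarrow> A j \<in> carrier_mat (n j) (n j)"
  by (simp add: families_def)

lemma families_update: "A \<in> families m n \<Longrightarrow> X \<in> carrier_mat (n j) (n j) \<Longrightarrow> A(j := X) \<in> families m n"
  by (simp add: families_def)

text \<open>The digits of a row index of a Kronecker product are the row indices in the factors.\<close>
primrec digit :: "nat \<Rightarrow> (nat \<Rightarrow> nat) \<Rightarrow> nat \<Rightarrow> nat \<Rightarrow> nat" where
  "digit 0 n p = (\<lambda>j. 0)"
| "digit (Suc m) n p = (\<lambda>j. if j = m then p mod n m else digit m n (p div n m) j)"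

lemma digit_less: "(\<And>j. j < m \<Longrightarrow> n j > 0) \<Longrightarrow> j < m \<Longrightarrow> digit m n p j < n j"
proof (induction m arbitrary: p)
  case (Suc m)
  have "digit m n (p div n m) j < n j" if "j < m"
    using Suc.IH[of "p div n m"] Suc.prems(1) that by simp
  moreover have "p mod n m < n m" using Suc.prems(1)[of m] by simp
  ultimately show ?case using Suc.prems(2) by (auto simp: less_Suc_eq)
qed simp

lemma digit_inject:
  assumes "p < (\<Prod>j<m. n j)" "q < (\<Prod>j<m. n j)" "\<And>j. j < m \<Longrightarrow> digit m n p j = digit m n q j"
  shows "p = q"
  using assms
proof (induction m arbitrary: p q)
  case (Suc m)
  have "p div n m = q div n m"
  proof (rule Suc.IH)
    show "p div n m < (\<Prod>j<m. n j)" "q div n m < (\<Prod>j<m. n j)"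
      using Suc.prems(1,2) by (simp_all add: less_mult_imp_div_less)
    show "digit m n (p div n m) j = digit m n (q div n m) j" if "j < m" for j
      using Suc.prems(3)[of j] that by simp
  qed
  moreover have "p mod n m = q mod n m" using Suc.prems(3)[of m] by simp
  ultimately show ?case by (metis div_mult_mod_eq)
qed simp

lemma div_mod_digit:
  fixes a b n :: nat
  assumes "b < n" shows "(a * n + b) div n = a" "(a * n + b) mod n = b"
  using assms by simp_all

lemma less_mult_digit:
  fixes a b n P :: nat
  assumes "a < P" "b < n" shows "a * n + b < P * n"
proof -
  have "a * n + b < a * n + n" using assms(2) by simp
  also have "\<dots> = Suc a * n" by simp
  also have "\<dots> \<le> P * n" using assms(1) by (intro mult_right_mono) simp_all
  finally show ?thesis .
qed

lemma digit_surject: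
  assumes "\<And>j. j < m \<Longrightarrow> d j < n j"
  shows "\<exists>p < (\<Prod>j<m. n j). \<forall>j<m. digit m n p j = d j"
  using assms
proof (induction m)
  case (Suc m)
  then obtain p where p: "p < (\<Prod>j<m. n j)" "\<forall>j<m. digit m n p j = d j"
    by fastforce
  have dm: "d m < n m" using Suc.prems by simp
  have "\<forall>j<Suc m. digit (Suc m) n (p * n m + d m) j = d j"
    using p(2) dm by (simp add: less_Suc_eq div_mod_digit[OF dm] del: div_mult_self3 div_mult_self4)
  moreover have "p * n m + d m < (\<Prod>j<Suc m. n j)"
    using less_mult_digit[OF p(1) dm] by simp
  ultimately show ?case by blast
qed simp

lemma sum_div_mod:
  fixes g :: "nat \<Rightarrow> nat \<Rightarrow> 'a :: comm_monoid_add"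
  shows "(\<Sum>t<P * n. g (t div n) (t mod n)) = (\<Sum>a<P. \<Sum>b<n. g a b)"
proof -
  have "(\<Sum>t<P * n. g (t div n) (t mod n)) = (\<Sum>(a, b)\<in>{..<P} \<times> {..<n}. g a b)"
  proof (rule sum.reindex_bij_witness[of _ "\<lambda>(a, b). a * n + b" "\<lambda>t. (t div n, t mod n)"])
    fix t assume "t \<in> {..<P * n}"
    then have t: "t < P * n" by simp
    then have "n > 0" by (cases n) simp_all
    with t show "(t div n, t mod n) \<in> {..<P} \<times> {..<n}"
      by (simp add: less_mult_imp_div_less)
  next
    fix q assume "q \<in> {..<P} \<times> {..<n}"
    then obtain a b where q: "q = (a, b)" "a < P" "b < n" by auto
    show "(case q of (a, b) \<Rightarrow> a * n + b) \<in> {..<P * n}"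
      using less_mult_digit[OF q(2,3)] q(1) by simp
    show "((case q of (a, b) \<Rightarrow> a * n + b) div n, (case q of (a, b) \<Rightarrow> a * n + b) mod n) = q"
      using div_mod_digit[OF q(3), of a] q(1) by simp
  qed simp_all
  then show ?thesis by (simp add: sum.cartesian_product)
qed

text \<open>The digits run independently of each other, so a sum of products over all multi-indices factors.\<close>
lemma sum_prod_digit:
  fixes f :: "nat \<Rightarrow> nat \<Rightarrow> 'a :: comm_semiring_1"
  shows "(\<Sum>t<(\<Prod>j<m. n j). \<Prod>j<m. f j (digit m n t j)) = (\<Prod>j<m. \<Sum>s<n j. f j s)"
proof (induction m)
  case (Suc m)
  have "(\<Prod>j<Suc m. f j (digit (Suc m) n t j))
      = (\<Prod>j<m. f j (digit m n (t div n m) j)) * f m (t mod n m)" for t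
    by (simp add: mult.commute)
  then have "(\<Sum>t<(\<Prod>j<Suc m. n j). \<Prod>j<Suc m. f j (digit (Suc m) n t j))
      = (\<Sum>t<(\<Prod>j<m. n j) * n m. (\<Prod>j<m. f j (digit m n (t div n m) j)) * f m (t mod n m))"
    by (simp only: prod.lessThan_Suc[of n])
  also have "\<dots> = (\<Sum>a<(\<Prod>j<m. n j). \<Sum>b<n m. (\<Prod>j<m. f j (digit m n a j)) * f m b)"
    by (rule sum_div_mod)
  also have "\<dots> = (\<Sum>a<(\<Prod>j<m. n j). \<Prod>j<m. f j (digit m n a j)) * (\<Sum>b<n m. f m b)"
    by (simp only: sum_product)
  finally show ?case by (simp add: Suc.IH)
qed simp

lemma kronecker_family_in_carrier:
  "A \<in> families m n \<Longrightarrow> kronecker_family m A \<in> carrier_mat (\<Prod>j<m. n j) (\<Prod>j<m. n j)"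
  by (rule kronecker_family_carrier) (simp add: families_def)

lemma kronecker_family_index:
  assumes "A \<in> families m n" "p < (\<Prod>j<m. n j)" "q < (\<Prod>j<m. n j)"
  shows "kronecker_family m A $$ (p, q) = (\<Prod>j<m. A j $$ (digit m n p j, digit m n q j))"
  using assms
proof (induction m arbitrary: p q)
  case (Suc m)
  let ?P = "\<Prod>j<m. n j"
  have A: "A \<in> families m n" and Am: "A m \<in> carrier_mat (n m) (n m)"
    using Suc.prems(1) by (simp_all add: families_def)
  have K: "kronecker_family m A \<in> carrier_mat ?P ?P" by (rule kronecker_family_in_carrier[OF A])
  have pq: "p < ?P * n m" "q < ?P * n m" using Suc.prems(2,3) by simp_all
  have "kronecker_family (Suc m) A $$ (p, q)
      = kronecker_family m A $$ (p div n m, q div n m) * A m $$ (p mod n m, q mod n m)"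
    using K Am pq by (simp add: kronecker_def)
  also have "kronecker_family m A $$ (p div n m, q div n m)
      = (\<Prod>j<m. A j $$ (digit m n (p div n m) j, digit m n (q div n m) j))"
    using pq by (intro Suc.IH A) (simp_all add: less_mult_imp_div_less)
  finally show ?case by simp
qed simp

lemma kronecker_family_cong:
  "(\<And>j. j < m \<Longrightarrow> A j = B j) \<Longrightarrow> kronecker_family m A = kronecker_family m B"
  by (induction m) simp_all

lemma kronecker_family_mult:
  assumes A: "A \<in> families m n" and B: "B \<in> families m n" and n: "\<And>j. j < m \<Longrightarrow> n j > 0"
  shows "kronecker_family m A * kronecker_family m B = kronecker_family m (\<lambda>j. A j * B j)"
proof -
  let ?P = "\<Prod>j<m. n j"
  have AB: "(\<lambda>j. A j * B j) \<in> families m n" using A B by (simp add: families_def)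
  note car = kronecker_family_in_carrier[OF A] kronecker_family_in_carrier[OF B]
    kronecker_family_in_carrier[OF AB]
  show ?thesis
  proof (rule eq_matI)
    fix p q assume "p < dim_row (kronecker_family m (\<lambda>j. A j * B j))"
      "q < dim_col (kronecker_family m (\<lambda>j. A j * B j))"
    then have pq: "p < ?P" "q < ?P" using car by simp_all
    have "(kronecker_family m A * kronecker_family m B) $$ (p, q)
        = (\<Sum>t<?P. kronecker_family m A $$ (p, t) * kronecker_family m B $$ (t, q))"
      by (rule index_mult_sum[OF car(1,2) pq])
    also have "\<dots> = (\<Sum>t<?P. \<Prod>j<m. A j $$ (digit m n p j, digit m n t j) * B j $$ (digit m n t j, digit m n q j))"
      by (intro sum.cong refl)
        (simp add: kronecker_family_index[OF A pq(1)] kronecker_family_index[OF B _ pq(2)] prod.distrib)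
    also have "\<dots> = (\<Prod>j<m. \<Sum>s<n j. A j $$ (digit m n p j, s) * B j $$ (s, digit m n q j))"
      by (rule sum_prod_digit)
    also have "\<dots> = (\<Prod>j<m. (A j * B j) $$ (digit m n p j, digit m n q j))"
      by (intro prod.cong refl index_mult_sum[OF familiesD[OF A] familiesD[OF B], symmetric])
        (simp_all add: digit_less n)
    also have "\<dots> = kronecker_family m (\<lambda>j. A j * B j) $$ (p, q)"
      by (rule kronecker_family_index[OF AB pq, symmetric])
    finally show "(kronecker_family m A * kronecker_family m B) $$ (p, q)
        = kronecker_family m (\<lambda>j. A j * B j) $$ (p, q)" .
  qed (use car in simp_all)
qed

lemma kronecker_family_adjoint:
  assumes A: "A \<in> families m n" and n: "\<And>j. j < m \<Longrightarrow> n j > 0"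
  shows "(kronecker_family m A)\<^sup>\<dagger> = kronecker_family m (\<lambda>j. (A j)\<^sup>\<dagger>)"
proof -
  have A': "(\<lambda>j. (A j)\<^sup>\<dagger>) \<in> families m n" using A by (simp add: families_def)
  note car = kronecker_family_in_carrier[OF A] kronecker_family_in_carrier[OF A']
  have dims: "j < m \<Longrightarrow> dim_row (A j) = n j" "j < m \<Longrightarrow> dim_col (A j) = n j" for j
    by (drule familiesD[OF A], simp)+
  show ?thesis
    by (rule eq_matI)
      (use car in \<open>simp_all add: kronecker_family_index[OF A] kronecker_family_index[OF A'] digit_less n dims\<close>)
qed

lemma kronecker_family_transpose:
  assumes A: "A \<in> families m n" and n: "\<And>j. j < m \<Longrightarrow> n j > 0"
  shows "transpose_mat (kronecker_family m A) = kronecker_family m (\<lambda>j. transpose_mat (A j))"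
proof -
  have A': "(\<lambda>j. transpose_mat (A j)) \<in> families m n" using A by (simp add: families_def)
  note car = kronecker_family_in_carrier[OF A] kronecker_family_in_carrier[OF A']
  have dims: "j < m \<Longrightarrow> dim_row (A j) = n j" "j < m \<Longrightarrow> dim_col (A j) = n j" for j
    by (drule familiesD[OF A], simp)+
  show ?thesis
    by (rule eq_matI)
      (use car in \<open>simp_all add: kronecker_family_index[OF A] kronecker_family_index[OF A'] digit_less n dims\<close>)
qed

lemma prod_indicator:
  "(\<Prod>j<(m::nat). if P j then 1 else 0 :: 'a :: comm_semiring_1) = (if \<forall>j<m. P j then 1 else 0)"
  by (induction m) (auto simp: less_Suc_eq)

lemma kronecker_family_unit_mat:
  assumes n: "\<And>j. j < m \<Longrightarrow> n j > 0" and rs: "r < (\<Prod>j<m. n j)" "s < (\<Prod>j<m. n j)"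
  shows "kronecker_family m (\<lambda>j. unit_mat (n j) (digit m n r j) (digit m n s j))
    = unit_mat (\<Prod>j<m. n j) r s" (is "kronecker_family m ?E = _")
proof -
  have E: "?E \<in> families m n" by (simp add: families_def)
  note car = kronecker_family_in_carrier[OF E]
  show ?thesis
  proof (rule eq_matI)
    fix p q assume "p < dim_row (unit_mat (\<Prod>j<m. n j) r s)" "q < dim_col (unit_mat (\<Prod>j<m. n j) r s)"
    then have pq: "p < (\<Prod>j<m. n j)" "q < (\<Prod>j<m. n j)" by simp_all
    have "kronecker_family m ?E $$ (p, q)
        = (\<Prod>j<m. if digit m n p j = digit m n r j \<and> digit m n q j = digit m n s j then 1 else 0)"
      unfolding kronecker_family_index[OF E pq]
      by (intro prod.cong refl) (simp add: digit_less n)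
    also have "\<dots> = (if p = r \<and> q = s then 1 else 0)"
      unfolding prod_indicator using digit_inject[OF pq(1) rs(1)] digit_inject[OF pq(2) rs(2)] by auto
    finally show "kronecker_family m ?E $$ (p, q) = unit_mat (\<Prod>j<m. n j) r s $$ (p, q)"
      using pq by simp
  qed (use car in simp_all)
qed

lemma kronecker_family_diag:
  fixes d :: "nat \<Rightarrow> nat \<Rightarrow> complex"
  assumes n: "\<And>j. j < m \<Longrightarrow> n j > 0"
  shows "kronecker_family m (\<lambda>j. mat_diag (n j) (d j))
    = mat_diag (\<Prod>j<m. n j) (\<lambda>p. \<Prod>j<m. d j (digit m n p j))" (is "kronecker_family m ?D = ?R")
proof -
  have D: "?D \<in> families m n" by (simp add: families_def)
  note car = kronecker_family_in_carrier[OF D]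
  show ?thesis
  proof (rule eq_matI)
    fix p q assume "p < dim_row ?R" "q < dim_col ?R"
    then have pq: "p < (\<Prod>j<m. n j)" "q < (\<Prod>j<m. n j)" by (simp_all add: mat_diag_def)
    have "kronecker_family m ?D $$ (p, q)
        = (\<Prod>j<m. d j (digit m n p j) * (if digit m n p j = digit m n q j then 1 else 0))"
      unfolding kronecker_family_index[OF D pq]
      by (intro prod.cong refl) (simp add: digit_less n mat_diag_def)
    also have "\<dots> = (\<Prod>j<m. d j (digit m n p j)) * (if p = q then 1 else 0)"
      unfolding prod.distrib prod_indicator using digit_inject[OF pq] by auto
    finally show "kronecker_family m ?D $$ (p, q) = ?R $$ (p, q)"
      using pq by (simp add: mat_diag_def)
  qed (use car in \<open>simp_all add: mat_diag_def\<close>)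
qed

lemma kronecker_family_one:
  assumes n: "\<And>j. j < m \<Longrightarrow> n j > 0"
  shows "kronecker_family m (\<lambda>j. 1\<^sub>m (n j)) = (1\<^sub>m (\<Prod>j<m. n j) :: complex mat)"
  using kronecker_family_diag[of m n "\<lambda>_ _. 1"] n by simp

lemma kronecker_family_unitary:
  assumes V: "\<And>j. j < m \<Longrightarrow> V j \<in> unitaries (n j)" and n: "\<And>j. j < m \<Longrightarrow> n j > 0"
  shows "kronecker_family m V \<in> unitaries (\<Prod>j<m. n j)"
proof -
  have fam: "V \<in> families m n" "(\<lambda>j. (V j)\<^sup>\<dagger>) \<in> families m n"
    using unitariesD(1)[OF V] by (simp_all add: families_def)
  have "(kronecker_family m V)\<^sup>\<dagger> * kronecker_family m V = kronecker_family m (\<lambda>j. (V j)\<^sup>\<dagger> * V j)"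
    by (simp add: kronecker_family_adjoint[OF fam(1) n] kronecker_family_mult[OF fam(2,1) n])
  also have "\<dots> = kronecker_family m (\<lambda>j. 1\<^sub>m (n j))"
    by (rule kronecker_family_cong) (simp add: unitariesD[OF V])
  also have "\<dots> = 1\<^sub>m (\<Prod>j<m. n j)" by (rule kronecker_family_one[OF n])
  finally show ?thesis
    using kronecker_family_in_carrier[OF fam(1)] by (simp add: unitaries_def)
qed

lemma kronecker_family_conj:
  assumes V: "\<And>j. j < m \<Longrightarrow> V j \<in> carrier_mat (n j) (n j)" and A: "A \<in> families m n"
    and n: "\<And>j. j < m \<Longrightarrow> n j > 0"
  shows "kronecker_family m (\<lambda>j. V j * A j * (V j)\<^sup>\<dagger>)
    = kronecker_family m V * kronecker_family m A * (kronecker_family m V)\<^sup>\<dagger>"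
proof -
  have fam: "V \<in> families m n" "(\<lambda>j. (V j)\<^sup>\<dagger>) \<in> families m n" "(\<lambda>j. V j * A j) \<in> families m n"
    using V A by (simp_all add: families_def)
  show ?thesis
    by (simp add: kronecker_family_adjoint[OF fam(1) n] kronecker_family_mult[OF fam(1) A n]
        kronecker_family_mult[OF fam(3,2) n])
qed

subsection \<open>Multilinear functions of a family\<close>

definition multilinear :: "nat \<Rightarrow> (nat \<Rightarrow> nat) \<Rightarrow> ((nat \<Rightarrow> complex mat) \<Rightarrow> complex) \<Rightarrow> bool" where
  "multilinear m n g \<longleftrightarrow>
    (\<forall>A\<in>families m n. \<forall>j<m. linear_functional (n j) (\<lambda>X. g (A(j := X))))"

lemma multilinearD:
  "multilinear m n g \<Longrightarrow> A \<in> families m n \<Longrightarrow> j < m \<Longrightarrow> linear_functional (n j) (\<lambda>X. g (A(j := X)))"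
  by (simp add: multilinear_def)

text \<open>The slots are freed one after the other from the restriction to the spanning sets.\<close>
lemma multilinear_eq_0:
  assumes g: "multilinear m n g" and B: "\<And>j. j < m \<Longrightarrow> spanning (n j) (B j)"
    and sub: "\<And>j. j < m \<Longrightarrow> B j \<subseteq> carrier_mat (n j) (n j)"
    and zero: "\<And>A. (\<And>j. j < m \<Longrightarrow> A j \<in> B j) \<Longrightarrow> g A = 0" and A: "A \<in> families m n"
  shows "g A = 0"
proof -
  have "k \<le> m \<Longrightarrow> (\<forall>A\<in>families m n. (\<forall>j. k \<le> j \<longrightarrow> j < m \<longrightarrow> A j \<in> B j) \<longrightarrow> g A = 0)" for k
  proof (induction k)
    case 0
    then show ?case using zero by simp
  next
    case (Suc k)
    then have k: "k < m" by simp
    show ?case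
    proof (intro ballI impI)
      fix A assume A: "A \<in> families m n" and AB: "\<forall>j. Suc k \<le> j \<longrightarrow> j < m \<longrightarrow> A j \<in> B j"
      have "g (A(k := X)) = 0" if X: "X \<in> B k" for X
      proof -
        have "A(k := X) \<in> families m n" using sub[OF k] X by (intro families_update A) blast
        moreover have "\<forall>j. k \<le> j \<longrightarrow> j < m \<longrightarrow> (A(k := X)) j \<in> B j"
          using AB X by (simp add: Suc_le_eq)
        ultimately show ?thesis using Suc.IH k by (meson less_imp_le)
      qed
      then have "g (A(k := A k)) = 0"
        using B[OF k] multilinearD[OF g A k] familiesD[OF A k] unfolding spanning_def by blast
      then show "g A = 0" by simp
    qed
  qed
  from this[of m] A show ?thesis by simp
qed

lemma multilinear_diff:
  assumes "multilinear m n g" "multilinear m n h"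
  shows "multilinear m n (\<lambda>A. g A - h A)"
  using assms by (simp add: multilinear_def linear_functional_diff)

lemma kronecker_family_index_update:
  assumes A: "A \<in> families m n" and j: "j < m" and Z: "Z \<in> carrier_mat (n j) (n j)"
    and pq: "p < (\<Prod>j<m. n j)" "q < (\<Prod>j<m. n j)"
  shows "kronecker_family m (A(j := Z)) $$ (p, q) = Z $$ (digit m n p j, digit m n q j) *
    (\<Prod>k\<in>{..<m} - {j}. A k $$ (digit m n p k, digit m n q k))"
proof -
  have "(\<Prod>k\<in>{..<m} - {j}. (A(j := Z)) k $$ (digit m n p k, digit m n q k))
      = (\<Prod>k\<in>{..<m} - {j}. A k $$ (digit m n p k, digit m n q k))"
    by (intro prod.cong) simp_all
  then show ?thesis
    unfolding kronecker_family_index[OF families_update[of A m n Z j, OF A Z] pq] using j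
    by (subst prod.remove[of "{..<m}" j]) simp_all
qed

lemma kronecker_family_update_add:
  assumes A: "A \<in> families m n" and j: "j < m" and n: "\<And>j. j < m \<Longrightarrow> n j > 0"
    and X: "X \<in> carrier_mat (n j) (n j)" and Y: "Y \<in> carrier_mat (n j) (n j)"
  shows "kronecker_family m (A(j := X + Y))
    = kronecker_family m (A(j := X)) + kronecker_family m (A(j := Y))"
proof -
  have XY: "X + Y \<in> carrier_mat (n j) (n j)" using X Y by simp
  note fam = families_update[OF A XY] families_update[OF A X] families_update[OF A Y]
  note car = fam[THEN kronecker_family_in_carrier]
  have dl: "digit m n p j < n j" for p
    using digit_less[of m n j p] n j by blast
  show ?thesis
    by (rule eq_matI) (use car X Y in \<open>simp_all add: kronecker_family_index_update[OF A j]
      dl distrib_right del: fun_upd_apply\<close>)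
qed

lemma kronecker_family_update_smult:
  assumes A: "A \<in> families m n" and j: "j < m" and n: "\<And>j. j < m \<Longrightarrow> n j > 0"
    and X: "X \<in> carrier_mat (n j) (n j)"
  shows "kronecker_family m (A(j := c \<cdot>\<^sub>m X)) = c \<cdot>\<^sub>m kronecker_family m (A(j := X))"
proof -
  have cX: "c \<cdot>\<^sub>m X \<in> carrier_mat (n j) (n j)" using X by simp
  note fam = families_update[OF A cX] families_update[OF A X]
  note car = fam[THEN kronecker_family_in_carrier]
  have dl: "digit m n p j < n j" for p
    using digit_less[of m n j p] n j by blast
  show ?thesis
    by (rule eq_matI) (use car X in \<open>simp_all add: kronecker_family_index_update[OF A j]
      dl mult.assoc del: fun_upd_apply\<close>)
qed

lemma multilinear_kronecker:
  assumes l: "linear_functional (\<Prod>j<m. n j) l" and n: "\<And>j. j < m \<Longrightarrow> n j > 0"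
  shows "multilinear m n (\<lambda>A. l (kronecker_family m A))"
  unfolding multilinear_def
proof (intro ballI allI impI linear_functionalI)
  fix A j and X Y :: "complex mat" assume A: "A \<in> families m n" and j: "j < m"
    and X: "X \<in> carrier_mat (n j) (n j)" and Y: "Y \<in> carrier_mat (n j) (n j)"
  show "l (kronecker_family m (A(j := X + Y)))
      = l (kronecker_family m (A(j := X))) + l (kronecker_family m (A(j := Y)))"
    using linear_functional_add[OF l kronecker_family_in_carrier[OF families_update[of A m n X j, OF A X]]
        kronecker_family_in_carrier[OF families_update[of A m n Y j, OF A Y]]]
    by (simp only: kronecker_family_update_add[OF A j n X Y])
next
  fix A j c and X :: "complex mat" assume A: "A \<in> families m n" and j: "j < m" and X: "X \<in> carrier_mat (n j) (n j)"
  show "l (kronecker_family m (A(j := c \<cdot>\<^sub>m X))) = c * l (kronecker_family m (A(j := X)))"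
    using linear_functional_smult[OF l kronecker_family_in_carrier[OF families_update[of A m n X j, OF A X]]]
    by (simp only: kronecker_family_update_smult[OF A j n X])
qed

section \<open>Unitary diagonalisation of Hermitian matrices\<close>

lemma sum_mult_delta:
  fixes f :: "nat \<Rightarrow> complex"
  shows "i < n \<Longrightarrow> (\<Sum>t<n. f t * (if t = i then 1 else 0)) = f i"
    and "i < n \<Longrightarrow> (\<Sum>t<n. f t * (if i = t then 1 else 0)) = f i"
proof -
  have "(\<Sum>t<n. f t * (if t = i then 1 else 0)) = (\<Sum>t<n. if t = i then f t else 0)"
    "(\<Sum>t<n. f t * (if i = t then 1 else 0)) = (\<Sum>t<n. if t = i then f t else 0)"
    by (intro sum.cong; simp)+
  then show "i < n \<Longrightarrow> (\<Sum>t<n. f t * (if t = i then 1 else 0)) = f i"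
    and "i < n \<Longrightarrow> (\<Sum>t<n. f t * (if i = t then 1 else 0)) = f i"
    by simp_all
qed

text \<open>A Householder reflection. The phase \<open>\<omega>\<close> makes the coordinate 0 of the vector nonnegative, so that
  its sum with the first basis vector cannot vanish.\<close>
lemma unit_vector_extends_to_unitary:
  assumes v: "normsq n v = 1"
  obtains U where "U \<in> unitaries n" "\<forall>i<n. U $$ (i, 0) = v i"
proof -
  have n: "n > 0" using v by (cases n) (simp_all add: normsq_def)
  define a where "a = cmod (v 0)"
  define \<omega> where "\<omega> = (if v 0 = 0 then 1 else v 0 / of_real a)"
  have \<omega>: "\<omega> * cnj \<omega> = 1" "v 0 = of_real a * \<omega>"
  proof -
    have "cmod \<omega> = 1" by (simp add: \<omega>_def a_def norm_divide)
    then show "\<omega> * cnj \<omega> = 1" by (simp add: complex_norm_square[symmetric])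
    show "v 0 = of_real a * \<omega>" by (simp add: \<omega>_def a_def)
  qed
  have a: "a \<ge> 0" by (simp add: a_def)
  then have a1: "complex_of_real a + 1 \<noteq> 0"
    by (metis add_nonneg_eq_0_iff of_real_1 of_real_add of_real_eq_0_iff zero_le_one zero_neq_one)
  define w where "w i = cnj \<omega> * v i + (if i = 0 then 1 else 0)" for i
  have w0: "w 0 = of_real a + 1"
    using \<omega> by (simp add: w_def) (metis mult.assoc mult.commute mult.right_neutral)
  have ww: "(\<Sum>t<n. cnj (w t) * w t) = 2 * (of_real a + 1)"
  proof -
    have "cnj (w t) * w t = cnj (v t) * v t + (\<omega> * cnj (v t) + cnj \<omega> * v t + 1) * (if t = 0 then 1 else 0)" for t
    proof -
      have "cnj (w t) * w t = (\<omega> * cnj \<omega>) * (cnj (v t) * v t)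
        + (\<omega> * cnj (v t) + cnj \<omega> * v t + 1) * (if t = 0 then 1 else 0)"
        by (simp add: w_def algebra_simps)
      then show ?thesis by (simp only: \<omega>(1) mult_1)
    qed
    then have "(\<Sum>t<n. cnj (w t) * w t)
      = (\<Sum>t<n. cnj (v t) * v t) + (\<omega> * cnj (v 0) + cnj \<omega> * v 0 + 1)"
      using n by (simp only: sum.distrib sum_mult_delta)
    also have "(\<Sum>t<n. cnj (v t) * v t) = 1"
      using v by (simp flip: normsq_complex)
    also have "\<omega> * cnj (v 0) = of_real a * (\<omega> * cnj \<omega>)" unfolding \<omega>(2) by simp
    also have "cnj \<omega> * v 0 = of_real a * (\<omega> * cnj \<omega>)" unfolding \<omega>(2) by simp
    finally show ?thesis by (simp add: \<omega>(1))
  qed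
  \<comment> \<open>\<open>\<omega>\<close> times the reflection in the line through \<open>w\<close>, which exchanges the first basis
    vector and \<open>cnj \<omega> v\<close>.\<close>
  define U where "U = mat n n (\<lambda>(i, j). \<omega> * (w i * cnj (w j) / (of_real a + 1) - (if i = j then 1 else 0)))"
  have U: "U \<in> carrier_mat n n" by (simp add: U_def)
  have col: "U $$ (i, 0) = v i" if "i < n" for i
  proof -
    have "cnj (w 0) = of_real a + 1" by (simp add: w0)
    then have "U $$ (i, 0) = \<omega> * (w i - (if i = 0 then 1 else 0))"
      using that n a1 by (simp add: U_def)
    also have "\<dots> = (\<omega> * cnj \<omega>) * v i" by (simp add: w_def)
    finally show ?thesis by (simp add: \<omega>(1))
  qed
  have "U\<^sup>\<dagger> * U = 1\<^sub>m n"
  proof (rule eq_matI)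
    fix i j assume "i < dim_row (1\<^sub>m n :: complex mat)" "j < dim_col (1\<^sub>m n :: complex mat)"
    then have ij: "i < n" "j < n" by simp_all
    let ?\<alpha> = "w i / (of_real a + 1)" and ?\<beta> = "cnj (w j) / (of_real a + 1)"
    let ?d = "\<lambda>i t. if i = t then 1 else 0 :: complex"
    have "(U\<^sup>\<dagger> * U) $$ (i, j) = (\<Sum>t<n. cnj (U $$ (t, i)) * U $$ (t, j))"
      using U ij by (subst index_mult_sum[of _ n n _ n]) simp_all
    also have "\<dots> = (\<Sum>t<n. (?\<alpha> * ?\<beta>) * (cnj (w t) * w t) - (?\<alpha> * cnj (w t)) * ?d t j
        - (?\<beta> * w t) * ?d t i + ?d t j * ?d t i)"
    proof (intro sum.cong refl)
      fix t assume "t \<in> {..<n}"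
      then have "cnj (U $$ (t, i)) * U $$ (t, j) = (\<omega> * cnj \<omega>) *
        ((cnj (w t) * ?\<alpha> - ?d t i) * (w t * ?\<beta> - ?d t j))"
        using ij by (simp add: U_def)
      then show "cnj (U $$ (t, i)) * U $$ (t, j) = (?\<alpha> * ?\<beta>) * (cnj (w t) * w t)
        - (?\<alpha> * cnj (w t)) * ?d t j - (?\<beta> * w t) * ?d t i + ?d t j * ?d t i"
        unfolding \<omega>(1) by (simp add: algebra_simps)
    qed
    also have "\<dots> = (?\<alpha> * ?\<beta>) * (\<Sum>t<n. cnj (w t) * w t) - ?\<alpha> * cnj (w j) - ?\<beta> * w i + ?d i j"
      using ij by (simp only: sum.distrib sum_subtractf sum_mult_delta flip: sum_distrib_left)
    also have "\<dots> = ?d i j"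
    proof -
      have "x / s * (y / s) * (2 * s) - x / s * y - y / s * x + e = e" if "s \<noteq> 0" for x y s e :: complex
        using that by (simp add: field_simps)
      then show ?thesis unfolding ww using a1 by blast
    qed
    finally show "(U\<^sup>\<dagger> * U) $$ (i, j) = 1\<^sub>m n $$ (i, j)" using ij by simp
  qed (use U in simp_all)
  then have "U \<in> unitaries n" using U by (simp add: unitaries_def)
  then show ?thesis using col by (intro that allI impI)
qed

lemma diag_conj_index:
  assumes "V \<in> carrier_mat n n" "i < n" "j < n"
  shows "(V * mat_diag n d * V\<^sup>\<dagger>) $$ (i, j) = (\<Sum>t<n. V $$ (i, t) * d t * cnj (V $$ (j, t)))"
proof -
  have "(V * mat_diag n d * V\<^sup>\<dagger>) $$ (i, j) = (\<Sum>t<n. (V * mat_diag n d) $$ (i, t) * V\<^sup>\<dagger> $$ (t, j))"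
    using assms by (intro index_mult_sum[of _ n n _ n]) simp_all
  also have "\<dots> = (\<Sum>t<n. V $$ (i, t) * d t * cnj (V $$ (j, t)))"
    using assms by (intro sum.cong refl) (simp add: mat_diag_mult_right[of V n n])
  finally show ?thesis .
qed

text \<open>A unitary whose first column is a unit eigenvector splits off a block of size one, since the
  first row of a Hermitian matrix is determined by its first column.\<close>
lemma hermitian_diagonalisation:
  assumes "A \<in> hermitians n"
  shows "\<exists>V\<in>unitaries n. \<exists>d. A = V * mat_diag n (\<lambda>i. complex_of_real (d i)) * V\<^sup>\<dagger>"
  using assms
proof (induction n arbitrary: A)
  case 0
  then have "A \<in> carrier_mat 0 0" by (simp add: hermitians_def)
  then have "A = 1\<^sub>m 0 * mat_diag 0 (\<lambda>i. complex_of_real 0) * (1\<^sub>m 0)\<^sup>\<dagger>"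
    by (intro eq_matI) (simp_all add: mat_diag_def)
  then show ?case by (intro bexI[of _ "1\<^sub>m 0"] exI[of _ "\<lambda>_. 0"]) simp_all
next
  case (Suc n)
  then have A: "A \<in> carrier_mat (Suc n) (Suc n)" and herm: "A\<^sup>\<dagger> = A" by (simp_all add: hermitians_def)
  from spectrum_non_empty[OF A] obtain k where "eigenvalue A k"
    by (auto simp: spectrum_def)
  then obtain x where x: "x \<in> carrier_vec (Suc n)" "x \<noteq> 0\<^sub>v (Suc n)" "A *\<^sub>v x = k \<cdot>\<^sub>v x"
    using A by (auto simp: eigenvalue_def eigenvector_def)
  define r where "r = normsq (Suc n) (($) x)"
  have "r \<noteq> 0"
  proof
    assume "r = 0"
    then have "x = 0\<^sub>v (Suc n)"
      using x(1) normsq_eq_0[of "Suc n" "($) x"] by (intro eq_vecI) (simp_all add: r_def)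
    with x(2) show False by simp
  qed
  then have r: "r > 0" using normsq_nonneg[of "Suc n" "($) x"] unfolding r_def by linarith
  define v where "v = (\<lambda>i. complex_of_real (1 / sqrt r) * x $ i)"
  have "normsq (Suc n) v = 1"
    using r unfolding v_def normsq_scale r_def[symmetric] by (simp add: norm_divide power_divide)
  then obtain W where W: "W \<in> unitaries (Suc n)" and "\<forall>i<Suc n. W $$ (i, 0) = v i"
    by (rule unit_vector_extends_to_unitary)
  then have W0: "\<And>i. i < Suc n \<Longrightarrow> W $$ (i, 0) = v i" by blast
  note Wc = unitariesD[OF W]
  define B where "B = W\<^sup>\<dagger> * A * W"
  have B: "B \<in> carrier_mat (Suc n) (Suc n)" using Wc A by (simp add: B_def)
  have Bherm: "B\<^sup>\<dagger> = B"
    using unitary_conj_adjoint[OF Wc(4) A] by (simp add: B_def herm)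
  have eigen: "(A * W) $$ (s, 0) = k * W $$ (s, 0)" if s: "s < Suc n" for s
  proof -
    have "(A * W) $$ (s, 0) = (\<Sum>t<Suc n. A $$ (s, t) * W $$ (t, 0))"
      using A Wc(1) s by (intro index_mult_sum[of _ "Suc n" "Suc n" _ "Suc n"]) simp_all
    also have "\<dots> = (\<Sum>t<Suc n. complex_of_real (1 / sqrt r) * (A $$ (s, t) * x $ t))"
      by (intro sum.cong refl) (simp add: W0 v_def del: of_real_divide)
    also have "\<dots> = complex_of_real (1 / sqrt r) * (A *\<^sub>v x) $ s"
      using A x(1) s by (simp add: scalar_prod_def atLeast0LessThan sum_distrib_left distrib_left
          del: of_real_divide)
    also have "\<dots> = k * W $$ (s, 0)"
      using x s by (simp add: W0[OF s] v_def del: of_real_divide)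
    finally show ?thesis .
  qed
  have Bcol: "B $$ (i, 0) = (if i = 0 then k else 0)" if i: "i < Suc n" for i
  proof -
    have "B $$ (i, 0) = (W\<^sup>\<dagger> * (A * W)) $$ (i, 0)"
      using Wc A by (simp add: B_def assoc_mult_mat[of _ "Suc n" "Suc n" _ "Suc n" _ "Suc n"] del: index_mult_mat)
    also have "\<dots> = (\<Sum>s<Suc n. W\<^sup>\<dagger> $$ (i, s) * (A * W) $$ (s, 0))"
      using A Wc(1) i by (intro index_mult_sum[of _ "Suc n" "Suc n" _ "Suc n"]) simp_all
    also have "\<dots> = k * (\<Sum>s<Suc n. W\<^sup>\<dagger> $$ (i, s) * W $$ (s, 0))"
      unfolding sum_distrib_left by (intro sum.cong refl) (simp only: eigen lessThan_iff mult.left_commute)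
    also have "(\<Sum>s<Suc n. W\<^sup>\<dagger> $$ (i, s) * W $$ (s, 0)) = (W\<^sup>\<dagger> * W) $$ (i, 0)"
      using Wc(1) i by (intro index_mult_sum[of _ "Suc n" "Suc n" _ "Suc n", symmetric]) simp_all
    finally show ?thesis using i by (simp add: Wc(2))
  qed
  have Badj: "B $$ (i, j) = cnj (B $$ (j, i))" if "i < Suc n" "j < Suc n" for i j
  proof -
    have "B $$ (i, j) = B\<^sup>\<dagger> $$ (i, j)" by (simp only: Bherm)
    then show ?thesis using that B by simp
  qed
  have k: "cnj k = k" using Badj[of 0 0] Bcol[of 0] by simp
  have Brow: "B $$ (0, j) = (if j = 0 then k else 0)" if "j < Suc n" for j
    using Badj[of 0 j] Bcol[OF that] that k by simp
  define C where "C = mat n n (\<lambda>(i, j). B $$ (Suc i, Suc j))"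
  have "C\<^sup>\<dagger> = C"
    by (rule eq_matI) (simp_all add: C_def Badj[symmetric])
  then have "C \<in> hermitians n" by (simp add: hermitians_def C_def)
  from Suc.IH[OF this] obtain V d where V: "V \<in> unitaries n"
    and Cd: "C = V * mat_diag n (\<lambda>i. complex_of_real (d i)) * V\<^sup>\<dagger>"
    by blast
  note Vc = unitariesD[OF V]
  define V' where "V' = mat (Suc n) (Suc n) (\<lambda>(i, j). case i of 0 \<Rightarrow> (case j of 0 \<Rightarrow> 1 | Suc _ \<Rightarrow> 0)
    | Suc i' \<Rightarrow> (case j of 0 \<Rightarrow> 0 | Suc j' \<Rightarrow> V $$ (i', j')))"
  define d' where "d' = (\<lambda>i. case i of 0 \<Rightarrow> Re k | Suc i' \<Rightarrow> d i')"
  have V'c: "V' \<in> carrier_mat (Suc n) (Suc n)" by (simp add: V'_def)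
  have V'1: "V' $$ (0, 0) = 1" "\<And>i. i < n \<Longrightarrow> V' $$ (Suc i, 0) = 0"
    "\<And>j. j < n \<Longrightarrow> V' $$ (0, Suc j) = 0"
    "\<And>i j. i < n \<Longrightarrow> j < n \<Longrightarrow> V' $$ (Suc i, Suc j) = V $$ (i, j)"
    by (simp_all add: V'_def)
  have "V'\<^sup>\<dagger> * V' = 1\<^sub>m (Suc n)"
  proof (rule eq_matI)
    fix i j assume "i < dim_row (1\<^sub>m (Suc n) :: complex mat)" "j < dim_col (1\<^sub>m (Suc n) :: complex mat)"
    then have ij: "i < Suc n" "j < Suc n" by simp_all
    have "(V'\<^sup>\<dagger> * V') $$ (i, j) = (\<Sum>t<Suc n. cnj (V' $$ (t, i)) * V' $$ (t, j))"
      using V'c ij by (subst index_mult_sum[of _ "Suc n" "Suc n" _ "Suc n"]) simp_all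
    also have "\<dots> = cnj (V' $$ (0, i)) * V' $$ (0, j) + (\<Sum>t<n. cnj (V' $$ (Suc t, i)) * V' $$ (Suc t, j))"
      by (rule sum.lessThan_Suc_shift)
    also have "\<dots> = 1\<^sub>m (Suc n) $$ (i, j)"
    proof (cases i)
      case 0
      then show ?thesis using ij by (cases j) (simp_all add: V'1)
    next
      case i: (Suc i')
      show ?thesis
      proof (cases j)
        case 0
        then show ?thesis using ij i by (simp add: V'1)
      next
        case j: (Suc j')
        have "(\<Sum>t<n. cnj (V $$ (t, i')) * V $$ (t, j')) = (V\<^sup>\<dagger> * V) $$ (i', j')"
          using Vc(1) ij i j by (subst index_mult_sum[of _ n n _ n]) simp_all
        then show ?thesis using ij i j by (simp add: V'1 Vc(2))
      qed
    qed
    finally show "(V'\<^sup>\<dagger> * V') $$ (i, j) = 1\<^sub>m (Suc n) $$ (i, j)" .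
  qed (use V'c in simp_all)
  then have V': "V' \<in> unitaries (Suc n)" using V'c by (simp add: unitaries_def)
  have Bd: "B = V' * mat_diag (Suc n) (\<lambda>i. complex_of_real (d' i)) * V'\<^sup>\<dagger>" (is "B = ?R")
  proof (rule eq_matI)
    fix i j assume "i < dim_row ?R" "j < dim_col ?R"
    then have ij: "i < Suc n" "j < Suc n" using V'c by simp_all
    have "?R $$ (i, j) = (\<Sum>t<Suc n. V' $$ (i, t) * complex_of_real (d' t) * cnj (V' $$ (j, t)))"
      by (rule diag_conj_index[OF V'c ij])
    also have "\<dots> = V' $$ (i, 0) * complex_of_real (d' 0) * cnj (V' $$ (j, 0))
      + (\<Sum>t<n. V' $$ (i, Suc t) * complex_of_real (d' (Suc t)) * cnj (V' $$ (j, Suc t)))"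
      by (rule sum.lessThan_Suc_shift)
    also have "\<dots> = B $$ (i, j)"
    proof (cases i)
      case 0
      have "complex_of_real (Re k) = k" using k by (simp add: complex_eq_iff)
      then show ?thesis using ij 0 by (cases j) (simp_all add: V'1 Brow d'_def)
    next
      case i: (Suc i')
      show ?thesis
      proof (cases j)
        case 0
        then show ?thesis using ij i by (simp add: V'1 Bcol)
      next
        case j: (Suc j')
        have "(\<Sum>t<n. V $$ (i', t) * complex_of_real (d t) * cnj (V $$ (j', t))) = C $$ (i', j')"
          unfolding Cd using diag_conj_index[OF Vc(1)] ij i j by simp
        then show ?thesis using ij i j by (simp add: V'1 d'_def C_def)
      qed
    qed
    finally show "B $$ (i, j) = ?R $$ (i, j)" ..
  qed (use B V'c in simp_all)
  have "A = W * B * W\<^sup>\<dagger>"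
    using unitary_conj_cancel(2)[OF W A] by (simp add: B_def)
  also have "\<dots> = (W * V') * mat_diag (Suc n) (\<lambda>i. complex_of_real (d' i)) * (W * V')\<^sup>\<dagger>"
    unfolding Bd using Wc(1) V'c
    by (simp add: adjoint_mult[of _ "Suc n" "Suc n" _ "Suc n"]
        assoc_mult_mat[of _ "Suc n" "Suc n" _ "Suc n" _ "Suc n"])
  finally show ?case using unitaries_mult[OF W V'] by blast
qed

section \<open>Functionals that are unimodular on rank-one projections\<close>

definition rank_one_projections :: "nat \<Rightarrow> complex mat set" where
  "rank_one_projections n = {V * unit_mat n a a * V\<^sup>\<dagger> | V a. V \<in> unitaries n \<and> a < n}"

lemma unit_mat_eq_diag: "unit_mat n a a = mat_diag n (\<lambda>t. if t = a then 1 else 0)"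
  by (rule eq_matI) (auto simp: mat_diag_def)

lemma conj_unit_mat_index:
  assumes V: "V \<in> carrier_mat n n" and "a < n" "i < n" "j < n"
  shows "(V * unit_mat n a a * V\<^sup>\<dagger>) $$ (i, j) = V $$ (i, a) * cnj (V $$ (j, a))"
proof -
  have "(V * unit_mat n a a * V\<^sup>\<dagger>) $$ (i, j)
      = (\<Sum>t<n. V $$ (i, t) * (if t = a then 1 else 0) * cnj (V $$ (j, t)))"
    unfolding unit_mat_eq_diag by (rule diag_conj_index[OF V assms(3,4)])
  also have "\<dots> = (\<Sum>t<n. (V $$ (i, t) * cnj (V $$ (j, t))) * (if t = a then 1 else 0))"
    by (intro sum.cong refl) simp
  also have "\<dots> = V $$ (i, a) * cnj (V $$ (j, a))"
    using assms(2) by (rule sum_mult_delta)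
  finally show ?thesis .
qed

lemma unit_mat_rank_one: "a < k \<Longrightarrow> unit_mat k a a \<in> rank_one_projections k"
  unfolding rank_one_projections_def
  by (intro CollectI exI[of _ "1\<^sub>m k"] exI[of _ a])
    (simp add: left_mult_one_mat[of _ k k] right_mult_one_mat[of _ k k])

lemma rank_one_projections_carrier: "P \<in> rank_one_projections n \<Longrightarrow> P \<in> carrier_mat n n"
  by (auto simp: rank_one_projections_def unitaries_def)

lemma trace_rank_one_projection: "P \<in> rank_one_projections n \<Longrightarrow> trace_mat P = 1"
  by (auto simp: rank_one_projections_def trace_unitary_conj trace_unit_mat)

text \<open>Every vector is a multiple of the first column of a unitary, and both sides are homogeneous.\<close>
lemma unimodular_functional_quadratic:
  assumes l: "linear_functional n l" and P: "\<And>P. P \<in> rank_one_projections n \<Longrightarrow> cmod (l P) = 1"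
  shows "cmod (\<Sum>a<n. \<Sum>b<n. x a * cnj (x b) * l (unit_mat n a b)) = normsq n x"
proof (cases "normsq n x = 0")
  case True
  then show ?thesis using normsq_eq_0[OF True] by simp
next
  case False
  then have r: "normsq n x > 0" using normsq_nonneg[of n x] by linarith
  define c where "c = complex_of_real (1 / sqrt (normsq n x))"
  have c: "c * cnj c = complex_of_real (1 / normsq n x)"
    using r by (simp add: c_def flip: of_real_mult)
  have "normsq n (\<lambda>i. c * x i) = 1"
    using r unfolding normsq_scale by (simp add: c_def norm_divide power_divide)
  then obtain V where V: "V \<in> unitaries n" "\<forall>i<n. V $$ (i, 0) = c * x i"
    by (rule unit_vector_extends_to_unitary)
  have n: "n > 0" using r by (cases n) (simp_all add: normsq_def)
  let ?P = "V * unit_mat n 0 0 * V\<^sup>\<dagger>"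
  have mem: "?P \<in> rank_one_projections n"
    using V(1) n unfolding rank_one_projections_def by blast
  have "l ?P = (\<Sum>a<n. \<Sum>b<n. ?P $$ (a, b) * l (unit_mat n a b))"
    by (rule linear_functional_expand[OF l rank_one_projections_carrier[OF mem]])
  also have "\<dots> = (\<Sum>a<n. \<Sum>b<n. (c * cnj c) * (x a * cnj (x b) * l (unit_mat n a b)))"
    using n by (intro sum.cong refl)
      (simp add: conj_unit_mat_index[OF unitariesD(1)[OF V(1)]] V(2) del: index_mult_mat)
  also have "\<dots> = (c * cnj c) * (\<Sum>a<n. \<Sum>b<n. x a * cnj (x b) * l (unit_mat n a b))"
    by (simp only: sum_distrib_left)
  finally have "cmod (c * cnj c) * cmod (\<Sum>a<n. \<Sum>b<n. x a * cnj (x b) * l (unit_mat n a b)) = 1"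
    using P[OF mem] by (simp only: norm_mult)
  then show ?thesis unfolding c using r by (simp add: norm_divide field_simps)
qed

lemma two_point_sum:
  fixes f :: "nat \<Rightarrow> 'a :: comm_monoid_add"
  assumes "a < n" "b < n" "a \<noteq> b" "\<And>i. i < n \<Longrightarrow> i \<noteq> a \<Longrightarrow> i \<noteq> b \<Longrightarrow> f i = 0"
  shows "(\<Sum>i<n. f i) = f a + f b"
proof -
  have "(\<Sum>i<n. f i) = (\<Sum>i\<in>{a, b}. f i)"
    by (rule sum.mono_neutral_right) (use assms in auto)
  then show ?thesis using assms(3) by simp
qed

text \<open>The value of a binary sesquilinear form at \<open>(1, r \<omega>)\<close>. The values at \<open>\<omega>\<close> and \<open>- \<omega>\<close> have the same
  modulus, so the off-diagonal part is orthogonal, in the real plane, to \<open>p + r\<^sup>2 q\<close> for all \<open>r\<close>, hence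
  to \<open>p\<close> and to \<open>q\<close>. After the normalisation \<open>p = 1\<close> this makes the off-diagonal part skew, with two real
  parameters, and the directions \<open>1\<close>, \<open>\<i>\<close> and \<open>(1 + \<i>) / sqrt 2\<close> leave no other solution than the
  trivial one; the third direction excludes \<open>q = - p\<close>.\<close>
lemma unimodular_binary_form:
  fixes p q \<beta> \<gamma> :: complex
  assumes *: "\<And>r \<omega>. r > 0 \<Longrightarrow> cmod \<omega> = 1 \<Longrightarrow>
    cmod (p + of_real (r\<^sup>2) * q + of_real r * (\<omega> * \<beta> + cnj \<omega> * \<gamma>)) = 1 + r\<^sup>2"
    and p: "cmod p = 1" and q: "cmod q = 1"
  shows "\<beta> = 0 \<and> \<gamma> = 0 \<and> p = q"
proof -
  have split: "(cmod x)\<^sup>2 + (cmod y)\<^sup>2 = s\<^sup>2 \<and> Re (x * cnj y) = 0"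
    if "cmod (x + y) = s" "cmod (x - y) = s" for x y :: complex and s
  proof -
    have "(cmod (x + y))\<^sup>2 = s\<^sup>2" "(cmod (x - y))\<^sup>2 = s\<^sup>2" using that by simp_all
    then show ?thesis unfolding cmod_power2 by (simp add: power2_eq_square algebra_simps)
  qed
  have orth: "Re (p * cnj (\<omega> * \<beta> + cnj \<omega> * \<gamma>)) = 0 \<and> Re (q * cnj (\<omega> * \<beta> + cnj \<omega> * \<gamma>)) = 0 \<and>
      (cmod (p + q))\<^sup>2 + (cmod (\<omega> * \<beta> + cnj \<omega> * \<gamma>))\<^sup>2 = 4"
    if \<omega>: "cmod \<omega> = 1" for \<omega>
  proof -
    let ?y = "\<omega> * \<beta> + cnj \<omega> * \<gamma>"
    have m: "cmod (p + of_real (r\<^sup>2) * q - of_real r * ?y) = 1 + r\<^sup>2" if "r > 0" for r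
      using *[OF that, of "- \<omega>"] \<omega> by (simp add: algebra_simps)
    have 1: "(cmod (p + q))\<^sup>2 + (cmod ?y)\<^sup>2 = 2\<^sup>2 \<and> Re ((p + q) * cnj ?y) = 0"
      using *[of 1, OF _ \<omega>] m[of 1] by (intro split) simp_all
    have 2: "Re ((p + of_real (2\<^sup>2) * q) * cnj (of_real 2 * ?y)) = 0"
      using split[OF *[of 2, OF _ \<omega>] m[of 2]] by simp
    show ?thesis using 1 2 by (simp add: algebra_simps)
  qed
  \<comment> \<open>Normalise \<open>p = 1\<close>.\<close>
  define b where "b = cnj p * \<beta>"
  define c where "c = cnj p * \<gamma>"
  define d where "d = cnj p * q"
  have pp: "cnj p * p = 1" "p * cnj p = 1" using p by (simp_all add: complex_norm_square[symmetric] mult.commute)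
  have eq: "\<beta> = p * b" "\<gamma> = p * c" "q = p * d"
    using pp by (simp_all add: b_def c_def d_def flip: mult.assoc)
  have d1: "cmod d = 1" using p q by (simp add: d_def norm_mult)
  have orth': "Re (\<omega> * b + cnj \<omega> * c) = 0 \<and> Re (d * cnj (\<omega> * b + cnj \<omega> * c)) = 0 \<and>
      (cmod (1 + d))\<^sup>2 + (cmod (\<omega> * b + cnj \<omega> * c))\<^sup>2 = 4"
    if \<omega>: "cmod \<omega> = 1" for \<omega>
  proof -
    let ?y = "\<omega> * b + cnj \<omega> * c"
    have y: "\<omega> * \<beta> + cnj \<omega> * \<gamma> = p * ?y" by (simp add: eq algebra_simps)
    have "p * cnj (p * ?y) = (p * cnj p) * cnj ?y" by simp
    then have 1: "p * cnj (p * ?y) = cnj ?y" by (simp only: pp mult_1)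
    have "q * cnj (p * ?y) = (p * cnj p) * (d * cnj ?y)" by (simp add: eq)
    then have 2: "q * cnj (p * ?y) = d * cnj ?y" by (simp only: pp mult_1)
    have 3: "cmod (p + q) = cmod (1 + d)"
    proof -
      have "p + q = p * (1 + d)" by (simp add: eq algebra_simps)
      then show ?thesis using p by (simp add: norm_mult)
    qed
    have 4: "cmod (p * ?y) = cmod ?y" using p by (simp add: norm_mult)
    have "Re (cnj ?y) = Re ?y" by simp
    then show ?thesis using orth[OF \<omega>] by (simp only: y 1 2 3 4)
  qed
  have w: "cmod ((1 + \<i>) / of_real (sqrt 2)) = 1" by (simp add: norm_divide cmod_def power_divide)
  have y1: "1 * b + cnj 1 * c = b + c" and yi: "\<i> * b + cnj \<i> * c = \<i> * (b - c)"
    and yw: "((1 + \<i>) / of_real (sqrt 2)) * b + cnj ((1 + \<i>) / of_real (sqrt 2)) * c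
      = ((b + c) + \<i> * (b - c)) / of_real (sqrt 2)"
    by (simp_all add: field_simps)
  note o1 = orth'[of 1, OF norm_one, unfolded y1] and oi = orth'[of \<i>, OF norm_ii, unfolded yi]
    and ow = orth'[OF w, unfolded yw]
  define \<kappa> where "\<kappa> = Im (b + c)"
  define \<mu> where "\<mu> = Re (b - c)"
  have bc: "b + c = \<i> * of_real \<kappa>" "b - c = of_real \<mu>"
    using o1 oi by (simp_all add: complex_eq_iff \<kappa>_def \<mu>_def)
  have b: "b = (of_real \<mu> + \<i> * of_real \<kappa>) / 2" and c: "c = (\<i> * of_real \<kappa> - of_real \<mu>) / 2"
    using bc by (simp_all add: complex_eq_iff)
  have D: "(Re d)\<^sup>2 + (Im d)\<^sup>2 = 1" using d1 by (metis cmod_power2 one_power2)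
  have e1: "\<kappa> * Im d = 0" "\<mu> * Im d = 0"
    using o1 oi unfolding bc by auto
  have e2: "(1 + Re d)\<^sup>2 + (Im d)\<^sup>2 + \<kappa>\<^sup>2 = 4" "(1 + Re d)\<^sup>2 + (Im d)\<^sup>2 + \<mu>\<^sup>2 = 4"
    using o1 oi unfolding bc cmod_power2 by simp_all
  have "(\<i> * of_real \<kappa> + \<i> * of_real \<mu>) / of_real (sqrt 2) = \<i> * of_real ((\<kappa> + \<mu>) / sqrt 2)"
    by (simp add: field_simps)
  then have e3: "(1 + Re d)\<^sup>2 + (Im d)\<^sup>2 + (\<kappa> + \<mu>)\<^sup>2 / 2 = 4"
    using ow unfolding bc cmod_power2 by (simp add: power_divide)
  have "\<kappa> = 0 \<and> \<mu> = 0 \<and> d = 1"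
  proof (cases "\<kappa> = 0 \<and> \<mu> = 0")
    case True
    then have "Re d = 1" using D e2 by (simp add: power2_eq_square algebra_simps)
    moreover then have "Im d = 0" using D by simp
    ultimately show ?thesis using True by (simp add: complex_eq_iff)
  next
    case False
    then have "Im d = 0" using e1 by auto
    then have "Re d = 1 \<or> Re d = -1" using D by (simp add: power2_eq_1_iff)
    moreover have "Re d \<noteq> 1" using False e2 \<open>Im d = 0\<close> by auto
    ultimately have "Re d = -1" by simp
    then have "\<kappa>\<^sup>2 = 4" "\<mu>\<^sup>2 = 4" "(\<kappa> + \<mu>)\<^sup>2 = 8" using e2 e3 \<open>Im d = 0\<close> by simp_all
    then have "\<kappa> * \<mu> = 0" by (simp add: power2_eq_square algebra_simps)
    then show ?thesis using \<open>\<kappa>\<^sup>2 = 4\<close> \<open>\<mu>\<^sup>2 = 4\<close> by auto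
  qed
  then show ?thesis using eq b c by simp
qed

text \<open>The coefficients are compared on the span of two basis vectors at a time.\<close>
lemma unimodular_functional_is_trace:
  assumes l: "linear_functional n l" and P: "\<And>P. P \<in> rank_one_projections n \<Longrightarrow> cmod (l P) = 1"
  shows "\<exists>t. \<forall>X\<in>carrier_mat n n. l X = t * trace_mat X"
proof -
  let ?t = "\<lambda>a b. l (unit_mat n a b)"
  note quad = unimodular_functional_quadratic[OF l P]
  have diag: "cmod (?t a a) = 1" if a: "a < n" for a
  proof -
    have "unit_mat n a a \<in> rank_one_projections n" using a by (rule unit_mat_rank_one)
    then show ?thesis by (rule P)
  qed
  have off: "?t a b = 0 \<and> ?t b a = 0 \<and> ?t a a = ?t b b" if ab: "a < n" "b < n" "a \<noteq> b" for a b
  proof -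
    have "cmod (?t a a + of_real (r\<^sup>2) * ?t b b + of_real r * (\<omega> * ?t b a + cnj \<omega> * ?t a b)) = 1 + r\<^sup>2"
      if r: "r > 0" and \<omega>: "cmod \<omega> = 1" for r \<omega>
    proof -
      define x where "x i = (if i = a then 1 else if i = b then of_real r * \<omega> else 0)" for i
      have xv: "x a = 1" "x b = of_real r * \<omega>" "\<And>i. i \<noteq> a \<Longrightarrow> i \<noteq> b \<Longrightarrow> x i = 0"
        using ab(3) by (simp_all add: x_def)
      have "normsq n x = (cmod (x a))\<^sup>2 + (cmod (x b))\<^sup>2"
        unfolding normsq_def by (rule two_point_sum[OF ab]) (simp add: xv)
      also have "\<dots> = 1 + r\<^sup>2" using r \<omega> by (simp add: xv norm_mult power_mult_distrib)
      finally have nx: "normsq n x = 1 + r\<^sup>2" .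
      have in1: "(\<Sum>d<n. x c * cnj (x d) * ?t c d) = x c * cnj (x a) * ?t c a + x c * cnj (x b) * ?t c b" for c
        by (rule two_point_sum[OF ab]) (simp add: xv)
      have "(\<Sum>c<n. \<Sum>d<n. x c * cnj (x d) * ?t c d)
        = (x a * cnj (x a) * ?t a a + x a * cnj (x b) * ?t a b)
          + (x b * cnj (x a) * ?t b a + x b * cnj (x b) * ?t b b)"
        unfolding in1 by (rule two_point_sum[OF ab]) (simp add: xv)
      also have "x b * cnj (x b) = of_real (r\<^sup>2)"
      proof -
        have "x b * cnj (x b) = of_real (r\<^sup>2) * (\<omega> * cnj \<omega>)"
          unfolding xv by (simp add: power2_eq_square)
        then show ?thesis using \<omega> by (simp add: complex_norm_square[symmetric])
      qed
      finally show ?thesis using quad[of x] unfolding nx xv by (simp add: algebra_simps)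
    qed
    from unimodular_binary_form[OF this diag[OF ab(1)] diag[OF ab(2)]] show ?thesis by simp
  qed
  have "l X = ?t 0 0 * trace_mat X" if X: "X \<in> carrier_mat n n" for X
  proof -
    have "l X = (\<Sum>a<n. \<Sum>b<n. X $$ (a, b) * ?t a b)" by (rule linear_functional_expand[OF l X])
    also have "\<dots> = (\<Sum>a<n. \<Sum>b<n. if b = a then X $$ (a, a) * ?t 0 0 else 0)"
    proof (intro sum.cong refl)
      fix a b assume ab: "a \<in> {..<n}" "b \<in> {..<n}"
      have "?t a a = ?t 0 0"
      proof (cases "a = 0")
        case False
        then show ?thesis using off[of a 0] ab by simp
      qed simp
      then show "X $$ (a, b) * ?t a b = (if b = a then X $$ (a, a) * ?t 0 0 else 0)"
        using off[of a b] ab by auto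
    qed
    also have "\<dots> = ?t 0 0 * trace_mat X"
      using X by (simp add: trace_mat_def sum_distrib_left mult.commute)
    finally show ?thesis .
  qed
  then show ?thesis by blast
qed

text \<open>As a function of a single slot, \<open>g\<close> is a multiple of the trace, and all rank-one projections have
  trace 1. Slots may also be frozen at one matrix.\<close>
lemma multilinear_unimodular_constant:
  assumes g: "multilinear m n g"
    and R: "\<And>j. j < m \<Longrightarrow> R j = rank_one_projections (n j) \<or> (\<exists>B\<in>carrier_mat (n j) (n j). R j = {B})"
    and uni: "\<And>P. (\<And>j. j < m \<Longrightarrow> P j \<in> R j) \<Longrightarrow> cmod (g P) = 1"
    and cong: "\<And>P Q. (\<And>j. j < m \<Longrightarrow> P j = Q j) \<Longrightarrow> g P = g Q"
    and P: "\<And>j. j < m \<Longrightarrow> P j \<in> R j" and Q: "\<And>j. j < m \<Longrightarrow> Q j \<in> R j"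
  shows "g P = g Q"
proof -
  define S where "S k = (\<lambda>j. if j < k then Q j else P j)" for k
  have Rc: "X \<in> carrier_mat (n j) (n j)" if "j < m" "X \<in> R j" for j X
    using R[OF that(1)] that(2) rank_one_projections_carrier by auto
  have "k \<le> m \<Longrightarrow> g (S k) = g P" for k
  proof (induction k)
    case 0
    show ?case by (simp add: S_def)
  next
    case (Suc k)
    then have k: "k < m" by simp
    have SR: "S k j \<in> R j" if "j < m" for j using P Q that by (simp add: S_def)
    have fam: "S k \<in> families m n" using Rc SR by (simp add: families_def)
    have upd: "S (Suc k) = (S k)(k := Q k)" "S k = (S k)(k := P k)"
      by (auto simp: S_def fun_eq_iff less_Suc_eq)
    have "g ((S k)(k := Q k)) = g ((S k)(k := P k))"
    proof (cases "R k = rank_one_projections (n k)")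
      case True
      have "cmod (g ((S k)(k := X))) = 1" if "X \<in> rank_one_projections (n k)" for X
        using SR that True by (intro uni) simp
      then obtain t where "\<forall>X\<in>carrier_mat (n k) (n k). g ((S k)(k := X)) = t * trace_mat X"
        using unimodular_functional_is_trace[OF multilinearD[OF g fam k]] by blast
      then show ?thesis
        using P[OF k] Q[OF k] Rc[OF k] trace_rank_one_projection unfolding True by metis
    next
      case False
      then obtain B where "R k = {B}" using R[OF k] by blast
      then have "P k = Q k" using P[OF k] Q[OF k] by simp
      then show ?thesis by simp
    qed
    then have "g (S (Suc k)) = g ((S k)(k := P k))" by (simp only: upd(1))
    also have "\<dots> = g (S k)" by (rule arg_cong[OF upd(2)[symmetric]])
    finally show ?case using Suc.IH k by simp
  qed
  from this[of m] have "g (S m) = g P" by simp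
  moreover have "g (S m) = g Q" by (rule cong) (simp add: S_def)
  ultimately show ?thesis by simp
qed

section \<open>Images of a product basis of projections\<close>

subsection \<open>Vectors at which a quadratic form is extremal\<close>

lemma form_expand:
  "form n A (\<lambda>i. u i + s * v i) (\<lambda>i. u i + s * v i)
    = form n A u u + s * form n A u v + cnj s * form n A v u + cnj s * s * form n A v v"
  unfolding form_def sum_distrib_left sum.distrib[symmetric]
  by (intro sum.cong refl) (simp add: algebra_simps)

text \<open>Otherwise a small step from \<open>u\<close> in the direction \<open>- h v\<close>, where \<open>h\<close> is the value in question,
  would make the form negative.\<close>
lemma positive_form_null_vector:
  assumes M: "M \<in> hermitians n" and pos: "\<And>v. Re (form n M v v) \<ge> 0" and u: "form n M u u = 0"
  shows "form n M v u = 0"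
proof (rule ccontr)
  assume h: "form n M v u \<noteq> 0"
  let ?h = "form n M v u" and ?K = "Re (form n M v v)"
  \<comment> \<open>The step length has to satisfy \<open>e * ?K < 2\<close>.\<close>
  define e where "e = 1 / (?K + 1)"
  have K: "?K \<ge> 0" by (rule pos)
  then have e: "e > 0" by (simp add: e_def)
  have Mc: "M \<in> carrier_mat n n" and Mh: "M\<^sup>\<dagger> = M" using M by (simp_all add: hermitians_def)
  have sym: "form n M u v = cnj ?h"
    using form_adjoint[OF Mc, of u v] by (simp add: Mh)
  define s where "s = - of_real e * ?h"
  have "Re (form n M (\<lambda>i. u i + s * v i) (\<lambda>i. u i + s * v i))
      = - 2 * e * (cmod ?h)\<^sup>2 + e\<^sup>2 * (cmod ?h)\<^sup>2 * ?K"
  proof -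
    have hh: "?h * cnj ?h = of_real ((cmod ?h)\<^sup>2)" "cnj ?h * ?h = of_real ((cmod ?h)\<^sup>2)"
      by (simp_all only: complex_norm_square mult.commute)
    have s1: "s * cnj ?h = of_real (- e * (cmod ?h)\<^sup>2)" "cnj s * ?h = of_real (- e * (cmod ?h)\<^sup>2)"
      using hh by (simp_all add: s_def)
    have s2: "cnj s * s = of_real (e\<^sup>2 * (cmod ?h)\<^sup>2)"
    proof -
      have "cnj s * s = of_real (e\<^sup>2) * (cnj ?h * ?h)" by (simp add: s_def power2_eq_square)
      then show ?thesis by (simp only: hh(2) of_real_mult)
    qed
    show ?thesis unfolding form_expand u sym s1 s2 by simp
  qed
  then have "0 \<le> - 2 * e * (cmod ?h)\<^sup>2 + e\<^sup>2 * (cmod ?h)\<^sup>2 * ?K" by (metis pos)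
  also have "\<dots> = (e * (cmod ?h)\<^sup>2) * (e * ?K - 2)" by (simp add: power2_eq_square algebra_simps)
  also have "\<dots> < 0"
  proof (rule mult_pos_neg)
    show "0 < e * (cmod ?h)\<^sup>2" using e h by simp
    have "e * ?K < 1" using K by (simp add: e_def)
    then show "e * ?K - 2 < 0" by simp
  qed
  finally show False by simp
qed

lemma Re_le_cmod_unit: "cmod c = 1 \<Longrightarrow> Re (cnj c * z) \<le> cmod z"
  using complex_Re_le_cmod[of "cnj c * z"] by (simp add: norm_mult)

lemma form_one: "form n (1\<^sub>m n) v u = (\<Sum>i<n. cnj (v i) * u i)"
proof -
  have "form n (1\<^sub>m n) v u = (\<Sum>i<n. \<Sum>j<n. (cnj (v i) * u j) * (if j = i then 1 else 0))"
    unfolding form_def by (intro sum.cong refl) simp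
  also have "\<dots> = (\<Sum>i<n. cnj (v i) * u i)"
    by (intro sum.cong refl sum_mult_delta(1)) simp
  finally show ?thesis .
qed

text \<open>A unit vector at which \<open>|v\<^sup>* A v|\<close> attains its maximum 1 is an eigenvector, with eigenvalue 1,
  of the real part of a rotation of \<open>A\<close>: it is a null vector of a positive semidefinite form.\<close>
lemma extremal_vector_eigen:
  assumes A: "A \<in> carrier_mat n n" and le: "\<And>v. cmod (form n A v v) \<le> normsq n v"
    and u: "normsq n u = 1" "form n A u u = c" "cmod c = 1"
  shows "2 * (\<Sum>i<n. cnj (v i) * u i) = cnj c * form n A v u + c * cnj (form n A u v)"
proof -
  define M where "M = 2 \<cdot>\<^sub>m 1\<^sub>m n + ((- cnj c) \<cdot>\<^sub>m A + (- c) \<cdot>\<^sub>m A\<^sup>\<dagger>)"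
  have M: "M \<in> carrier_mat n n" using A by (simp add: M_def)
  have form: "form n M v w = 2 * (\<Sum>i<n. cnj (v i) * w i) - cnj c * form n A v w - c * cnj (form n A w v)" for v w
    unfolding M_def using A by (simp add: form_add form_smult form_one form_adjoint)
  have "M\<^sup>\<dagger> = M" unfolding M_def
    by (rule eq_matI) (use A in \<open>simp_all add: algebra_simps\<close>)
  then have herm: "M \<in> hermitians n" using M by (simp add: hermitians_def)
  have pos: "Re (form n M v v) \<ge> 0" for v
  proof -
    have "Re (form n M v v) = 2 * normsq n v - 2 * Re (cnj c * form n A v v)"
      unfolding form normsq_complex[symmetric] by simp
    then show ?thesis using Re_le_cmod_unit[OF u(3), of "form n A v v"] le[of v] by linarith
  qed
  have cc: "cnj c * c = 1" "c * cnj c = 1" using u(3) by (simp_all add: complex_norm_square[symmetric] mult.commute)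
  have "form n M u u = 0"
    unfolding form normsq_complex[symmetric] u(1,2) cc by simp
  from positive_form_null_vector[OF herm pos this, of v] show ?thesis
    unfolding form by (simp add: algebra_simps)
qed

subsection \<open>Averaging over a one-parameter torus\<close>

definition character :: "nat \<Rightarrow> int \<Rightarrow> nat \<Rightarrow> complex" where
  "character M e k = cis (2 * pi * of_int e * of_nat k / of_nat M)"

lemma character_mult: "character M a k * character M b k = character M (a + b) k"
  by (simp add: character_def cis_mult add_divide_distrib algebra_simps)

lemma cnj_character: "cnj (character M a k) = character M (- a) k"
  by (simp add: character_def cis_cnj)

lemma norm_character: "cmod (character M a k) = 1"
  by (simp add: character_def)

lemma character_power: "character M 1 k ^ s = character M (int s) k"
  by (simp add: character_def Complex.DeMoivre mult_ac)

lemma sum_character: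
  assumes "\<bar>e\<bar> < int M"
  shows "(\<Sum>k<M. character M e k) = (if e = 0 then of_nat M else 0)"
proof (cases "e = 0")
  case True
  then show ?thesis by (simp add: character_def)
next
  case False
  have M: "M > 0" using assms by simp
  define x where "x = cis (2 * pi * of_int e / of_nat M)"
  have "x \<noteq> 1"
  proof
    assume "x = 1"
    then have "cos (2 * pi * of_int e / of_nat M) = 1" by (simp add: x_def complex_eq_iff)
    then obtain z :: int where "2 * pi * of_int e / of_nat M = of_int z * 2 * pi"
      using cos_one_2pi_int by blast
    then have "of_int e = of_int z * (of_nat M :: real)" using M by (simp add: field_simps)
    then have "e = z * int M" by (metis of_int_eq_iff of_int_mult of_int_of_nat_eq)
    then have "int M dvd e" by simp
    with assms False show False using zdvd_imp_le[of "int M" "\<bar>e\<bar>"] by simp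
  qed
  moreover have "x ^ M = 1"
  proof -
    have "x ^ M = cis (2 * pi * of_int e)" using M by (simp add: x_def Complex.DeMoivre)
    then show ?thesis by (simp add: cis_multiple_2pi)
  qed
  moreover have "character M e k = x ^ k" for k
    by (simp add: character_def x_def Complex.DeMoivre mult_ac)
  ultimately show ?thesis using False by (simp add: geometric_sum)
qed

text \<open>Let \<open>u\<close> be extremal for one of the matrices \<open>Q I\<close>. Averaging \<open>u\<^sup>* P(\<omega>) u\<close> over the torus leaves
  the value at \<open>Q I\<close>, which has maximal modulus; hence \<open>u\<close> is extremal for every \<open>P(\<omega>)\<close>, and the
  Fourier coefficients of the eigenvector equation separate the matrices \<open>Q J\<close>. Only
  nonnegative frequencies occur, so those of \<open>P(\<omega>)\<close> and of its adjoint do not interfere.\<close>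
lemma torus_extremal_vector:
  fixes Q :: "nat \<Rightarrow> complex mat" and \<sigma> :: "nat \<Rightarrow> nat"
  assumes inj: "inj_on \<sigma> {..<N}" and I: "I < N" "\<sigma> I = 0"
    and P: "\<And>\<omega>. P \<omega> \<in> carrier_mat N N"
      "\<And>\<omega> v w. form N (P \<omega>) v w = (\<Sum>J<N. \<omega> ^ \<sigma> J * form N (Q J) v w)"
    and le: "\<And>\<omega> v. cmod \<omega> = 1 \<Longrightarrow> cmod (form N (P \<omega>) v v) \<le> normsq N v"
    and u: "normsq N u = 1" "cmod (form N (Q I) u u) = 1"
    and J: "J < N" "J \<noteq> I"
  shows "form N (Q J) v u = 0 \<and> form N (Q J) u v = 0"
proof -
  \<comment> \<open>The roots of unity of this order separate all sums and differences of two frequencies.\<close>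
  define M where "M = Suc (2 * (\<Sum>J<N. \<sigma> J))"
  have M: "M > 0" by (simp add: M_def)
  have \<sigma>M: "2 * \<sigma> K < M" if "K < N" for K
    using member_le_sum[of K "{..<N}" \<sigma>] that by (simp add: M_def)
  have \<sigma>0: "\<sigma> K = 0 \<longleftrightarrow> K = I" if "K < N" for K
    using inj_onD[OF inj, of K I] that I by auto
  define \<omega> where "\<omega> k = character M 1 k" for k
  have \<omega>: "cmod (\<omega> k) = 1" "\<omega> k ^ s = character M (int s) k" for k s
    by (simp_all add: \<omega>_def norm_character character_power)
  define c where "c = form N (Q I) u u"
  have c: "cmod c = 1" using u(2) by (simp add: c_def)
  have cc: "cnj c * c = 1" using c by (simp add: complex_norm_square[symmetric] mult.commute)
  define f where "f k = form N (P (\<omega> k)) u u" for k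
  \<comment> \<open>Fourier coefficients: summing against a character picks out one term.\<close>
  have pick: "(\<Sum>k<M. character M e k * (\<Sum>K<N. character M (s K) k * a K))
      = (\<Sum>K<N. if e + s K = 0 then of_nat M * a K else 0)"
    if bound: "\<And>K. K < N \<Longrightarrow> \<bar>e + s K\<bar> < int M" for e s a
  proof -
    have "(\<Sum>k<M. character M e k * (\<Sum>K<N. character M (s K) k * a K))
        = (\<Sum>k<M. \<Sum>K<N. character M (e + s K) k * a K)"
      by (simp only: sum_distrib_left mult.assoc[symmetric] character_mult)
    also have "\<dots> = (\<Sum>K<N. (\<Sum>k<M. character M (e + s K) k) * a K)"
      by (subst sum.swap) (simp only: sum_distrib_right)
    also have "\<dots> = (\<Sum>K<N. if e + s K = 0 then of_nat M * a K else 0)"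
      by (intro sum.cong refl) (simp add: sum_character bound)
    finally show ?thesis .
  qed
  have char0: "character M 0 k = 1" for k by (simp add: character_def)
  have "(\<Sum>k<M. f k) = (\<Sum>k<M. character M 0 k * (\<Sum>K<N. character M (int (\<sigma> K)) k * form N (Q K) u u))"
    by (simp add: f_def P(2) \<omega>(2) char0)
  also have "\<dots> = (\<Sum>K<N. if 0 + int (\<sigma> K) = 0 then of_nat M * form N (Q K) u u else 0)"
    by (rule pick) (use \<sigma>M in fastforce)
  also have "\<dots> = (\<Sum>K<N. if K = I then of_nat M * form N (Q K) u u else 0)"
    by (intro sum.cong refl) (simp add: \<sigma>0)
  also have "\<dots> = of_nat M * c" using I(1) by (simp add: c_def)
  finally have avg: "(\<Sum>k<M. f k) = of_nat M * c" .
  have fle: "cmod (f k) \<le> 1" for k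
    using le[OF \<omega>(1), of k u] u(1) by (simp add: f_def)
  have "(\<Sum>k<M. 1 - Re (cnj c * f k)) = 0"
  proof -
    have "(\<Sum>k<M. Re (cnj c * f k)) = Re (cnj c * (\<Sum>k<M. f k))"
      by (simp only: sum_distrib_left Re_sum)
    also have "cnj c * (\<Sum>k<M. f k) = of_nat M * (cnj c * c)" unfolding avg by simp
    finally show ?thesis unfolding cc sum_subtractf by simp
  qed
  moreover have nonneg: "1 - Re (cnj c * f k) \<ge> 0" for k
    using Re_le_cmod_unit[OF c, of "f k"] fle[of k] by linarith
  ultimately have Re1: "Re (cnj c * f k) = 1" if "k < M" for k
    using that by (simp add: sum_nonneg_eq_0_iff)
  have fc: "f k = c" if "k < M" for k
  proof -
    let ?z = "cnj c * f k"
    have "cmod ?z \<le> 1" using fle[of k] c by (simp add: norm_mult)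
    then have "(cmod ?z)\<^sup>2 \<le> 1" by (simp add: power_le_one)
    then have "(Im ?z)\<^sup>2 \<le> 0" unfolding cmod_power2 Re1[OF that] by simp
    then have "?z = 1" using Re1[OF that] by (simp add: complex_eq_iff)
    then have "c * (cnj c * f k) = c" by simp
    then show ?thesis using cc by (metis mult.assoc mult.commute mult.left_neutral)
  qed
  define g where "g = 2 * (\<Sum>i<N. cnj (v i) * u i)"
  define a where "a K = cnj c * form N (Q K) v u" for K
  define b where "b K = c * cnj (form N (Q K) u v)" for K
  have eq: "g = (\<Sum>K<N. character M (int (\<sigma> K)) k * a K) + (\<Sum>K<N. character M (- int (\<sigma> K)) k * b K)"
    if k: "k < M" for k
  proof -
    have "g = cnj c * form N (P (\<omega> k)) v u + c * cnj (form N (P (\<omega> k)) u v)"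
      unfolding g_def
      by (rule extremal_vector_eigen[OF P(1) le[OF \<omega>(1)] u(1) fc[OF k, unfolded f_def] c])
    also have "cnj c * form N (P (\<omega> k)) v u = (\<Sum>K<N. character M (int (\<sigma> K)) k * a K)"
      unfolding P(2) sum_distrib_left by (intro sum.cong refl) (simp add: \<omega>(2) a_def)
    also have "c * cnj (form N (P (\<omega> k)) u v) = (\<Sum>K<N. character M (- int (\<sigma> K)) k * b K)"
      unfolding P(2) cnj_sum sum_distrib_left
      by (intro sum.cong refl) (simp add: \<omega>(2) b_def cnj_character)
    finally show ?thesis .
  qed
  define j where "j = int (\<sigma> J)"
  have j: "j > 0" "2 * j < int M" using \<sigma>0[OF J(1)] J(2) \<sigma>M[OF J(1)] by (simp_all add: j_def)
  have fourier: "(\<Sum>k<M. character M e k * g)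
      = (\<Sum>K<N. if e + int (\<sigma> K) = 0 then of_nat M * a K else 0)
        + (\<Sum>K<N. if e + - int (\<sigma> K) = 0 then of_nat M * b K else 0)"
    if e: "\<bar>2 * e\<bar> < int M" for e
  proof -
    have bd: "\<bar>e + int (\<sigma> K)\<bar> < int M" "\<bar>e + - int (\<sigma> K)\<bar> < int M" if "K < N" for K
      using \<sigma>M[OF that] e by linarith+
    have "(\<Sum>k<M. character M e k * g)
        = (\<Sum>k<M. character M e k * (\<Sum>K<N. character M (int (\<sigma> K)) k * a K))
          + (\<Sum>k<M. character M e k * (\<Sum>K<N. character M (- int (\<sigma> K)) k * b K))"
      unfolding sum.distrib[symmetric]
      by (intro sum.cong refl) (simp only: lessThan_iff eq distrib_left)
    then show ?thesis by (simp only: pick bd)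
  qed
  have zero: "(\<Sum>k<M. character M e k * g) = 0" if "e \<noteq> 0" "\<bar>e\<bar> < int M" for e
    using sum_character[OF that(2)] that(1) by (simp flip: sum_distrib_right)
  have "(\<Sum>k<M. character M (- j) k * g) = of_nat M * a J"
  proof -
    have "(\<Sum>K<N. if - j + int (\<sigma> K) = 0 then of_nat M * a K else 0)
        = (\<Sum>K<N. if K = J then of_nat M * a K else 0)"
      by (intro sum.cong refl) (use inj_onD[OF inj, of _ J] J(1) in \<open>auto simp: j_def\<close>)
    moreover have "(\<Sum>K<N. if - j + - int (\<sigma> K) = 0 then of_nat M * b K else 0) = 0"
      by (intro sum.neutral) (use j in simp)
    ultimately show ?thesis using fourier[of "- j"] j J(1) by simp
  qed
  then have "a J = 0" using zero[of "- j"] j M by simp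
  have "(\<Sum>k<M. character M j k * g) = of_nat M * b J"
  proof -
    have "(\<Sum>K<N. if j + - int (\<sigma> K) = 0 then of_nat M * b K else 0)
        = (\<Sum>K<N. if K = J then of_nat M * b K else 0)"
      by (intro sum.cong refl) (use inj_onD[OF inj, of _ J] J(1) in \<open>auto simp: j_def\<close>)
    moreover have "(\<Sum>K<N. if j + int (\<sigma> K) = 0 then of_nat M * a K else 0) = 0"
      by (intro sum.neutral) (use j in simp)
    ultimately show ?thesis using fourier[of j] j J(1) by simp
  qed
  then have "b J = 0" using zero[of j] j M by simp
  have "c \<noteq> 0" using c by auto
  then show ?thesis using \<open>a J = 0\<close> \<open>b J = 0\<close> by (simp add: a_def b_def)
qed

text \<open>For every multi-index \<open>I\<close> there is a one-parameter torus inside the diagonal Kronecker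
  products that separates all multi-indices and fixes \<open>I\<close>.\<close>
lemma separating_exponents:
  assumes "I < (\<Prod>j<m. n j)"
  shows "\<exists>c :: nat \<Rightarrow> nat \<Rightarrow> nat. inj_on (\<lambda>p. \<Sum>j<m. c j (digit m n p j)) {..<(\<Prod>j<m. n j)} \<and>
    (\<Sum>j<m. c j (digit m n I j)) = 0"
  using assms
proof (induction m arbitrary: I)
  case 0
  then show ?case by (simp add: inj_on_def)
next
  case (Suc m)
  let ?P = "\<Prod>j<m. n j" and ?n = "n m"
  have I: "I < ?P * ?n" using Suc.prems by simp
  then have n: "?n > 0" by (cases ?n) simp_all
  have "I div ?n < ?P" using I by (simp add: less_mult_imp_div_less)
  from Suc.IH[OF this] obtain c :: "nat \<Rightarrow> nat \<Rightarrow> nat"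
    where c: "inj_on (\<lambda>p. \<Sum>j<m. c j (digit m n p j)) {..<?P}"
      "(\<Sum>j<m. c j (digit m n (I div ?n) j)) = 0" by blast
  define r where "r = I mod ?n"
  \<comment> \<open>The transposition of \<open>0\<close> and \<open>r\<close>, so that the last digit of \<open>I\<close> gets exponent 0.\<close>
  define s where "s i = (if i = r then 0 else if i = 0 then r else i)" for i
  have r: "r < ?n" using n by (simp add: r_def)
  have s: "s i < ?n" if "i < ?n" for i using that r n by (simp add: s_def)
  have sinj: "i = i'" if "s i = s i'" for i i' using that by (auto simp: s_def split: if_splits)
  define c' where "c' = (\<lambda>j i. if j = m then s i else ?n * c j i)"
  have val: "(\<Sum>j<Suc m. c' j (digit (Suc m) n p j))
      = (\<Sum>j<m. c j (digit m n (p div ?n) j)) * ?n + s (p mod ?n)" for p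
  proof -
    have "(\<Sum>j<m. c' j (digit (Suc m) n p j)) = (\<Sum>j<m. c j (digit m n (p div ?n) j)) * ?n"
      unfolding sum_distrib_right by (intro sum.cong refl) (simp add: c'_def)
    then show ?thesis by (simp add: c'_def)
  qed
  have "inj_on (\<lambda>p. \<Sum>j<Suc m. c' j (digit (Suc m) n p j)) {..<?P * ?n}"
    unfolding val
  proof (rule inj_onI)
    fix p q assume pq: "p \<in> {..<?P * ?n}" "q \<in> {..<?P * ?n}"
      and eq: "(\<Sum>j<m. c j (digit m n (p div ?n) j)) * ?n + s (p mod ?n)
        = (\<Sum>j<m. c j (digit m n (q div ?n) j)) * ?n + s (q mod ?n)"
    have sp: "s (p mod ?n) < ?n" "s (q mod ?n) < ?n" using s n by simp_all
    have "(\<Sum>j<m. c j (digit m n (p div ?n) j)) = (\<Sum>j<m. c j (digit m n (q div ?n) j))"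
      using arg_cong[OF eq, of "\<lambda>x. x div ?n"] unfolding div_mod_digit(1)[OF sp(1)] div_mod_digit(1)[OF sp(2)] .
    then have 1: "p div ?n = q div ?n"
      by (rule inj_onD[OF c(1)]) (use pq in \<open>simp_all add: less_mult_imp_div_less\<close>)
    have "s (p mod ?n) = s (q mod ?n)"
      using arg_cong[OF eq, of "\<lambda>x. x mod ?n"] unfolding div_mod_digit(2)[OF sp(1)] div_mod_digit(2)[OF sp(2)] .
    then have "p mod ?n = q mod ?n" by (rule sinj)
    with 1 show "p = q" by (metis div_mult_mod_eq)
  qed
  then have "inj_on (\<lambda>p. \<Sum>j<Suc m. c' j (digit (Suc m) n p j)) {..<(\<Prod>j<Suc m. n j)}"
    by (simp only: prod.lessThan_Suc)
  moreover have "(\<Sum>j<Suc m. c' j (digit (Suc m) n I j)) = 0"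
    unfolding val c(2) s_def r_def by (simp only: mult_zero_left add_0_left if_True refl)
  ultimately show ?case by (intro exI[of _ c'] conjI)
qed

subsection \<open>The image of a product basis\<close>

lemma linear_map_matD:
  assumes "linear_map_mat N \<phi>"
  shows "X \<in> carrier_mat N N \<Longrightarrow> \<phi> X \<in> carrier_mat N N"
    and "X \<in> carrier_mat N N \<Longrightarrow> Y \<in> carrier_mat N N \<Longrightarrow> \<phi> (X + Y) = \<phi> X + \<phi> Y"
    and "X \<in> carrier_mat N N \<Longrightarrow> \<phi> (c \<cdot>\<^sub>m X) = c \<cdot>\<^sub>m \<phi> X"
  using assms unfolding linear_map_mat_iff by blast+

lemma linear_map_mat_comp_functional:
  assumes \<phi>: "linear_map_mat N \<phi>" and l: "linear_functional N l"
  shows "linear_functional N (\<lambda>X. l (\<phi> X))"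
  by (rule linear_functionalI)
    (simp_all add: linear_map_matD[OF \<phi>] linear_functional_add[OF l] linear_functional_smult[OF l])

lemma linear_functional_form: "linear_functional n (\<lambda>X. form n X v u)"
  by (rule linear_functionalI) (simp_all add: form_add form_smult)

lemma linear_functional_index: "p < n \<Longrightarrow> q < n \<Longrightarrow> linear_functional n (\<lambda>X. X $$ (p, q))"
  by (rule linear_functionalI) simp_all

lemma linear_functional_trace: "linear_functional n trace_mat"
  by (rule linear_functionalI) (simp_all add: trace_mat_add[of _ n] trace_mat_smult[of _ n])

lemma form_diag: "form n (mat_diag n d) v v = (\<Sum>i<n. d i * of_real ((cmod (v i))\<^sup>2))"
proof -
  have "form n (mat_diag n d) v v = (\<Sum>i<n. \<Sum>j<n. (cnj (v i) * d i * v j) * (if j = i then 1 else 0))"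
    unfolding form_def by (intro sum.cong refl) (simp add: mat_diag_def)
  also have "\<dots> = (\<Sum>i<n. cnj (v i) * d i * v i)"
    by (intro sum.cong refl sum_mult_delta(1)) simp
  finally show ?thesis unfolding complex_norm_square by (simp add: mult_ac)
qed

lemma numerical_radius_diag_le:
  assumes "n > 0" "\<And>i. i < n \<Longrightarrow> cmod (d i) \<le> 1"
  shows "numerical_radius (mat_diag n d) \<le> 1"
proof (rule numerical_radius_leI[OF _ assms(1)])
  fix v
  have "cmod (form n (mat_diag n d) v v) \<le> (\<Sum>i<n. cmod (d i * of_real ((cmod (v i))\<^sup>2)))"
    unfolding form_diag by (rule norm_sum)
  also have "\<dots> \<le> normsq n v"
    unfolding normsq_def
  proof (rule sum_mono)
    fix i assume "i \<in> {..<n}"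
    then have "cmod (d i) * (cmod (v i))\<^sup>2 \<le> 1 * (cmod (v i))\<^sup>2"
      using assms(2) by (intro mult_right_mono) simp_all
    then show "cmod (d i * of_real ((cmod (v i))\<^sup>2)) \<le> (cmod (v i))\<^sup>2"
      by (simp add: norm_mult norm_power)
  qed
  finally show "cmod (form n (mat_diag n d) v v) \<le> 1 * normsq n v" by simp
qed simp

lemma numerical_radius_unit_mat:
  assumes "a < n" shows "numerical_radius (unit_mat n a a) = 1"
proof (rule antisym)
  show "numerical_radius (unit_mat n a a) \<le> 1"
    unfolding unit_mat_eq_diag by (rule numerical_radius_diag_le) (use assms in simp_all)
  let ?v = "\<lambda>i. if i = a then 1 else 0 :: complex"
  have "normsq n ?v = (\<Sum>i<n. if i = a then 1 else 0)"
    unfolding normsq_def by (intro sum.cong) simp_all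
  then have nv: "normsq n ?v = 1" using assms by simp
  have "form n (unit_mat n a a) ?v ?v = (\<Sum>i<n. if i = a then 1 else 0)"
    unfolding unit_mat_eq_diag form_diag by (intro sum.cong) simp_all
  then have "form n (unit_mat n a a) ?v ?v = 1" using assms by simp
  then show "1 \<le> numerical_radius (unit_mat n a a)"
    using form_le_numerical_radius[of "unit_mat n a a" n ?v] nv by simp
qed

lemma conj_index_form:
  assumes "U \<in> carrier_mat n n" "A \<in> carrier_mat n n" "p < n" "q < n"
  shows "(U\<^sup>\<dagger> * A * U) $$ (p, q) = form n A (\<lambda>i. U $$ (i, p)) (\<lambda>i. U $$ (i, q))"
proof -
  have "(U\<^sup>\<dagger> * A * U) $$ (p, q) = (U\<^sup>\<dagger> * (A * U)) $$ (p, q)"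
    using assms by (simp only: assoc_mult_mat[OF mat_adjoint_carrier])
  also have "\<dots> = (\<Sum>i<n. U\<^sup>\<dagger> $$ (p, i) * (A * U) $$ (i, q))"
    using assms by (intro index_mult_sum[of _ n n _ n]) simp_all
  also have "\<dots> = (\<Sum>i<n. \<Sum>j<n. cnj (U $$ (i, p)) * A $$ (i, j) * U $$ (j, q))"
    using assms by (intro sum.cong refl)
      (simp add: index_mult_sum[of A n n U n] sum_distrib_left mult.assoc del: index_mult_mat(1))
  finally show ?thesis by (simp add: form_def)
qed

definition preserves_radius :: "nat \<Rightarrow> (nat \<Rightarrow> nat) \<Rightarrow> (complex mat \<Rightarrow> complex mat) \<Rightarrow> bool" where
  "preserves_radius m n \<phi> \<longleftrightarrow> (\<forall>A\<in>families m n.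
    numerical_radius (\<phi> (kronecker_family m A)) = numerical_radius (kronecker_family m A))"

text \<open>For each \<open>I\<close> a unit vector \<open>u I\<close> is extremal for the image \<open>Q I\<close> of the diagonal unit \<open>E I I\<close>. The
  diagonal unitaries that are Kronecker products have images of numerical radius 1, so \<open>u I\<close> is
  annihilated by the other \<open>Q J\<close> and by their adjoints. By the eigenvector equation at \<open>u I\<close> the vectors
  are orthogonal, and in the basis that they form \<open>Q I\<close> has a single nonzero entry.\<close>
lemma image_of_standard_basis:
  assumes n: "\<And>j. j < m \<Longrightarrow> n j > 0" and N: "N = (\<Prod>j<m. n j)"
    and \<phi>: "linear_map_mat N \<phi>" and w: "preserves_radius m n \<phi>"
  shows "\<exists>U\<in>unitaries N. \<exists>c. \<forall>I<N. cmod (c I) = 1 \<and> \<phi> (unit_mat N I I) = U * (c I \<cdot>\<^sub>m unit_mat N I I) * U\<^sup>\<dagger>"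
proof -
  have N0: "N > 0" using n unfolding N by (intro prod_pos) simp
  define Q where "Q I = \<phi> (unit_mat N I I)" for I
  have Q: "Q I \<in> carrier_mat N N" for I by (simp add: Q_def linear_map_matD[OF \<phi>])
  have wQ: "numerical_radius (Q I) = 1" if "I < N" for I
  proof -
    let ?E = "\<lambda>j. unit_mat (n j) (digit m n I j) (digit m n I j)"
    have "kronecker_family m ?E = unit_mat N I I"
      using kronecker_family_unit_mat[OF n] that unfolding N by simp
    moreover have "?E \<in> families m n" by (simp add: families_def)
    ultimately have "numerical_radius (\<phi> (unit_mat N I I)) = numerical_radius (unit_mat N I I)"
      using w unfolding preserves_radius_def by metis
    then show ?thesis using numerical_radius_unit_mat[OF that] by (simp add: Q_def)
  qed
  have "\<exists>u. normsq N u = 1 \<and> cmod (form N (Q I) u u) = 1" if I: "I < N" for I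
  proof -
    obtain u where "normsq N u = 1" "cmod (form N (Q I) u u) = numerical_radius (Q I)"
      by (rule numerical_radius_attained[OF Q N0])
    then show ?thesis using wQ[OF I] by auto
  qed
  then obtain u where u: "\<And>I. I < N \<Longrightarrow> normsq N (u I) = 1 \<and> cmod (form N (Q I) (u I) (u I)) = 1"
    by metis
  define c where "c I = form N (Q I) (u I) (u I)" for I
  have c: "cmod (c I) = 1" if "I < N" for I using u[OF that] by (simp add: c_def)
  have off: "form N (Q J) v (u I) = 0 \<and> form N (Q J) (u I) v = 0"
    if I: "I < N" and J: "J < N" "J \<noteq> I" for I J v
  proof -
    obtain e :: "nat \<Rightarrow> nat \<Rightarrow> nat"
      where inj: "inj_on (\<lambda>p. \<Sum>j<m. e j (digit m n p j)) {..<N}"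
        and e0: "(\<Sum>j<m. e j (digit m n I j)) = 0"
      using separating_exponents I unfolding N by blast
    define \<sigma> where "\<sigma> = (\<lambda>p. \<Sum>j<m. e j (digit m n p j))"
    let ?D = "\<lambda>\<omega> :: complex. mat_diag N (\<lambda>p. \<omega> ^ \<sigma> p)"
    have D: "?D \<omega> = kronecker_family m (\<lambda>j. mat_diag (n j) (\<lambda>i. \<omega> ^ e j i))" for \<omega>
      unfolding N \<sigma>_def power_sum by (rule kronecker_family_diag[OF n, symmetric])
    show ?thesis
    proof (rule torus_extremal_vector[where P = "\<lambda>\<omega>. \<phi> (?D \<omega>)" and Q = Q and \<sigma> = \<sigma> and I = I and N = N])
      show "inj_on \<sigma> {..<N}" "\<sigma> I = 0" using inj e0 by (simp_all add: \<sigma>_def)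
      show "\<phi> (?D \<omega>) \<in> carrier_mat N N" for \<omega> by (simp add: linear_map_matD[OF \<phi>])
      show "form N (\<phi> (?D \<omega>)) v w = (\<Sum>J<N. \<omega> ^ \<sigma> J * form N (Q J) v w)" for \<omega> v w
        using linear_functional_diag[OF linear_map_mat_comp_functional[OF \<phi> linear_functional_form]]
        by (simp add: Q_def)
      show "cmod (form N (\<phi> (?D \<omega>)) v v) \<le> normsq N v" if "cmod \<omega> = 1" for \<omega> v
      proof -
        have "numerical_radius (\<phi> (?D \<omega>)) = numerical_radius (?D \<omega>)"
          using w unfolding D preserves_radius_def by (simp add: families_def)
        also have "\<dots> \<le> 1"
          using that by (intro numerical_radius_diag_le N0) (simp add: norm_power)
        finally have "numerical_radius (\<phi> (?D \<omega>)) * normsq N v \<le> 1 * normsq N v"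
          by (intro mult_right_mono) simp_all
        moreover have "cmod (form N (\<phi> (?D \<omega>)) v v) \<le> numerical_radius (\<phi> (?D \<omega>)) * normsq N v"
          by (rule form_le_numerical_radius) (simp add: linear_map_matD[OF \<phi>])
        ultimately show ?thesis by simp
      qed
      show "normsq N (u I) = 1" "cmod (form N (Q I) (u I) (u I)) = 1" using u[OF I] by simp_all
    qed (use I J in simp_all)
  qed
  have orth: "(\<Sum>i<N. cnj (u J i) * u I i) = (if J = I then 1 else 0)" if IJ: "I < N" "J < N" for I J
  proof (cases "J = I")
    case True
    then show ?thesis using u[OF IJ(1)] by (simp flip: normsq_complex)
  next
    case False
    have "cmod (form N (Q I) v v) \<le> normsq N v" for v
      using form_le_numerical_radius[OF Q, of I v] wQ[OF IJ(1)] by simp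
    from extremal_vector_eigen[OF Q this, of "u I" "c I" "u J"] u[OF IJ(1)] c[OF IJ(1)]
    have "2 * (\<Sum>i<N. cnj (u J i) * u I i)
        = cnj (c I) * form N (Q I) (u J) (u I) + c I * cnj (form N (Q I) (u I) (u J))"
      by (simp add: c_def)
    then show ?thesis using off[OF IJ(2,1)] False by simp
  qed
  define U where "U = mat N N (\<lambda>(i, I). u I i)"
  have Uc: "U \<in> carrier_mat N N" by (simp add: U_def)
  have "U\<^sup>\<dagger> * U = 1\<^sub>m N"
  proof (rule eq_matI)
    fix J I assume "J < dim_row (1\<^sub>m N :: complex mat)" "I < dim_col (1\<^sub>m N :: complex mat)"
    then have IJ: "I < N" "J < N" by simp_all
    have "(U\<^sup>\<dagger> * U) $$ (J, I) = (\<Sum>i<N. U\<^sup>\<dagger> $$ (J, i) * U $$ (i, I))"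
      using Uc IJ by (intro index_mult_sum[of _ N N _ N]) simp_all
    also have "\<dots> = (\<Sum>i<N. cnj (u J i) * u I i)"
      using IJ by (intro sum.cong refl) (simp add: U_def)
    finally show "(U\<^sup>\<dagger> * U) $$ (J, I) = 1\<^sub>m N $$ (J, I)" using orth[OF IJ] IJ by simp
  qed (use Uc in simp_all)
  then have U: "U \<in> unitaries N" using Uc by (simp add: unitaries_def)
  have "Q I = U * (c I \<cdot>\<^sub>m unit_mat N I I) * U\<^sup>\<dagger>" if I: "I < N" for I
  proof -
    have "U\<^sup>\<dagger> * Q I * U = c I \<cdot>\<^sub>m unit_mat N I I" (is "?L = ?R")
    proof (rule eq_matI)
      fix p q assume "p < dim_row ?R" "q < dim_col ?R"
      then have pq: "p < N" "q < N" by simp_all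
      have "?L $$ (p, q) = form N (Q I) (\<lambda>i. U $$ (i, p)) (\<lambda>i. U $$ (i, q))"
        by (rule conj_index_form[OF Uc Q pq])
      also have "\<dots> = form N (Q I) (u p) (u q)"
        unfolding form_def using pq by (intro sum.cong refl) (simp add: U_def)
      also have "\<dots> = ?R $$ (p, q)"
        using off[OF pq(1) I] off[OF pq(2) I] pq
        by (cases "p = I"; cases "q = I") (simp_all add: c_def)
      finally show "?L $$ (p, q) = ?R $$ (p, q)" .
    qed (use Uc Q in simp_all)
    then show ?thesis using unitary_conj_cancel(2)[OF U Q, of I] by simp
  qed
  then show ?thesis using U c unfolding Q_def by blast
qed

section \<open>Removing the scalar\<close>

lemma form_sum_right:
  "form n A w (\<lambda>i. \<Sum>q<k. u q * f q i) = (\<Sum>q<k. u q * form n A w (f q))"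
proof -
  have "form n A w (\<lambda>i. \<Sum>q<k. u q * f q i)
      = (\<Sum>i<n. \<Sum>j<n. \<Sum>q<k. u q * (cnj (w i) * A $$ (i, j) * f q j))"
    unfolding form_def sum_distrib_left by (intro sum.cong refl) (simp add: mult_ac)
  also have "\<dots> = (\<Sum>i<n. \<Sum>q<k. \<Sum>j<n. u q * (cnj (w i) * A $$ (i, j) * f q j))"
    by (intro sum.cong refl sum.swap)
  also have "\<dots> = (\<Sum>q<k. \<Sum>i<n. \<Sum>j<n. u q * (cnj (w i) * A $$ (i, j) * f q j))"
    by (rule sum.swap)
  finally show ?thesis by (simp only: form_def sum_distrib_left)
qed

lemma form_sum_left:
  assumes A: "A \<in> carrier_mat n n"
  shows "form n A (\<lambda>i. \<Sum>q<k. u q * f q i) w = (\<Sum>q<k. cnj (u q) * form n A (f q) w)"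
proof -
  have flip: "form n A x w = cnj (form n (A\<^sup>\<dagger>) w x)" for x
    using form_adjoint[OF A, of w x] by simp
  show ?thesis unfolding flip form_sum_right by simp
qed

lemma form_unitary_conj:
  assumes U: "U \<in> carrier_mat n n" and A: "A \<in> carrier_mat n n"
  shows "form n (U\<^sup>\<dagger> * A * U) v w
    = form n A (\<lambda>i. \<Sum>q<n. v q * U $$ (i, q)) (\<lambda>i. \<Sum>q<n. w q * U $$ (i, q))"
  unfolding form_sum_right form_sum_left[OF A]
  unfolding form_def[of n "U\<^sup>\<dagger> * A * U"] sum_distrib_left
  by (subst sum.swap) (intro sum.cong refl, simp add: conj_index_form[OF U A] mult_ac del: index_mult_mat)

lemma numerical_radius_unitary_conj_le:
  assumes U: "U \<in> unitaries n" and A: "A \<in> carrier_mat n n" and n: "n > 0"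
  shows "numerical_radius (U\<^sup>\<dagger> * A * U) \<le> numerical_radius A"
proof (rule numerical_radius_leI[OF _ n])
  note Uc = unitariesD[OF U]
  show "U\<^sup>\<dagger> * A * U \<in> carrier_mat n n" using Uc A by simp
  fix v
  let ?v = "\<lambda>i. \<Sum>q<n. v q * U $$ (i, q)"
  have "form n (1\<^sub>m n) ?v ?v = form n (U\<^sup>\<dagger> * 1\<^sub>m n * U) v v"
    by (rule form_unitary_conj[symmetric]) (use Uc in simp_all)
  also have "U\<^sup>\<dagger> * 1\<^sub>m n * U = 1\<^sub>m n" using Uc by (simp add: right_mult_one_mat[of _ n n])
  finally have "complex_of_real (normsq n ?v) = complex_of_real (normsq n v)"
    unfolding form_one normsq_complex .
  then have "normsq n ?v = normsq n v" by (simp only: of_real_eq_iff)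
  then show "cmod (form n (U\<^sup>\<dagger> * A * U) v v) \<le> numerical_radius A * normsq n v"
    using form_le_numerical_radius[OF A, of ?v] by (simp only: form_unitary_conj[OF Uc(1) A])
qed

lemma numerical_radius_unitary_conj:
  assumes U: "U \<in> unitaries n" and A: "A \<in> carrier_mat n n" and n: "n > 0"
  shows "numerical_radius (U * A * U\<^sup>\<dagger>) = numerical_radius A"
proof (rule antisym)
  note Uc = unitariesD[OF U]
  show "numerical_radius (U * A * U\<^sup>\<dagger>) \<le> numerical_radius A"
    using numerical_radius_unitary_conj_le[OF Uc(4) A n] by simp
  have "numerical_radius (U\<^sup>\<dagger> * (U * A * U\<^sup>\<dagger>) * U) \<le> numerical_radius (U * A * U\<^sup>\<dagger>)"
    using Uc A by (intro numerical_radius_unitary_conj_le[OF U _ n]) simp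
  then show "numerical_radius A \<le> numerical_radius (U * A * U\<^sup>\<dagger>)"
    unfolding unitary_conj_cancel(1)[OF U A] .
qed

lemma smult_smult_mat: "a \<cdot>\<^sub>m (b \<cdot>\<^sub>m A) = (a * b) \<cdot>\<^sub>m (A :: 'a :: semigroup_mult mat)"
  by (rule eq_matI) (simp_all add: mult.assoc)

lemma one_smult_mat: "1 \<cdot>\<^sub>m A = (A :: 'a :: monoid_mult mat)"
  by (rule eq_matI) simp_all

lemma linear_map_unitary_conj:
  assumes \<phi>: "linear_map_mat N \<phi>" and W: "W \<in> carrier_mat N N"
  shows "linear_map_mat N (\<lambda>X. \<phi> (W * X * W\<^sup>\<dagger>))"
  unfolding linear_map_mat_iff
proof (intro conjI ballI allI)
  fix X :: "complex mat" assume X: "X \<in> carrier_mat N N"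
  show "\<phi> (W * X * W\<^sup>\<dagger>) \<in> carrier_mat N N" using X W by (simp add: linear_map_matD[OF \<phi>])
  fix Y :: "complex mat" assume Y: "Y \<in> carrier_mat N N"
  have "W * (X + Y) * W\<^sup>\<dagger> = W * X * W\<^sup>\<dagger> + W * Y * W\<^sup>\<dagger>"
    using X Y W by (simp add: mult_add_distrib_mat[of _ N N _ N] add_mult_distrib_mat[of _ N N _ _ N])
  then show "\<phi> (W * (X + Y) * W\<^sup>\<dagger>) = \<phi> (W * X * W\<^sup>\<dagger>) + \<phi> (W * Y * W\<^sup>\<dagger>)"
    using X Y W by (simp add: linear_map_matD[OF \<phi>])
next
  fix c and X :: "complex mat" assume X: "X \<in> carrier_mat N N"
  have "W * (c \<cdot>\<^sub>m X) * W\<^sup>\<dagger> = c \<cdot>\<^sub>m (W * X * W\<^sup>\<dagger>)"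
    using X W by (simp add: mult_smult_distrib[of _ N N _ N] mult_smult_assoc_mat[of _ N N _ N])
  then show "\<phi> (W * (c \<cdot>\<^sub>m X) * W\<^sup>\<dagger>) = c \<cdot>\<^sub>m \<phi> (W * X * W\<^sup>\<dagger>)"
    using X W by (simp add: linear_map_matD[OF \<phi>])
qed

text \<open>Conjugation by a Kronecker product of unitaries preserves the hypotheses.\<close>
lemma image_of_product_basis:
  assumes n: "\<And>j. j < m \<Longrightarrow> n j > 0" and N: "N = (\<Prod>j<m. n j)"
    and \<phi>: "linear_map_mat N \<phi>" and w: "preserves_radius m n \<phi>"
    and V: "\<And>j. j < m \<Longrightarrow> V j \<in> unitaries (n j)"
  shows "\<exists>U\<in>unitaries N. \<exists>c. \<forall>I<N. cmod (c I) = 1 \<and>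
    \<phi> (kronecker_family m V * unit_mat N I I * (kronecker_family m V)\<^sup>\<dagger>) = U * (c I \<cdot>\<^sub>m unit_mat N I I) * U\<^sup>\<dagger>"
proof -
  let ?W = "kronecker_family m V"
  have N0: "N > 0" using n unfolding N by (intro prod_pos) simp
  have W: "?W \<in> unitaries N" unfolding N by (rule kronecker_family_unitary[OF V n])
  note Vc = unitariesD(1)[OF V]
  have "preserves_radius m n (\<lambda>X. \<phi> (?W * X * ?W\<^sup>\<dagger>))"
    unfolding preserves_radius_def
  proof
    fix A assume A: "A \<in> families m n"
    note AN = kronecker_family_in_carrier[OF A, folded N]
    have VA: "(\<lambda>j. V j * A j * (V j)\<^sup>\<dagger>) \<in> families m n"
      using A Vc by (simp add: families_def)
    have "numerical_radius (\<phi> (kronecker_family m (\<lambda>j. V j * A j * (V j)\<^sup>\<dagger>)))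
        = numerical_radius (kronecker_family m (\<lambda>j. V j * A j * (V j)\<^sup>\<dagger>))"
      using w VA unfolding preserves_radius_def by blast
    then show "numerical_radius (\<phi> (?W * kronecker_family m A * ?W\<^sup>\<dagger>)) = numerical_radius (kronecker_family m A)"
      using numerical_radius_unitary_conj[OF W AN N0] by (simp only: kronecker_family_conj[OF Vc A n])
  qed
  from image_of_standard_basis[OF n N linear_map_unitary_conj[OF \<phi> unitariesD(1)[OF W]] this]
  show ?thesis .
qed

text \<open>A linear map that carries every product basis of rank-one projections to a basis of
  rank-one projections.\<close>
locale frame_map =
  fixes m :: nat and n :: "nat \<Rightarrow> nat" and N :: nat and \<psi> :: "complex mat \<Rightarrow> complex mat"
  assumes pos: "\<And>j. j < m \<Longrightarrow> n j > 0"
    and N: "N = (\<Prod>j<m. n j)"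
    and linear: "linear_map_mat N \<psi>"
    and frame: "\<And>V. (\<And>j. j < m \<Longrightarrow> V j \<in> unitaries (n j)) \<Longrightarrow> \<exists>U\<in>unitaries N. \<forall>I<N.
      \<psi> (kronecker_family m V * unit_mat N I I * (kronecker_family m V)\<^sup>\<dagger>) = U * unit_mat N I I * U\<^sup>\<dagger>"

lemma rank_one_family:
  assumes n: "\<And>j. j < m \<Longrightarrow> n j > 0" and N: "N = (\<Prod>j<m. n j)"
    and P: "\<And>j. j < m \<Longrightarrow> P j \<in> rank_one_projections (n j)"
  obtains V I where "\<forall>j<m. V j \<in> unitaries (n j)" "I < N"
    "kronecker_family m P = kronecker_family m V * unit_mat N I I * (kronecker_family m V)\<^sup>\<dagger>"
proof -
  have "\<forall>j\<in>{..<m}. \<exists>V a. V \<in> unitaries (n j) \<and> a < n j \<and> P j = V * unit_mat (n j) a a * V\<^sup>\<dagger>"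
    using P unfolding rank_one_projections_def by blast
  then obtain V a where Va: "\<And>j. j < m \<Longrightarrow> V j \<in> unitaries (n j) \<and> a j < n j \<and>
      P j = V j * unit_mat (n j) (a j) (a j) * (V j)\<^sup>\<dagger>"
    by (metis lessThan_iff)
  obtain I where I: "I < N" "\<forall>j<m. digit m n I j = a j"
    using digit_surject[of m a n] Va unfolding N by blast
  let ?E = "\<lambda>j. unit_mat (n j) (digit m n I j) (digit m n I j)"
  have "kronecker_family m P = kronecker_family m (\<lambda>j. V j * ?E j * (V j)\<^sup>\<dagger>)"
    by (rule kronecker_family_cong) (simp add: Va I(2))
  also have "\<dots> = kronecker_family m V * kronecker_family m ?E * (kronecker_family m V)\<^sup>\<dagger>"
  proof (rule kronecker_family_conj[OF _ _ n])
    show "V j \<in> carrier_mat (n j) (n j)" if "j < m" for j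
      using Va[OF that] unitariesD(1) by blast
  qed (simp add: families_def)
  also have "kronecker_family m ?E = unit_mat N I I"
    using kronecker_family_unit_mat[OF n] I(1) unfolding N by simp
  finally show ?thesis using that[of V I] Va I(1) by blast
qed

text \<open>The scalars in the images of all product bases are traces of images of rank-one projections, that
  is, values of a multilinear function that is unimodular there; hence they are all equal.\<close>
lemma preserver_scalar_frame_map:
  assumes n: "\<And>j. j < m \<Longrightarrow> n j > 0" and N: "N = (\<Prod>j<m. n j)"
    and \<phi>: "linear_map_mat N \<phi>" and w: "preserves_radius m n \<phi>"
  shows "\<exists>\<xi>. cmod \<xi> = 1 \<and> frame_map m n N (\<lambda>X. inverse \<xi> \<cdot>\<^sub>m \<phi> X)"
proof -
  define g where "g A = trace_mat (\<phi> (kronecker_family m A))" for A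
  have g: "multilinear m n g"
    unfolding g_def using linear_map_mat_comp_functional[OF \<phi> linear_functional_trace]
    unfolding N by (intro multilinear_kronecker n)
  have trace: "trace_mat (U * (c \<cdot>\<^sub>m unit_mat N I I) * U\<^sup>\<dagger>) = c" if "U \<in> unitaries N" "I < N" for U c I
    using that by (simp add: trace_unitary_conj trace_mat_smult[of _ N] trace_unit_mat)
  have uni: "cmod (g P) = 1" if P: "\<And>j. j < m \<Longrightarrow> P j \<in> rank_one_projections (n j)" for P
  proof -
    obtain V I where VI: "\<forall>j<m. V j \<in> unitaries (n j)" "I < N"
      "kronecker_family m P = kronecker_family m V * unit_mat N I I * (kronecker_family m V)\<^sup>\<dagger>"
      by (rule rank_one_family[OF n N P])
    obtain U c where U: "U \<in> unitaries N" and c: "\<forall>I<N. cmod (c I) = 1 \<and>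
      \<phi> (kronecker_family m V * unit_mat N I I * (kronecker_family m V)\<^sup>\<dagger>) = U * (c I \<cdot>\<^sub>m unit_mat N I I) * U\<^sup>\<dagger>"
      using image_of_product_basis[OF n N \<phi> w] VI(1) by blast
    then have "\<phi> (kronecker_family m P) = U * (c I \<cdot>\<^sub>m unit_mat N I I) * U\<^sup>\<dagger>" "cmod (c I) = 1"
      using VI by simp_all
    then show ?thesis unfolding g_def by (simp add: trace U VI(2))
  qed
  define E where "E = (\<lambda>j. unit_mat (n j) 0 0)"
  have E: "E j \<in> rank_one_projections (n j)" if "j < m" for j
    unfolding E_def by (rule unit_mat_rank_one[OF n[OF that]])
  define \<xi> where "\<xi> = g E"
  have \<xi>: "cmod \<xi> = 1" unfolding \<xi>_def by (rule uni[OF E])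
  have const: "g P = \<xi>" if P: "\<And>j. j < m \<Longrightarrow> P j \<in> rank_one_projections (n j)" for P
    unfolding \<xi>_def
  proof (rule multilinear_unimodular_constant[OF g, where R = "\<lambda>j. rank_one_projections (n j)"])
    show "g P = g Q" if "\<And>j. j < m \<Longrightarrow> P j = Q j" for P Q
      unfolding g_def using kronecker_family_cong[OF that] by simp
  qed (use uni P E in simp_all)
  have "frame_map m n N (\<lambda>X. inverse \<xi> \<cdot>\<^sub>m \<phi> X)"
  proof (rule frame_map.intro)
    show "n j > 0" if "j < m" for j by (rule n[OF that])
    show "N = (\<Prod>j<m. n j)" by (rule N)
    show "linear_map_mat N (\<lambda>X. inverse \<xi> \<cdot>\<^sub>m \<phi> X)"
      unfolding linear_map_mat_iff
      by (simp add: linear_map_matD[OF \<phi>] add_smult_distrib_left_mat[of _ N N] smult_smult_mat mult.commute)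
    fix V assume V: "\<And>j. j < m \<Longrightarrow> V j \<in> unitaries (n j)"
    obtain U c where U: "U \<in> unitaries N" and c: "\<forall>I<N. cmod (c I) = 1 \<and>
      \<phi> (kronecker_family m V * unit_mat N I I * (kronecker_family m V)\<^sup>\<dagger>) = U * (c I \<cdot>\<^sub>m unit_mat N I I) * U\<^sup>\<dagger>"
      using image_of_product_basis[OF n N \<phi> w V] by blast
    have "inverse \<xi> \<cdot>\<^sub>m \<phi> (kronecker_family m V * unit_mat N I I * (kronecker_family m V)\<^sup>\<dagger>)
        = U * unit_mat N I I * U\<^sup>\<dagger>" if I: "I < N" for I
    proof -
      define P where "P j = V j * unit_mat (n j) (digit m n I j) (digit m n I j) * (V j)\<^sup>\<dagger>" for j
      let ?E = "\<lambda>j. unit_mat (n j) (digit m n I j) (digit m n I j)"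
      have "P j \<in> rank_one_projections (n j)" if "j < m" for j
        unfolding rank_one_projections_def P_def using V[OF that] digit_less[of m n j I] n that by blast
      then have "g P = \<xi>" by (rule const)
      moreover have "kronecker_family m P = kronecker_family m V * kronecker_family m ?E * (kronecker_family m V)\<^sup>\<dagger>"
        unfolding P_def
        by (rule kronecker_family_conj[OF unitariesD(1)[OF V] _ n]) (simp_all add: families_def)
      moreover have "kronecker_family m ?E = unit_mat N I I"
        using kronecker_family_unit_mat[OF n] I unfolding N by simp
      ultimately have "c I = \<xi>"
        using c I unfolding g_def by (simp add: trace U)
      moreover have "U * (\<xi> \<cdot>\<^sub>m unit_mat N I I) * U\<^sup>\<dagger> = \<xi> \<cdot>\<^sub>m (U * unit_mat N I I * U\<^sup>\<dagger>)"
        using unitariesD(1)[OF U] by (simp add: mult_smult_distrib[of _ N N _ N] mult_smult_assoc_mat[of _ N N _ N])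
      moreover have "\<xi> \<noteq> 0" using \<xi> by auto
      ultimately show ?thesis using c I by (simp add: smult_smult_mat one_smult_mat)
    qed
    with U show "\<exists>U\<in>unitaries N. \<forall>I<N.
      inverse \<xi> \<cdot>\<^sub>m \<phi> (kronecker_family m V * unit_mat N I I * (kronecker_family m V)\<^sup>\<dagger>) = U * unit_mat N I I * U\<^sup>\<dagger>"
      by blast
  qed
  with \<xi> show ?thesis by blast
qed

section \<open>Commuting Hermitian families\<close>

context frame_map
begin

definition tensor_image :: "(nat \<Rightarrow> complex mat) \<Rightarrow> complex mat" where
  "tensor_image A = \<psi> (kronecker_family m A)"

lemma image_carrier: "A \<in> families m n \<Longrightarrow> tensor_image A \<in> carrier_mat N N"
  unfolding tensor_image_def using kronecker_family_in_carrier[of A m n]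
  by (simp add: N[symmetric] linear_map_matD[OF linear])

lemma image_cong: "(\<And>j. j < m \<Longrightarrow> A j = B j) \<Longrightarrow> tensor_image A = tensor_image B"
  unfolding tensor_image_def by (simp only: kronecker_family_cong[of m A B])

lemma multilinear_image:
  assumes "linear_functional N l" shows "multilinear m n (\<lambda>A. l (tensor_image A))"
  unfolding tensor_image_def
  using linear_map_mat_comp_functional[OF linear assms] pos unfolding N
  by (intro multilinear_kronecker) simp_all

lemma image_update_add:
  assumes A: "A \<in> families m n" and j: "j < m" and X: "X \<in> carrier_mat (n j) (n j)" "Y \<in> carrier_mat (n j) (n j)"
  shows "tensor_image (A(j := X + Y)) = tensor_image (A(j := X)) + tensor_image (A(j := Y))"
  unfolding tensor_image_def
  using kronecker_family_update_add[OF A j pos X] kronecker_family_in_carrier[OF families_update[of A m n X j, OF A X(1)]]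
    kronecker_family_in_carrier[OF families_update[of A m n Y j, OF A X(2)]]
  by (simp add: N[symmetric] linear_map_matD[OF linear])

lemma image_update_smult:
  assumes A: "A \<in> families m n" and j: "j < m" and X: "X \<in> carrier_mat (n j) (n j)"
  shows "tensor_image (A(j := c \<cdot>\<^sub>m X)) = c \<cdot>\<^sub>m tensor_image (A(j := X))"
  unfolding tensor_image_def
  using kronecker_family_update_smult[OF A j pos X, of c] kronecker_family_in_carrier[OF families_update[of A m n X j, OF A X]]
  by (simp add: N[symmetric] linear_map_matD[OF linear])

lemma frame_diag:
  assumes V: "\<And>j. j < m \<Longrightarrow> V j \<in> unitaries (n j)"
  shows "\<exists>U\<in>unitaries N. \<forall>d. \<psi> (kronecker_family m V * mat_diag N d * (kronecker_family m V)\<^sup>\<dagger>)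
    = U * mat_diag N d * U\<^sup>\<dagger>"
proof -
  let ?W = "kronecker_family m V"
  have W: "?W \<in> carrier_mat N N"
    unfolding N by (rule unitariesD(1)[OF kronecker_family_unitary[OF V pos]])
  obtain U where U: "U \<in> unitaries N" and UI: "\<forall>I<N. \<psi> (?W * unit_mat N I I * ?W\<^sup>\<dagger>) = U * unit_mat N I I * U\<^sup>\<dagger>"
    using frame[OF V] by blast
  note Uc = unitariesD(1)[OF U]
  have id: "linear_map_mat N (\<lambda>X. X)" unfolding linear_map_mat_iff by simp
  have "\<psi> (?W * mat_diag N d * ?W\<^sup>\<dagger>) = U * mat_diag N d * U\<^sup>\<dagger>" for d
  proof (rule eq_matI)
    fix p q assume "p < dim_row (U * mat_diag N d * U\<^sup>\<dagger>)" "q < dim_col (U * mat_diag N d * U\<^sup>\<dagger>)"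
    then have pq: "p < N" "q < N" using Uc by simp_all
    note l = linear_functional_index[OF pq]
    show "\<psi> (?W * mat_diag N d * ?W\<^sup>\<dagger>) $$ (p, q) = (U * mat_diag N d * U\<^sup>\<dagger>) $$ (p, q)"
      using linear_functional_diag[OF linear_map_mat_comp_functional[OF linear_map_unitary_conj[OF linear W] l], of d]
        linear_functional_diag[OF linear_map_mat_comp_functional[OF linear_map_unitary_conj[OF id Uc] l], of d]
      by (simp add: UI del: index_mult_mat)
  next
    have "\<psi> (?W * mat_diag N d * ?W\<^sup>\<dagger>) \<in> carrier_mat N N" "U * mat_diag N d * U\<^sup>\<dagger> \<in> carrier_mat N N"
      using W Uc by (simp_all add: linear_map_matD[OF linear])
    then show "dim_row (\<psi> (?W * mat_diag N d * ?W\<^sup>\<dagger>)) = dim_row (U * mat_diag N d * U\<^sup>\<dagger>)"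
      "dim_col (\<psi> (?W * mat_diag N d * ?W\<^sup>\<dagger>)) = dim_col (U * mat_diag N d * U\<^sup>\<dagger>)"
      by (simp_all del: index_mult_mat)
  qed
  with U show ?thesis by blast
qed

lemma hermitian_family_diagonalisation:
  assumes "\<And>j. j < m \<Longrightarrow> C j \<in> hermitians (n j)"
  obtains V d where "\<forall>j<m. V j \<in> unitaries (n j)"
    "\<forall>j<m. C j = V j * mat_diag (n j) (\<lambda>i. complex_of_real (d j i)) * (V j)\<^sup>\<dagger>"
proof -
  have "\<forall>j\<in>{..<m}. \<exists>V d. V \<in> unitaries (n j) \<and> C j = V * mat_diag (n j) (\<lambda>i. complex_of_real (d i)) * V\<^sup>\<dagger>"
    using hermitian_diagonalisation assms by blast
  then show ?thesis using that by (metis lessThan_iff)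
qed

lemma conj_diag_family:
  assumes V: "\<And>j. j < m \<Longrightarrow> V j \<in> unitaries (n j)"
  shows "kronecker_family m (\<lambda>j. V j * mat_diag (n j) (d j) * (V j)\<^sup>\<dagger>)
    = kronecker_family m V * mat_diag N (\<lambda>p. \<Prod>j<m. d j (digit m n p j)) * (kronecker_family m V)\<^sup>\<dagger>"
proof -
  have "kronecker_family m (\<lambda>j. V j * mat_diag (n j) (d j) * (V j)\<^sup>\<dagger>)
      = kronecker_family m V * kronecker_family m (\<lambda>j. mat_diag (n j) (d j)) * (kronecker_family m V)\<^sup>\<dagger>"
    by (rule kronecker_family_conj[OF unitariesD(1)[OF V] _ pos]) (simp_all add: families_def)
  then show ?thesis by (simp only: kronecker_family_diag[OF pos] N)
qed

lemma image_commuting_mult: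
  assumes V: "\<And>j. j < m \<Longrightarrow> V j \<in> unitaries (n j)"
    and A: "\<And>j. j < m \<Longrightarrow> A j = V j * mat_diag (n j) (d j) * (V j)\<^sup>\<dagger>"
    and B: "\<And>j. j < m \<Longrightarrow> B j = V j * mat_diag (n j) (e j) * (V j)\<^sup>\<dagger>"
  shows "tensor_image A * tensor_image B = tensor_image (\<lambda>j. A j * B j)"
proof -
  obtain U where U: "U \<in> unitaries N" and Ud: "\<And>d. \<psi> (kronecker_family m V * mat_diag N d * (kronecker_family m V)\<^sup>\<dagger>)
    = U * mat_diag N d * U\<^sup>\<dagger>"
    using frame_diag[OF V] by blast
  have img: "tensor_image A = U * mat_diag N (\<lambda>p. \<Prod>j<m. d j (digit m n p j)) * U\<^sup>\<dagger>"
    if "\<And>j. j < m \<Longrightarrow> A j = V j * mat_diag (n j) (d j) * (V j)\<^sup>\<dagger>" for A d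
  proof -
    have "tensor_image A = tensor_image (\<lambda>j. V j * mat_diag (n j) (d j) * (V j)\<^sup>\<dagger>)"
      by (rule image_cong) (rule that)
    then show ?thesis by (simp only: tensor_image_def conj_diag_family[OF V] Ud)
  qed
  have AB: "A j * B j = V j * mat_diag (n j) (\<lambda>i. d j i * e j i) * (V j)\<^sup>\<dagger>" if "j < m" for j
    unfolding A[OF that] B[OF that] by (simp add: unitary_conj_mult[OF V[OF that]])
  have "tensor_image A = U * mat_diag N (\<lambda>p. \<Prod>j<m. d j (digit m n p j)) * U\<^sup>\<dagger>"
    by (rule img) (rule A)
  moreover have "tensor_image B = U * mat_diag N (\<lambda>p. \<Prod>j<m. e j (digit m n p j)) * U\<^sup>\<dagger>"
    by (rule img) (rule B)
  moreover have "tensor_image (\<lambda>j. A j * B j)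
      = U * mat_diag N (\<lambda>p. \<Prod>j<m. d j (digit m n p j) * e j (digit m n p j)) * U\<^sup>\<dagger>"
    by (rule img) (rule AB)
  ultimately show ?thesis by (simp add: unitary_conj_mult[OF U] prod.distrib)
qed

lemma image_hermitian:
  assumes C: "\<And>j. j < m \<Longrightarrow> C j \<in> hermitians (n j)"
  shows "(tensor_image C)\<^sup>\<dagger> = tensor_image C"
proof -
  obtain V d where V: "\<forall>j<m. V j \<in> unitaries (n j)"
    and Cd: "\<forall>j<m. C j = V j * mat_diag (n j) (\<lambda>i. complex_of_real (d j i)) * (V j)\<^sup>\<dagger>"
    by (rule hermitian_family_diagonalisation[OF C])
  then have V': "\<And>j. j < m \<Longrightarrow> V j \<in> unitaries (n j)" by blast
  obtain U where U: "U \<in> unitaries N" and Ud: "\<And>d. \<psi> (kronecker_family m V * mat_diag N d * (kronecker_family m V)\<^sup>\<dagger>)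
    = U * mat_diag N d * U\<^sup>\<dagger>"
    using frame_diag[OF V'] by blast
  have "tensor_image C = tensor_image (\<lambda>j. V j * mat_diag (n j) (\<lambda>i. complex_of_real (d j i)) * (V j)\<^sup>\<dagger>)"
    by (rule image_cong) (use Cd in blast)
  also have "\<dots> = U * mat_diag N (\<lambda>p. \<Prod>j<m. complex_of_real (d j (digit m n p j))) * U\<^sup>\<dagger>"
    by (simp only: tensor_image_def conj_diag_family[OF V'] Ud)
  finally have eq: "tensor_image C = U * mat_diag N (\<lambda>p. \<Prod>j<m. complex_of_real (d j (digit m n p j))) * U\<^sup>\<dagger>" .
  have "(mat_diag N (\<lambda>p. \<Prod>j<m. complex_of_real (d j (digit m n p j))))\<^sup>\<dagger>
      = mat_diag N (\<lambda>p. \<Prod>j<m. complex_of_real (d j (digit m n p j)))"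
    by (rule eq_matI) (auto simp: mat_diag_def)
  then show ?thesis unfolding eq by (simp add: unitary_conj_adjoint[OF U])
qed

abbreviation one_family :: "nat \<Rightarrow> complex mat" where
  "one_family \<equiv> (\<lambda>j. 1\<^sub>m (n j))"

lemma one_family: "one_family \<in> families m n" by (simp add: families_def)

lemma image_one: "tensor_image one_family = 1\<^sub>m N"
proof -
  have V: "\<And>j. j < m \<Longrightarrow> 1\<^sub>m (n j) \<in> unitaries (n j)" by simp
  obtain U where U: "U \<in> unitaries N" and Ud: "\<And>d. \<psi> (kronecker_family m one_family * mat_diag N d * (kronecker_family m one_family)\<^sup>\<dagger>)
    = U * mat_diag N d * U\<^sup>\<dagger>"
    using frame_diag[OF V] by blast
  have one: "kronecker_family m one_family = 1\<^sub>m N" unfolding N by (rule kronecker_family_one[OF pos])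
  have "\<psi> (1\<^sub>m N * mat_diag N (\<lambda>_. 1) * (1\<^sub>m N)\<^sup>\<dagger>) = U * mat_diag N (\<lambda>_. 1) * U\<^sup>\<dagger>"
    using Ud[of "\<lambda>_. 1"] unfolding one .
  then show ?thesis
    unfolding tensor_image_def one using unitariesD[OF U]
    by (simp add: right_mult_one_mat[of _ N N] left_mult_one_mat[of _ N N])
qed

text \<open>The images of factors in complementary sets of slots commute, and multiply to the image of
  the whole product: this is clear for Hermitian factors, which are diagonal in one product basis,
  and extends by multilinearity.\<close>
lemma image_split:
  assumes C: "C \<in> families m n"
  shows "tensor_image (\<lambda>j. if j \<in> S then C j else 1\<^sub>m (n j)) * tensor_image (\<lambda>j. if j \<in> S then 1\<^sub>m (n j) else C j) = tensor_image C"
proof -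
  define A where "A C = (\<lambda>j. if j \<in> S then C j else 1\<^sub>m (n j))" for C :: "nat \<Rightarrow> complex mat"
  define B where "B C = (\<lambda>j. if j \<in> S then 1\<^sub>m (n j) else C j)" for C :: "nat \<Rightarrow> complex mat"
  have fam: "A C \<in> families m n" "B C \<in> families m n" if "C \<in> families m n" for C
    using that by (simp_all add: families_def A_def B_def)
  have entry: "(tensor_image (A C) * tensor_image (B C)) $$ (p, q) - tensor_image C $$ (p, q) = 0"
    if pq: "p < N" "q < N" for p q
  proof (rule multilinear_eq_0[where m = m and n = n and B = "\<lambda>j. hermitians (n j)"
        and g = "\<lambda>C. (tensor_image (A C) * tensor_image (B C)) $$ (p, q) - tensor_image C $$ (p, q)" and A = C])
    show "multilinear m n (\<lambda>C. (tensor_image (A C) * tensor_image (B C)) $$ (p, q) - tensor_image C $$ (p, q))"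
    proof (rule multilinear_diff)
      show "multilinear m n (\<lambda>C. tensor_image C $$ (p, q))"
        by (rule multilinear_image[OF linear_functional_index[OF pq]])
      show "multilinear m n (\<lambda>C. (tensor_image (A C) * tensor_image (B C)) $$ (p, q))"
        unfolding multilinear_def
      proof (intro ballI allI impI linear_functionalI)
        fix C j and X Y :: "complex mat"
        assume C: "C \<in> families m n" and j: "j < m" and X: "X \<in> carrier_mat (n j) (n j)" and Y: "Y \<in> carrier_mat (n j) (n j)"
        note car = image_carrier[OF fam(1)[OF C]] image_carrier[OF fam(2)[OF C]]
          image_carrier[OF families_update[of _ _ _ X j, OF fam(1)[OF C] X]]
          image_carrier[OF families_update[of _ _ _ X j, OF fam(2)[OF C] X]]
          image_carrier[OF families_update[of _ _ _ Y j, OF fam(1)[OF C] Y]]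
          image_carrier[OF families_update[of _ _ _ Y j, OF fam(2)[OF C] Y]]
        show "(tensor_image (A (C(j := X + Y))) * tensor_image (B (C(j := X + Y)))) $$ (p, q)
          = (tensor_image (A (C(j := X))) * tensor_image (B (C(j := X)))) $$ (p, q)
            + (tensor_image (A (C(j := Y))) * tensor_image (B (C(j := Y)))) $$ (p, q)"
        proof (cases "j \<in> S")
          case True
          then have "A (C(j := Z)) = (A C)(j := Z)" "B (C(j := Z)) = B C" for Z
            by (auto simp: A_def B_def fun_eq_iff)
          then show ?thesis using pq car
            by (simp add: image_update_add[OF fam(1)[OF C] j X Y] add_mult_distrib_mat[of _ N N _ _ N] del: index_mult_mat(1) fun_upd_apply)
        next
          case False
          then have "B (C(j := Z)) = (B C)(j := Z)" "A (C(j := Z)) = A C" for Z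
            by (auto simp: A_def B_def fun_eq_iff)
          then show ?thesis using pq car
            by (simp add: image_update_add[OF fam(2)[OF C] j X Y] mult_add_distrib_mat[of _ N N _ N] del: index_mult_mat(1) fun_upd_apply)
        qed
      next
        fix C j c and X :: "complex mat"
        assume C: "C \<in> families m n" and j: "j < m" and X: "X \<in> carrier_mat (n j) (n j)"
        note car = image_carrier[OF fam(1)[OF C]] image_carrier[OF fam(2)[OF C]]
          image_carrier[OF families_update[of _ _ _ X j, OF fam(1)[OF C] X]]
          image_carrier[OF families_update[of _ _ _ X j, OF fam(2)[OF C] X]]
        show "(tensor_image (A (C(j := c \<cdot>\<^sub>m X))) * tensor_image (B (C(j := c \<cdot>\<^sub>m X)))) $$ (p, q)
          = c * (tensor_image (A (C(j := X))) * tensor_image (B (C(j := X)))) $$ (p, q)"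
        proof (cases "j \<in> S")
          case True
          then have "A (C(j := Z)) = (A C)(j := Z)" "B (C(j := Z)) = B C" for Z
            by (auto simp: A_def B_def fun_eq_iff)
          then show ?thesis using pq car
            by (simp add: image_update_smult[OF fam(1)[OF C] j X] mult_smult_assoc_mat[of _ N N _ N] del: index_mult_mat(1) fun_upd_apply)
        next
          case False
          then have "B (C(j := Z)) = (B C)(j := Z)" "A (C(j := Z)) = A C" for Z
            by (auto simp: A_def B_def fun_eq_iff)
          then show ?thesis using pq car
            by (simp add: image_update_smult[OF fam(2)[OF C] j X] mult_smult_distrib[of _ N N _ N] del: index_mult_mat(1) fun_upd_apply)
        qed
      qed
    qed
    show "(tensor_image (A C) * tensor_image (B C)) $$ (p, q) - tensor_image C $$ (p, q) = 0"
      if C: "\<And>j. j < m \<Longrightarrow> C j \<in> hermitians (n j)" for C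
    proof -
      obtain V d where V: "\<forall>j<m. V j \<in> unitaries (n j)"
        and Cd: "\<forall>j<m. C j = V j * mat_diag (n j) (\<lambda>i. complex_of_real (d j i)) * (V j)\<^sup>\<dagger>"
        by (rule hermitian_family_diagonalisation[OF C])
      have one: "1\<^sub>m (n j) = V j * mat_diag (n j) (\<lambda>_. 1) * (V j)\<^sup>\<dagger>" if "j < m" for j
        using unitariesD[of "V j" "n j"] V that by (simp add: right_mult_one_mat[of _ "n j" "n j"])
      have "tensor_image (A C) * tensor_image (B C) = tensor_image (\<lambda>j. A C j * B C j)"
      proof (rule image_commuting_mult[where V = V
            and d = "\<lambda>j. if j \<in> S then (\<lambda>i. complex_of_real (d j i)) else (\<lambda>_. 1)"
            and e = "\<lambda>j. if j \<in> S then (\<lambda>_. 1) else (\<lambda>i. complex_of_real (d j i))"])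
        fix j assume j: "j < m"
        show "V j \<in> unitaries (n j)" using V j by blast
        show "A C j = V j * mat_diag (n j) (if j \<in> S then (\<lambda>i. complex_of_real (d j i)) else (\<lambda>_. 1)) * (V j)\<^sup>\<dagger>"
          using Cd j one[OF j] by (cases "j \<in> S") (simp_all add: A_def)
        show "B C j = V j * mat_diag (n j) (if j \<in> S then (\<lambda>_. 1) else (\<lambda>i. complex_of_real (d j i))) * (V j)\<^sup>\<dagger>"
          using Cd j one[OF j] by (cases "j \<in> S") (simp_all add: B_def)
      qed
      also have "\<dots> = tensor_image C"
      proof (rule image_cong)
        fix j assume j: "j < m"
        have "C j \<in> carrier_mat (n j) (n j)" using C[OF j] by (simp add: hermitians_def)
        then show "A C j * B C j = C j"
          by (simp add: A_def B_def left_mult_one_mat[of _ "n j" "n j"] right_mult_one_mat[of _ "n j" "n j"])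
      qed
      finally show ?thesis by simp
    qed
  qed (use C spanning_hermitians in \<open>auto simp: hermitians_def\<close>)
  have "tensor_image (A C) * tensor_image (B C) = tensor_image C"
  proof (rule eq_matI)
    note car = image_carrier[OF fam(1)[OF C]] image_carrier[OF fam(2)[OF C]] image_carrier[OF C]
    show "(tensor_image (A C) * tensor_image (B C)) $$ (p, q) = tensor_image C $$ (p, q)"
      if "p < dim_row (tensor_image C)" "q < dim_col (tensor_image C)" for p q
      using entry[of p q] that car by (simp del: index_mult_mat(1))
    show "dim_row (tensor_image (A C) * tensor_image (B C)) = dim_row (tensor_image C)"
      "dim_col (tensor_image (A C) * tensor_image (B C)) = dim_col (tensor_image C)"
      using car by simp_all
  qed
  then show ?thesis by (simp add: A_def B_def)
qed

text \<open>On Hermitian families both sides agree, and the two conjugations make the right-hand side linear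
  in each slot.\<close>
lemma image_adjoint:
  assumes A: "A \<in> families m n"
  shows "tensor_image (\<lambda>j. (A j)\<^sup>\<dagger>) = (tensor_image A)\<^sup>\<dagger>"
proof -
  have fam: "(\<lambda>j. (A j)\<^sup>\<dagger>) \<in> families m n" if "A \<in> families m n" for A
    using that by (simp add: families_def)
  have entry: "cnj (tensor_image (\<lambda>j. (A j)\<^sup>\<dagger>) $$ (q, p)) - tensor_image A $$ (p, q) = 0" if pq: "p < N" "q < N" for p q
  proof (rule multilinear_eq_0[where m = m and n = n and B = "\<lambda>j. hermitians (n j)"
        and g = "\<lambda>A. cnj (tensor_image (\<lambda>j. (A j)\<^sup>\<dagger>) $$ (q, p)) - tensor_image A $$ (p, q)" and A = A])
    show "multilinear m n (\<lambda>A. cnj (tensor_image (\<lambda>j. (A j)\<^sup>\<dagger>) $$ (q, p)) - tensor_image A $$ (p, q))"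
    proof (rule multilinear_diff)
      show "multilinear m n (\<lambda>C. tensor_image C $$ (p, q))"
        by (rule multilinear_image[OF linear_functional_index[OF pq]])
      have g: "multilinear m n (\<lambda>C. tensor_image C $$ (q, p))"
        by (rule multilinear_image[OF linear_functional_index[OF pq(2,1)]])
      have upd: "(\<lambda>k. ((A(j := X)) k)\<^sup>\<dagger>) = (\<lambda>k. (A k)\<^sup>\<dagger>)(j := X\<^sup>\<dagger>)" for A j and X :: "complex mat"
        by auto
      show "multilinear m n (\<lambda>A. cnj (tensor_image (\<lambda>j. (A j)\<^sup>\<dagger>) $$ (q, p)))"
        unfolding multilinear_def
      proof (intro ballI allI impI linear_functionalI)
        fix A j and X Y :: "complex mat"
        assume A: "A \<in> families m n" and j: "j < m" and X: "X \<in> carrier_mat (n j) (n j)" and Y: "Y \<in> carrier_mat (n j) (n j)"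
        show "cnj (tensor_image (\<lambda>k. ((A(j := X + Y)) k)\<^sup>\<dagger>) $$ (q, p))
          = cnj (tensor_image (\<lambda>k. ((A(j := X)) k)\<^sup>\<dagger>) $$ (q, p)) + cnj (tensor_image (\<lambda>k. ((A(j := Y)) k)\<^sup>\<dagger>) $$ (q, p))"
          unfolding upd adjoint_add[OF X Y]
          using linear_functional_add[OF multilinearD[OF g fam[OF A] j] mat_adjoint_carrier[OF X] mat_adjoint_carrier[OF Y]]
          by simp
      next
        fix A j c and X :: "complex mat"
        assume A: "A \<in> families m n" and j: "j < m" and X: "X \<in> carrier_mat (n j) (n j)"
        show "cnj (tensor_image (\<lambda>k. ((A(j := c \<cdot>\<^sub>m X)) k)\<^sup>\<dagger>) $$ (q, p)) = c * cnj (tensor_image (\<lambda>k. ((A(j := X)) k)\<^sup>\<dagger>) $$ (q, p))"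
          unfolding upd adjoint_smult
          using linear_functional_smult[OF multilinearD[OF g fam[OF A] j] mat_adjoint_carrier[OF X], of "cnj c"]
          by simp
      qed
    qed
    show "cnj (tensor_image (\<lambda>j. (A j)\<^sup>\<dagger>) $$ (q, p)) - tensor_image A $$ (p, q) = 0"
      if C: "\<And>j. j < m \<Longrightarrow> A j \<in> hermitians (n j)" for A
    proof -
      have "A \<in> families m n" using C by (simp add: families_def hermitians_def)
      note car = image_carrier[OF this]
      have "tensor_image (\<lambda>j. (A j)\<^sup>\<dagger>) = tensor_image A"
        by (rule image_cong) (use C in \<open>simp add: hermitians_def\<close>)
      moreover have "(tensor_image A)\<^sup>\<dagger> $$ (p, q) = cnj (tensor_image A $$ (q, p))"
        using car pq by simp
      ultimately show ?thesis using image_hermitian[OF C] by simp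
    qed
  qed (use A spanning_hermitians in \<open>auto simp: hermitians_def\<close>)
  have entry': "tensor_image (\<lambda>j. (A j)\<^sup>\<dagger>) $$ (q, p) = cnj (tensor_image A $$ (p, q))" if "p < N" "q < N" for p q
    using entry[OF that] by (metis complex_cnj_cnj eq_iff_diff_eq_0)
  show ?thesis
    by (rule eq_matI) (use entry' image_carrier[OF A] image_carrier[OF fam[OF A]] in simp_all)
qed

end

section \<open>Jordan homomorphisms on matrix units\<close>

lemma spanningD:
  "spanning n B \<Longrightarrow> linear_functional n l \<Longrightarrow> (\<And>X. X \<in> B \<Longrightarrow> l X = 0) \<Longrightarrow> X \<in> carrier_mat n n \<Longrightarrow> l X = 0"
  by (simp add: spanning_def)

lemma linear_functional_sum2:
  "linear_functional n l \<Longrightarrow> linear_functional n k \<Longrightarrow> linear_functional n (\<lambda>X. l X + k X)"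
  by (simp add: linear_functional_def algebra_simps)

lemma linear_functional_comp_mult:
  assumes l: "linear_functional n l" and Y: "Y \<in> carrier_mat n n"
  shows "linear_functional n (\<lambda>X. l (X * Y))" "linear_functional n (\<lambda>X. l (Y * X))"
  by (rule linear_functionalI; use Y in \<open>simp add: add_mult_distrib_mat[of _ n n _ _ n]
      mult_add_distrib_mat[of _ n n _ n] mult_smult_assoc_mat[of _ n n _ n] mult_smult_distrib[of _ n n _ n]
      linear_functional_add[OF l] linear_functional_smult[OF l]\<close>)+

lemma double_cancel_mat:
  assumes "A \<in> carrier_mat N N" "B \<in> carrier_mat N N" "A + A = B + (B :: complex mat)"
  shows "A = B"
proof (rule eq_matI)
  fix i j assume "i < dim_row B" "j < dim_col B"
  then have ij: "i < N" "j < N" using assms(2) by simp_all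
  have "(A + A) $$ (i, j) = (B + B) $$ (i, j)" by (simp only: assms(3))
  then show "A $$ (i, j) = B $$ (i, j)" using ij assms(1,2) by simp
qed (use assms in simp_all)

lemma add_eq_zero_cancel_mat:
  assumes "A \<in> carrier_mat N N" "B \<in> carrier_mat N N" "C \<in> carrier_mat N N"
    "A + B = 0\<^sub>m N N" "B + C = (0\<^sub>m N N :: complex mat)"
  shows "A = C"
proof (rule eq_matI)
  fix i j assume "i < dim_row C" "j < dim_col C"
  then have ij: "i < N" "j < N" using assms(3) by simp_all
  have "(A + B) $$ (i, j) = (B + C) $$ (i, j)" by (simp only: assms(4,5))
  then show "A $$ (i, j) = C $$ (i, j)" using ij assms(1-3) by simp
qed (use assms in simp_all)

text \<open>Linearity is expressed by functionals, which covers sums, multiples and entries at once.\<close>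
locale jordan_map =
  fixes n N :: nat and \<Phi> :: "complex mat \<Rightarrow> complex mat"
  assumes car: "X \<in> carrier_mat n n \<Longrightarrow> \<Phi> X \<in> carrier_mat N N"
    and lin: "linear_functional N l \<Longrightarrow> linear_functional n (\<lambda>X. l (\<Phi> X))"
    and jordan: "X \<in> carrier_mat n n \<Longrightarrow> Y \<in> carrier_mat n n \<Longrightarrow> \<Phi> X * \<Phi> Y + \<Phi> Y * \<Phi> X = \<Phi> (X * Y + Y * X)"
begin

definition G :: "nat \<Rightarrow> nat \<Rightarrow> complex mat" where
  "G a b = \<Phi> (unit_mat n a b)"

lemma G_carrier [simp]: "G a b \<in> carrier_mat N N"
  by (simp add: G_def car)

lemma map_zero: "\<Phi> (0\<^sub>m n n) = 0\<^sub>m N N"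
proof (rule eq_matI)
  fix p q assume "p < dim_row (0\<^sub>m N N :: complex mat)" "q < dim_col (0\<^sub>m N N :: complex mat)"
  then have "p < N" "q < N" by simp_all
  then show "\<Phi> (0\<^sub>m n n) $$ (p, q) = 0\<^sub>m N N $$ (p, q)"
    using linear_functional_zero[OF lin[OF linear_functional_index]] by simp
qed (use car[of "0\<^sub>m n n"] in simp_all)

lemma map_add:
  assumes X: "X \<in> carrier_mat n n" and Y: "Y \<in> carrier_mat n n"
  shows "\<Phi> (X + Y) = \<Phi> X + \<Phi> Y"
proof (rule eq_matI)
  have XY: "X + Y \<in> carrier_mat n n" using Y by simp
  fix p q assume "p < dim_row (\<Phi> X + \<Phi> Y)" "q < dim_col (\<Phi> X + \<Phi> Y)"
  then have pq: "p < N" "q < N" using car[OF Y] by simp_all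
  show "\<Phi> (X + Y) $$ (p, q) = (\<Phi> X + \<Phi> Y) $$ (p, q)"
    using linear_functional_add[OF lin[OF linear_functional_index[OF pq]] X Y] car[OF Y] car[OF X] pq by simp
qed (use car[OF Y] car[of "X + Y"] Y in simp_all)

lemmas assoc = assoc_mult_mat[of _ N N _ N _ N]
lemmas distrib = mult_add_distrib_mat[of _ N N _ N] add_mult_distrib_mat[of _ N N _ _ N]
lemmas zero_simps = left_mult_zero_mat[of _ N N] right_mult_zero_mat[of _ N N]
  left_add_zero_mat[of _ N N] right_add_zero_mat[of _ N N]

lemma jordan_units:
  assumes "a < n" "b < n" "c < n" "d < n"
  shows "G a b * G c d + G c d * G a b
    = (if b = c then G a d else 0\<^sub>m N N) + (if d = a then G c b else 0\<^sub>m N N)"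
proof -
  have "G a b * G c d + G c d * G a b
      = \<Phi> (unit_mat n a b * unit_mat n c d + unit_mat n c d * unit_mat n a b)"
    unfolding G_def by (rule jordan) simp_all
  also have "\<dots> = (if b = c then G a d else 0\<^sub>m N N) + (if d = a then G c b else 0\<^sub>m N N)"
    using assms by (simp add: unit_mat_mult map_add G_def map_zero)
  finally show ?thesis .
qed

lemma diag_idem: "a < n \<Longrightarrow> G a a * G a a = G a a"
  using jordan_units[of a a a a] double_cancel_mat[of "G a a * G a a" N "G a a"] by simp

lemma diag_orth:
  assumes "a < n" "b < n" "a \<noteq> b"
  shows "G a a * G b b = 0\<^sub>m N N"
proof -
  let ?e = "G a a" and ?f = "G b b"
  have sum: "?e * ?f + ?f * ?e = 0\<^sub>m N N"
    using jordan_units[of a a b b] assms by simp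
  have 1: "?e * ?f + ?e * (?f * ?e) = 0\<^sub>m N N"
  proof -
    have "?e * (?e * ?f + ?f * ?e) = (?e * ?e) * ?f + ?e * (?f * ?e)"
      by (simp add: distrib assoc)
    then show ?thesis unfolding sum diag_idem[OF assms(1)] by (simp add: zero_simps)
  qed
  have 2: "?e * (?f * ?e) + ?f * ?e = 0\<^sub>m N N"
  proof -
    have "(?e * ?f + ?f * ?e) * ?e = ?e * (?f * ?e) + ?f * (?e * ?e)"
      by (simp add: distrib assoc)
    then show ?thesis unfolding sum diag_idem[OF assms(1)] by (simp add: zero_simps)
  qed
  have "?e * ?f = ?f * ?e"
    by (rule add_eq_zero_cancel_mat[OF _ _ _ 1 2]) simp_all
  then have "?e * ?f + ?e * ?f = 0\<^sub>m N N + 0\<^sub>m N N" using sum by (simp add: zero_simps)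
  then show ?thesis using double_cancel_mat[of "?e * ?f" N "0\<^sub>m N N"] by simp
qed

text \<open>For \<open>a \<noteq> b\<close> the element \<open>e x y e\<close>, with \<open>e = G a a\<close>, \<open>x = G a b\<close>, \<open>y = G b a\<close>, is the
  part of the projection \<open>e\<close> on which \<open>\<Phi>\<close> is multiplicative on the matrix units of \<open>a\<close> and \<open>b\<close>;
  \<open>e y x e\<close> is the complementary part, on which it is antimultiplicative.\<close>

definition corner :: "nat \<Rightarrow> nat \<Rightarrow> complex mat" where
  "corner a b = G a a * (G a b * (G b a * G a a))"

definition cocorner :: "nat \<Rightarrow> nat \<Rightarrow> complex mat" where
  "cocorner a b = G a a * (G b a * (G a b * G a a))"

lemma corner_carrier [simp]: "corner a b \<in> carrier_mat N N" "cocorner a b \<in> carrier_mat N N"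
  by (simp_all add: corner_def cocorner_def)

lemma off_diag_relations:
  assumes "a < n" "b < n" "a \<noteq> b"
  shows "G a a * G a b + G a b * G a a = G a b"
    and "G b b * G a b + G a b * G b b = G a b"
    and "G a b * G a b = 0\<^sub>m N N"
    and "G a b * G b a + G b a * G a b = G a a + G b b"
proof -
  show "G a a * G a b + G a b * G a a = G a b"
    using jordan_units[of a a a b] assms by (simp add: zero_simps)
  show "G b b * G a b + G a b * G b b = G a b"
    using jordan_units[of b b a b] assms by (simp add: zero_simps)
  have "G a b * G a b + G a b * G a b = 0\<^sub>m N N + 0\<^sub>m N N"
    using jordan_units[of a b a b] assms by simp
  then show "G a b * G a b = 0\<^sub>m N N"
    using double_cancel_mat[of "G a b * G a b" N "0\<^sub>m N N"] by simp
  show "G a b * G b a + G b a * G a b = G a a + G b b"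
    using jordan_units[of a b b a] assms by simp
qed

text \<open>The corners are complementary projections under \<open>e\<close> because \<open>y e y = 0\<close> makes their product vanish.\<close>
lemma corner_relations:
  assumes ab: "a < n" "b < n" "a \<noteq> b"
  shows "corner a b + cocorner a b = G a a"
    and "corner a b * corner a b = corner a b"
    and "G a a * corner a b = corner a b" "corner a b * G a a = corner a b"
    and "G a a * cocorner a b = cocorner a b" "cocorner a b * G a a = cocorner a b"
proof -
  let ?e = "G a a" and ?f = "G b b" and ?x = "G a b" and ?y = "G b a"
  note ee = diag_idem[OF ab(1)] and ef = diag_orth[OF ab]
  have ee': "?e * (?e * Z) = ?e * Z" if "Z \<in> carrier_mat N N" for Z
  proof -
    have "?e * (?e * Z) = (?e * ?e) * Z" using that by (simp add: assoc)
    then show ?thesis by (simp only: ee)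
  qed
  show e1: "?e * corner a b = corner a b" "?e * cocorner a b = cocorner a b"
    unfolding corner_def cocorner_def by (simp_all add: ee')
  show e2: "corner a b * ?e = corner a b" "cocorner a b * ?e = cocorner a b"
    unfolding corner_def cocorner_def by (simp_all add: assoc ee)
  have "?e * ((?x * ?y + ?y * ?x) * ?e) = ?e * ((?e + ?f) * ?e)"
    by (simp only: off_diag_relations(4)[OF ab])
  then have "corner a b + cocorner a b = ?e * (?e * ?e) + (?e * ?f) * ?e"
    unfolding corner_def cocorner_def by (simp add: distrib assoc)
  then show sum: "corner a b + cocorner a b = ?e"
    unfolding ee ef by (simp add: zero_simps ee)
  have yey: "?y * (?e * ?y) = 0\<^sub>m N N"
  proof -
    have "?e * ?y + ?y * ?e = ?y" using off_diag_relations(2)[OF ab(2,1)] ab(3) by simp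
    then have "?y * (?e * ?y + ?y * ?e) = ?y * ?y" by simp
    then have "?y * (?e * ?y) + (?y * ?y) * ?e = ?y * ?y" by (simp add: distrib assoc)
    then show ?thesis
      using off_diag_relations(3)[OF ab(2,1)] ab(3) by (simp add: zero_simps)
  qed
  have "corner a b * cocorner a b = ?e * (?x * ((?y * (?e * ?y)) * (?x * ?e)))"
    unfolding corner_def cocorner_def by (simp add: assoc ee')
  also have "\<dots> = 0\<^sub>m N N" unfolding yey by (simp add: zero_simps)
  finally have ortho: "corner a b * cocorner a b = 0\<^sub>m N N" .
  have "corner a b * (corner a b + cocorner a b) = corner a b * corner a b + corner a b * cocorner a b"
    by (simp add: distrib)
  then show "corner a b * corner a b = corner a b"
    unfolding sum ortho e2 by (simp add: zero_simps)
qed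

text \<open>The hypothesis forces \<open>G a b = G a a * G a b * G b b\<close>, so products of units with different inner indices
  vanish, and the Jordan identity leaves only one term of the symmetrised product.\<close>
lemma multiplicative:
  assumes type: "\<And>a b. a < n \<Longrightarrow> b < n \<Longrightarrow> a \<noteq> b \<Longrightarrow> G a b * G a a = 0\<^sub>m N N"
    and X: "X \<in> carrier_mat n n" and Y: "Y \<in> carrier_mat n n"
  shows "\<Phi> (X * Y) = \<Phi> X * \<Phi> Y"
proof -
  have left: "G a a * G a b = G a b" if "a < n" "b < n" for a b
  proof (cases "a = b")
    case False
    then show ?thesis
      using off_diag_relations(1)[OF that False] type[OF that False] by (simp add: zero_simps)
  qed (use that diag_idem in simp)
  have right: "G a b * G b b = G a b" if "a < n" "b < n" for a b
  proof (cases "a = b")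
    case False
    have "G b b * G a b = G b b * (G a a * G a b)" by (simp only: left[OF that])
    also have "\<dots> = (G b b * G a a) * G a b" by (simp add: assoc)
    also have "\<dots> = 0\<^sub>m N N" using diag_orth[OF that(2,1)] False by (simp add: zero_simps)
    finally show ?thesis
      using off_diag_relations(2)[OF that False] by (simp add: zero_simps)
  qed (use that diag_idem in simp)
  have disjoint: "G a b * G c d = 0\<^sub>m N N" if "a < n" "b < n" "c < n" "d < n" "b \<noteq> c" for a b c d
  proof -
    have "G a b * G c d = (G a b * G b b) * (G c c * G c d)" by (simp only: left right that)
    also have "\<dots> = G a b * ((G b b * G c c) * G c d)" by (simp add: assoc)
    also have "\<dots> = 0\<^sub>m N N" using diag_orth[OF that(2,3,5)] by (simp add: zero_simps)
    finally show ?thesis .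
  qed
  have units: "G a b * G c d = (if b = c then G a d else 0\<^sub>m N N)"
    if "a < n" "b < n" "c < n" "d < n" for a b c d
  proof (cases "b = c")
    case False
    then show ?thesis using disjoint that by simp
  next
    case bc: True
    show ?thesis
    proof (cases "d = a")
      case False
      then show ?thesis
        using jordan_units[of a b b d] disjoint[of b d a b] that bc by (simp add: zero_simps)
    next
      case da: True
      show ?thesis
      proof (cases "a = b")
        case True
        then show ?thesis using bc da diag_idem that by simp
      next
        case False
        have "G a a * (G a b * G b a + G b a * G a b) = G a a * (G a a + G b b)"
          by (simp only: off_diag_relations(4)[OF that(1,2) False])
        then have "(G a a * G a b) * G b a + (G a a * G b a) * G a b = G a a * G a a + G a a * G b b"
          by (simp add: distrib assoc)
        then have "G a b * G b a = G a a"
          using that False bc da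
          by (simp add: left disjoint diag_orth diag_idem zero_simps)
        then show ?thesis using bc da by simp
      qed
    qed
  qed
  have entry: "(\<Phi> X * \<Phi> Y) $$ (p, q) - \<Phi> (X * Y) $$ (p, q) = 0" if pq: "p < N" "q < N" for p q
  proof (rule spanningD[OF spanning_unit_mats _ _ X,
        where l = "\<lambda>X. (\<Phi> X * \<Phi> Y) $$ (p, q) - \<Phi> (X * Y) $$ (p, q)"])
    note l = linear_functional_index[OF pq]
    show "linear_functional n (\<lambda>X. (\<Phi> X * \<Phi> Y) $$ (p, q) - \<Phi> (X * Y) $$ (p, q))"
      by (intro linear_functional_diff linear_functional_comp_mult(1)[OF lin[OF l] Y]
          lin[OF linear_functional_comp_mult(1)[OF l car[OF Y]]])
    fix E assume "E \<in> {unit_mat n a b | a b. a < n \<and> b < n}"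
    then obtain a b where E: "E = unit_mat n a b" and ab: "a < n" "b < n" by auto
    have Ec: "E \<in> carrier_mat n n" by (simp add: E)
    show "(\<Phi> E * \<Phi> Y) $$ (p, q) - \<Phi> (E * Y) $$ (p, q) = 0"
    proof (rule spanningD[OF spanning_unit_mats _ _ Y,
          where l = "\<lambda>Y. (\<Phi> E * \<Phi> Y) $$ (p, q) - \<Phi> (E * Y) $$ (p, q)"])
      show "linear_functional n (\<lambda>Y. (\<Phi> E * \<Phi> Y) $$ (p, q) - \<Phi> (E * Y) $$ (p, q))"
        by (intro linear_functional_diff linear_functional_comp_mult(2)[OF lin[OF l] Ec]
            lin[OF linear_functional_comp_mult(2)[OF l car[OF Ec]]])
      fix F assume "F \<in> {unit_mat n a b | a b. a < n \<and> b < n}"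
      then obtain c d where F: "F = unit_mat n c d" and cd: "c < n" "d < n" by auto
      have "\<Phi> E * \<Phi> F = (if b = c then G a d else 0\<^sub>m N N)"
        using units[OF ab cd] by (simp add: E F G_def)
      also have "\<dots> = \<Phi> (E * F)"
        using unit_mat_mult[OF ab(2) cd(1), of a d] by (simp add: E F G_def map_zero)
      finally show "(\<Phi> E * \<Phi> F) $$ (p, q) - \<Phi> (E * F) $$ (p, q) = 0" by simp
    qed
  qed
  show ?thesis
  proof (rule eq_matI)
    fix p q assume "p < dim_row (\<Phi> X * \<Phi> Y)" "q < dim_col (\<Phi> X * \<Phi> Y)"
    then have "p < N" "q < N" using car[OF X] car[OF Y] by simp_all
    from entry[OF this] show "\<Phi> (X * Y) $$ (p, q) = (\<Phi> X * \<Phi> Y) $$ (p, q)" by simp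
  qed (use car[OF X] car[OF Y] car[of "X * Y"] X Y in simp_all)
qed

end

section \<open>Each slot is mapped by a homomorphism or an antihomomorphism\<close>

context frame_map
begin

text \<open>The restriction to one tensor factor, the others being the identity matrix.\<close>
definition slot :: "nat \<Rightarrow> complex mat \<Rightarrow> complex mat" where
  "slot j X = tensor_image (one_family(j := X))"

lemma slot_carrier: "X \<in> carrier_mat (n j) (n j) \<Longrightarrow> slot j X \<in> carrier_mat N N"
  unfolding slot_def by (intro image_carrier families_update one_family)

lemma slot_functional: "j < m \<Longrightarrow> linear_functional N l \<Longrightarrow> linear_functional (n j) (\<lambda>X. l (slot j X))"
  unfolding slot_def using multilinearD[OF multilinear_image one_family] .

lemma slot_adjoint:
  assumes "X \<in> carrier_mat (n j) (n j)"
  shows "(slot j X)\<^sup>\<dagger> = slot j (X\<^sup>\<dagger>)"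
proof -
  have "(\<lambda>k. ((one_family(j := X)) k)\<^sup>\<dagger>) = one_family(j := X\<^sup>\<dagger>)" by auto
  then show ?thesis
    using image_adjoint[OF families_update[OF one_family assms]] by (simp only: slot_def)
qed

lemma slot_mult_image:
  assumes A: "A \<in> families m n" "A j = 1\<^sub>m (n j)" and X: "X \<in> carrier_mat (n j) (n j)"
  shows "slot j X * tensor_image A = tensor_image (A(j := X))"
    "tensor_image A * slot j X = tensor_image (A(j := X))"
proof -
  have C: "A(j := X) \<in> families m n" by (rule families_update[OF A(1) X])
  have 1: "(\<lambda>k. if k \<in> {j} then (A(j := X)) k else 1\<^sub>m (n k)) = one_family(j := X)"
    "(\<lambda>k. if k \<in> {j} then 1\<^sub>m (n k) else (A(j := X)) k) = A"
    "(\<lambda>k. if k \<in> - {j} then (A(j := X)) k else 1\<^sub>m (n k)) = A"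
    "(\<lambda>k. if k \<in> - {j} then 1\<^sub>m (n k) else (A(j := X)) k) = one_family(j := X)"
    using A(2) by (auto simp: fun_eq_iff)
  show "slot j X * tensor_image A = tensor_image (A(j := X))"
    using image_split[OF C, of "{j}"] unfolding 1 slot_def .
  show "tensor_image A * slot j X = tensor_image (A(j := X))"
    using image_split[OF C, of "- {j}"] unfolding 1 slot_def .
qed

lemma slot_square:
  assumes j: "j < m" and X: "X \<in> hermitians (n j)"
  shows "slot j X * slot j X = slot j (X * X)"
proof -
  obtain V d where V: "V \<in> unitaries (n j)" and Xd: "X = V * mat_diag (n j) (\<lambda>i. complex_of_real (d i)) * V\<^sup>\<dagger>"
    using hermitian_diagonalisation[OF X] by blast
  have "tensor_image (one_family(j := X)) * tensor_image (one_family(j := X))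
      = tensor_image (\<lambda>k. (one_family(j := X)) k * (one_family(j := X)) k)"
  proof (rule image_commuting_mult[where V = "one_family(j := V)"])
    fix k
    show "(one_family(j := V)) k \<in> unitaries (n k)" using V by simp
    show "(one_family(j := X)) k = (one_family(j := V)) k
        * mat_diag (n k) ((\<lambda>k i. if k = j then complex_of_real (d i) else 1) k) * ((one_family(j := V)) k)\<^sup>\<dagger>"
      using Xd by (simp add: left_mult_one_mat[of _ "n k" "n k"])
    then show "(one_family(j := X)) k = (one_family(j := V)) k
        * mat_diag (n k) ((\<lambda>k i. if k = j then complex_of_real (d i) else 1) k) * ((one_family(j := V)) k)\<^sup>\<dagger>" .
  qed
  also have "(\<lambda>k. (one_family(j := X)) k * (one_family(j := X)) k) = one_family(j := X * X)"
    by (auto simp: left_mult_one_mat[of _ "n _" "n _"])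
  finally show ?thesis by (simp only: slot_def)
qed

text \<open>The square of a Hermitian matrix is diagonal in the same basis; polarisation and bilinearity
  extend the preservation of squares to the Jordan identity.\<close>
lemma slot_jordan_map:
  assumes j: "j < m" shows "jordan_map (n j) N (slot j)"
proof (rule jordan_map.intro)
  let ?C = "carrier_mat (n j) (n j)"
  show "slot j X \<in> carrier_mat N N" if "X \<in> ?C" for X using that by (rule slot_carrier)
  show lin: "linear_functional (n j) (\<lambda>X. l (slot j X))" if "linear_functional N l" for l
    by (rule slot_functional[OF j that])
  fix X Y :: "complex mat" assume XY: "X \<in> ?C" "Y \<in> ?C"
  define b where "b p q X Y = ((slot j X * slot j Y) $$ (p, q) + (slot j Y * slot j X) $$ (p, q))
    - (slot j (X * Y) $$ (p, q) + slot j (Y * X) $$ (p, q))" for p q X Y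
  have b1: "linear_functional (n j) (\<lambda>X. b p q X Y)" and b2: "linear_functional (n j) (\<lambda>X. b p q Y X)"
    if pq: "p < N" "q < N" and Y: "Y \<in> ?C" for p q Y
  proof -
    note l = linear_functional_index[OF pq]
    note sY = slot_carrier[OF Y]
    show "linear_functional (n j) (\<lambda>X. b p q X Y)" "linear_functional (n j) (\<lambda>X. b p q Y X)"
      unfolding b_def
      by (intro linear_functional_diff linear_functional_sum2
          linear_functional_comp_mult[OF lin[OF l] Y] lin[OF linear_functional_comp_mult(1)[OF l sY]]
          lin[OF linear_functional_comp_mult(2)[OF l sY]])+
  qed
  have sym: "b p q X Y = b p q Y X" for p q X Y by (simp add: b_def add.commute)
  have diag: "b p q Z Z = 0" if "Z \<in> hermitians (n j)" for p q Z
    unfolding b_def slot_square[OF j that] by simp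
  have herm: "b p q X Y = 0" if pq: "p < N" "q < N" and XY: "X \<in> hermitians (n j)" "Y \<in> hermitians (n j)" for p q X Y
  proof -
    have c: "X \<in> ?C" "Y \<in> ?C" "X + Y \<in> ?C" using XY by (simp_all add: hermitians_def)
    have "X + Y \<in> hermitians (n j)" using XY by (simp add: hermitians_def adjoint_add[of _ "n j" "n j"])
    then have "0 = b p q (X + Y) (X + Y)" using diag by simp
    also have "\<dots> = (b p q X X + b p q X Y) + (b p q Y X + b p q Y Y)"
      using linear_functional_add[OF b1[OF pq c(3)] c(1,2)] linear_functional_add[OF b2[OF pq c(1)] c(1,2)]
        linear_functional_add[OF b2[OF pq c(2)] c(1,2)] by simp
    finally show ?thesis using diag[OF XY(1)] diag[OF XY(2)] sym[of p q X Y] by simp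
  qed
  have b0: "b p q X Y = 0" if pq: "p < N" "q < N" for p q
  proof (rule spanningD[OF spanning_hermitians b1[OF pq XY(2)] _ XY(1)])
    fix X assume X: "X \<in> hermitians (n j)"
    then have Xc: "X \<in> ?C" by (simp add: hermitians_def)
    show "b p q X Y = 0"
      by (rule spanningD[OF spanning_hermitians b2[OF pq Xc] herm[OF pq X] XY(2)])
  qed
  note c = slot_carrier[OF XY(1)] slot_carrier[OF XY(2)]
  have pc: "X * Y \<in> ?C" "Y * X \<in> ?C" using XY by simp_all
  have "slot j (X * Y + Y * X) $$ (p, q) = slot j (X * Y) $$ (p, q) + slot j (Y * X) $$ (p, q)"
    if "p < N" "q < N" for p q
    using linear_functional_add[OF lin[OF linear_functional_index[OF that]] pc] .
  moreover have "X * Y + Y * X \<in> ?C" using pc by simp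
  note sc = slot_carrier[OF this]
  ultimately show "slot j X * slot j Y + slot j Y * slot j X = slot j (X * Y + Y * X)"
    by (intro eq_matI) (use b0 c sc in \<open>simp_all add: b_def del: index_mult_mat(1)\<close>)
qed

lemma slot_commute_image:
  assumes A: "A \<in> families m n" "A j = 1\<^sub>m (n j)" and X: "X \<in> carrier_mat (n j) (n j)"
  shows "slot j X * tensor_image A = tensor_image A * slot j X"
  by (simp only: slot_mult_image[OF assms])

lemma image_rank_one:
  assumes P: "\<And>j. j < m \<Longrightarrow> P j \<in> rank_one_projections (n j)"
  shows "trace_mat (tensor_image P) = 1" "tensor_image P * tensor_image P = tensor_image P"
    and "A \<in> carrier_mat N N \<Longrightarrow> tensor_image P * A * tensor_image P
      = trace_mat (A * tensor_image P) \<cdot>\<^sub>m tensor_image P"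
proof -
  obtain V I where VI: "\<forall>j<m. V j \<in> unitaries (n j)" "I < N"
    "kronecker_family m P = kronecker_family m V * unit_mat N I I * (kronecker_family m V)\<^sup>\<dagger>"
    by (rule rank_one_family[OF pos N P])
  obtain U where U: "U \<in> unitaries N" and p: "tensor_image P = U * unit_mat N I I * U\<^sup>\<dagger>"
    using frame[of V] VI unfolding tensor_image_def by auto
  note Uc = unitariesD[OF U]
  show "trace_mat (tensor_image P) = 1"
    unfolding p by (simp add: trace_unitary_conj[OF U] trace_unit_mat VI(2))
  show "tensor_image P * tensor_image P = tensor_image P"
    unfolding p by (simp add: unitary_conj_mult[OF U] unit_mat_mult VI(2))
  assume A: "A \<in> carrier_mat N N"
  define B where "B = U\<^sup>\<dagger> * A * U"
  have B: "B \<in> carrier_mat N N" using Uc A by (simp add: B_def)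
  have AB: "A = U * B * U\<^sup>\<dagger>" using unitary_conj_cancel(2)[OF U A] by (simp add: B_def)
  have EBE: "unit_mat N I I * B * unit_mat N I I = B $$ (I, I) \<cdot>\<^sub>m unit_mat N I I"
  proof (rule eq_matI)
    fix p q assume "p < dim_row (B $$ (I, I) \<cdot>\<^sub>m unit_mat N I I)" "q < dim_col (B $$ (I, I) \<cdot>\<^sub>m unit_mat N I I)"
    then have pq: "p < N" "q < N" by simp_all
    have "(unit_mat N I I * B * unit_mat N I I) $$ (p, q) = (\<Sum>t<N. (unit_mat N I I * B) $$ (p, t) * unit_mat N I I $$ (t, q))"
      by (rule index_mult_sum[of _ N N _ N]) (use B pq in simp_all)
    also have "\<dots> = (\<Sum>t<N. ((unit_mat N I I * B) $$ (p, t) * (if q = I then 1 else 0)) * (if t = I then 1 else 0))"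
      using pq by (intro sum.cong refl) (simp del: index_mult_mat(1))
    also have "\<dots> = (unit_mat N I I * B) $$ (p, I) * (if q = I then 1 else 0)"
      using VI(2) by (rule sum_mult_delta(1))
    also have "(unit_mat N I I * B) $$ (p, I) = (\<Sum>t<N. unit_mat N I I $$ (p, t) * B $$ (t, I))"
      by (rule index_mult_sum[of _ N N _ N]) (use B pq VI(2) in simp_all)
    also have "\<dots> = (\<Sum>t<N. ((if p = I then 1 else 0) * B $$ (t, I)) * (if t = I then 1 else 0))"
      using pq by (intro sum.cong refl) simp
    also have "\<dots> = (if p = I then 1 else 0) * B $$ (I, I)"
      using VI(2) by (rule sum_mult_delta(1))
    finally show "(unit_mat N I I * B * unit_mat N I I) $$ (p, q) = (B $$ (I, I) \<cdot>\<^sub>m unit_mat N I I) $$ (p, q)"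
      using pq by simp
  qed (use B in simp_all)
  have EE: "unit_mat N I I * unit_mat N I I = unit_mat N I I" by (simp add: unit_mat_mult VI(2))
  have tr: "trace_mat (A * tensor_image P) = B $$ (I, I)"
  proof -
    have "trace_mat (A * tensor_image P) = trace_mat (B * unit_mat N I I)"
      unfolding p AB by (simp add: unitary_conj_mult[OF U B] trace_unitary_conj[OF U] B)
    also have "B * unit_mat N I I = B * (unit_mat N I I * unit_mat N I I)" by (simp only: EE)
    also have "trace_mat \<dots> = trace_mat ((unit_mat N I I * unit_mat N I I) * B)"
      by (rule trace_mat_mult_commute[of _ N N]) (use B in simp_all)
    also have "\<dots> = trace_mat (unit_mat N I I * (unit_mat N I I * B))"
      using B by (simp add: assoc_mult_mat[of _ N N _ N _ N])
    also have "\<dots> = trace_mat (unit_mat N I I * B * unit_mat N I I)"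
      by (rule trace_mat_mult_commute[of _ N N]) (use B in simp_all)
    also have "\<dots> = B $$ (I, I)"
      unfolding EBE by (simp add: trace_mat_smult[of _ N] trace_unit_mat VI(2))
    finally show ?thesis .
  qed
  show "tensor_image P * A * tensor_image P = trace_mat (A * tensor_image P) \<cdot>\<^sub>m tensor_image P"
  proof -
    have "tensor_image P * A * tensor_image P = U * (unit_mat N I I * B * unit_mat N I I) * U\<^sup>\<dagger>"
      unfolding p AB by (simp add: unitary_conj_mult[OF U] B)
    also have "\<dots> = B $$ (I, I) \<cdot>\<^sub>m (U * unit_mat N I I * U\<^sup>\<dagger>)"
      unfolding EBE using Uc by (simp add: mult_smult_distrib[of _ N N _ N] mult_smult_assoc_mat[of _ N N _ N])
    finally have 1: "tensor_image P * A * tensor_image P = B $$ (I, I) \<cdot>\<^sub>m (U * unit_mat N I I * U\<^sup>\<dagger>)" .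
    show ?thesis unfolding tr using 1 unfolding p .
  qed
qed

text \<open>Pinning slot \<open>j\<close> puts the image of a family of projections below \<open>slot j (E a a)\<close>, where the corners
  live.\<close>
definition pinned :: "nat \<Rightarrow> nat \<Rightarrow> nat \<Rightarrow> complex mat set" where
  "pinned j a k = (if k = j then {unit_mat (n j) a a} else rank_one_projections (n k))"

lemma pinned_rank_one: "a < n j \<Longrightarrow> X \<in> pinned j a k \<Longrightarrow> X \<in> rank_one_projections (n k)"
  by (auto simp: pinned_def unit_mat_rank_one split: if_splits)

text \<open>The projection \<open>slot j (E a a)\<close> is a sum of images of pinned families, namely of the product basis
  projections with \<open>a\<close> in slot \<open>j\<close>.\<close>
lemma trace_eq_0_if_pinned:
  assumes j: "j < m" and a: "a < n j" and Z: "Z \<in> carrier_mat N N"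
    and Ze: "Z * slot j (unit_mat (n j) a a) = Z"
    and 0: "\<And>P. (\<And>k. k < m \<Longrightarrow> P k \<in> pinned j a k) \<Longrightarrow> trace_mat (Z * tensor_image P) = 0"
  shows "trace_mat Z = 0"
proof -
  define d where "d k i = (if k = j \<and> i \<noteq> a then 0 else 1 :: complex)" for k i
  define D where "D p = (\<Prod>k<m. d k (digit m n p k))" for p
  have "kronecker_family m (one_family(j := unit_mat (n j) a a)) = kronecker_family m (\<lambda>k. mat_diag (n k) (d k))"
  proof (rule kronecker_family_cong)
    fix k
    have "unit_mat (n j) a a = mat_diag (n j) (d j)"
      by (rule eq_matI) (auto simp: mat_diag_def d_def)
    moreover have "k \<noteq> j \<Longrightarrow> d k = (\<lambda>_. 1)" by (simp add: d_def fun_eq_iff)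
    ultimately show "(one_family(j := unit_mat (n j) a a)) k = mat_diag (n k) (d k)" by simp
  qed
  also have "\<dots> = mat_diag N D" unfolding N D_def by (rule kronecker_family_diag[OF pos])
  finally have e: "slot j (unit_mat (n j) a a) = \<psi> (mat_diag N D)"
    by (simp only: slot_def tensor_image_def)
  have l: "linear_functional N (\<lambda>X. trace_mat (Z * \<psi> X))"
    by (rule linear_map_mat_comp_functional[OF linear linear_functional_comp_mult(2)[OF linear_functional_trace Z]])
  have terms: "D p * trace_mat (Z * \<psi> (unit_mat N p p)) = 0" if p: "p < N" for p
  proof (cases "digit m n p j = a")
    case False
    then have "d j (digit m n p j) = 0" by (simp add: d_def)
    then have "D p = 0" using j unfolding D_def by (intro prod_zero) auto
    then show ?thesis by simp
  next
    case True
    let ?E = "\<lambda>k. unit_mat (n k) (digit m n p k) (digit m n p k)"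
    have "kronecker_family m ?E = unit_mat N p p"
      using kronecker_family_unit_mat[of m n p p] pos p unfolding N by blast
    moreover have "trace_mat (Z * tensor_image ?E) = 0"
    proof (rule 0)
      fix k assume "k < m"
      then have "digit m n p k < n k" using digit_less[of m n k p] pos by blast
      then show "?E k \<in> pinned j a k" using True by (simp add: pinned_def unit_mat_rank_one)
    qed
    ultimately show ?thesis by (simp add: tensor_image_def)
  qed
  have "trace_mat (Z * \<psi> (mat_diag N D)) = (\<Sum>p<N. D p * trace_mat (Z * \<psi> (unit_mat N p p)))"
    by (rule linear_functional_diag[OF l])
  also have "\<dots> = 0" by (intro sum.neutral ballI terms) simp
  finally have "trace_mat (Z * \<psi> (mat_diag N D)) = 0" .
  then show ?thesis using Ze by (simp add: e)
qed

text \<open>The image \<open>p\<close> of a pinned family is a rank-one projection that commutes with the projection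
  \<open>corner a b\<close>, so the trace of their product is 0 or 1. As a multilinear function of the factors it
  cannot jump from one value to the other. So one of the two complementary corners has trace 0, and
  this trace is the square of the Hilbert--Schmidt norm of \<open>e x\<close> or of \<open>e y\<close>.\<close>
lemma slot_dichotomy:
  assumes j: "j < m" and ab: "a < n j" "b < n j" "a \<noteq> b"
  shows "slot j (unit_mat (n j) a a) * slot j (unit_mat (n j) a b) = 0\<^sub>m N N \<or>
    slot j (unit_mat (n j) a b) * slot j (unit_mat (n j) a a) = 0\<^sub>m N N"
proof -
  interpret J: jordan_map "n j" N "slot j" by (rule slot_jordan_map[OF j])
  let ?e = "J.G a a" and ?x = "J.G a b" and ?y = "J.G b a"
  let ?\<alpha> = "J.corner a b" and ?\<beta> = "J.cocorner a b"
  have adj: "(J.G c d)\<^sup>\<dagger> = J.G d c" for c d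
    unfolding J.G_def by (simp add: slot_adjoint)
  note rel = J.corner_relations[OF ab]
  note assoc = assoc_mult_mat[of _ N N _ N _ N]
  have fam: "P \<in> families m n" if "\<And>k. k < m \<Longrightarrow> P k \<in> pinned j a k" for P
    using that pinned_rank_one[OF ab(1)] rank_one_projections_carrier by (simp add: families_def)
  have p1: "trace_mat (tensor_image P) = 1" "tensor_image P * tensor_image P = tensor_image P"
    "\<And>A. A \<in> carrier_mat N N \<Longrightarrow> tensor_image P * A * tensor_image P
      = trace_mat (A * tensor_image P) \<cdot>\<^sub>m tensor_image P"
    if "\<And>k. k < m \<Longrightarrow> P k \<in> pinned j a k" for P
    using image_rank_one[of P] pinned_rank_one[OF ab(1)] that by blast+
  have split: "\<exists>Q\<in>carrier_mat N N. ?e * Q = tensor_image P \<and> Q * ?e = tensor_image P \<and> ?x * Q = Q * ?x \<and> ?y * Q = Q * ?y"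
    if P: "\<And>k. k < m \<Longrightarrow> P k \<in> pinned j a k" for P
  proof -
    let ?A = "P(j := 1\<^sub>m (n j))"
    have A: "?A \<in> families m n" "?A j = 1\<^sub>m (n j)"
      using families_update[OF fam[OF P], of "1\<^sub>m (n j)" j] by simp_all
    have "P j = unit_mat (n j) a a" using P[OF j] by (simp add: pinned_def)
    then have up: "?A(j := unit_mat (n j) a a) = P" by auto
    have "?e * tensor_image ?A = tensor_image P" "tensor_image ?A * ?e = tensor_image P"
      using slot_mult_image[OF A unit_mat_carrier[of "n j" a a], unfolded up] unfolding J.G_def .
    moreover have "?x * tensor_image ?A = tensor_image ?A * ?x" "?y * tensor_image ?A = tensor_image ?A * ?y"
      unfolding J.G_def by (intro slot_commute_image[OF A] unit_mat_carrier)+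
    ultimately show ?thesis using image_carrier[OF A(1)] by blast
  qed
  have idem: "trace_mat (?\<alpha> * tensor_image P) = 0 \<or> trace_mat (?\<alpha> * tensor_image P) = 1"
    and compl: "trace_mat (?\<alpha> * tensor_image P) + trace_mat (?\<beta> * tensor_image P) = 1"
    if P: "\<And>k. k < m \<Longrightarrow> P k \<in> pinned j a k" for P
  proof -
    let ?p = "tensor_image P"
    have p: "?p \<in> carrier_mat N N" by (rule image_carrier[OF fam[OF P]])
    obtain Q where Q: "Q \<in> carrier_mat N N" and eQ: "?e * Q = ?p" "Q * ?e = ?p"
      and comm: "?x * Q = Q * ?x" "?y * Q = Q * ?y"
      using split[OF P] by blast
    have mult_comm: "A * B * Q = Q * (A * B)" if "A \<in> carrier_mat N N" "B \<in> carrier_mat N N"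
      "A * Q = Q * A" "B * Q = Q * B" for A B
    proof -
      have "A * B * Q = A * (B * Q)" using that(1,2) Q by (simp add: assoc)
      also have "\<dots> = A * (Q * B)" by (simp only: that(4))
      also have "\<dots> = A * Q * B" using that(1,2) Q by (simp add: assoc)
      also have "\<dots> = Q * A * B" by (simp only: that(3))
      also have "\<dots> = Q * (A * B)" using that(1,2) Q by (simp add: assoc)
      finally show ?thesis .
    qed
    have eQc: "?e * Q = Q * ?e" by (simp only: eQ)
    have \<alpha>Q: "?\<alpha> * Q = Q * ?\<alpha>"
      unfolding J.corner_def by (intro mult_comm comm eQc) simp_all
    have "?\<alpha> * ?p = ?\<alpha> * ?e * Q" unfolding eQ(1)[symmetric] using Q by (simp add: assoc)
    then have 1: "?\<alpha> * ?p = ?\<alpha> * Q" by (simp only: rel)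
    have "?p * ?\<alpha> = Q * (?e * ?\<alpha>)" unfolding eQ(2)[symmetric] using Q by (simp add: assoc)
    then have 2: "?p * ?\<alpha> = Q * ?\<alpha>" by (simp only: rel)
    define t where "t = trace_mat (?\<alpha> * ?p)"
    have "?\<alpha> * ?p = ?\<alpha> * (?p * ?p)" by (simp only: p1(2)[OF P])
    also have "\<dots> = ?\<alpha> * ?p * ?p" using p by (simp add: assoc)
    also have "\<dots> = ?p * ?\<alpha> * ?p" by (simp only: 1 2 \<alpha>Q)
    also have "\<dots> = t \<cdot>\<^sub>m ?p" unfolding t_def by (rule p1(3)[OF P]) simp_all
    finally have \<alpha>p: "?\<alpha> * ?p = t \<cdot>\<^sub>m ?p" .
    have "?\<alpha> * ?p = ?\<alpha> * ?\<alpha> * ?p" by (simp only: rel)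
    also have "\<dots> = ?\<alpha> * (?\<alpha> * ?p)" using p by (simp add: assoc)
    also have "\<dots> = t \<cdot>\<^sub>m (t \<cdot>\<^sub>m ?p)" unfolding \<alpha>p
      using p by (simp add: mult_smult_distrib[of _ N N _ N] \<alpha>p)
    finally have "trace_mat (t \<cdot>\<^sub>m ?p) = trace_mat (t \<cdot>\<^sub>m (t \<cdot>\<^sub>m ?p))" by (simp only: \<alpha>p)
    then have "t = t * t" using p p1(1)[OF P] by (simp add: trace_mat_smult[of _ N])
    then show "trace_mat (?\<alpha> * ?p) = 0 \<or> trace_mat (?\<alpha> * ?p) = 1" unfolding t_def[symmetric] by simp
    have "(?\<alpha> + ?\<beta>) * ?p = ?p"
    proof -
      have "?e * ?p = ?e * ?e * Q" unfolding eQ(1)[symmetric] using Q by (simp add: assoc)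
      then show ?thesis using rel(1) J.diag_idem[OF ab(1)] eQ(1) by simp
    qed
    then have "trace_mat (?\<alpha> * ?p + ?\<beta> * ?p) = 1"
      using p p1(1)[OF P] by (simp add: add_mult_distrib_mat[of _ N N _ _ N])
    then show "trace_mat (?\<alpha> * ?p) + trace_mat (?\<beta> * ?p) = 1"
      using p by (simp add: trace_mat_add[of _ N])
  qed
  \<comment> \<open>The trace takes only the values 0 and 1, so its affine image in \<open>{1, -1}\<close> is unimodular.\<close>
  define g where "g A = 2 * trace_mat (?\<alpha> * tensor_image A) - trace_mat (tensor_image A)" for A
  have "linear_functional N (\<lambda>X. 2 * trace_mat (?\<alpha> * X) - trace_mat X)"
  proof (rule linear_functional_diff[OF _ linear_functional_trace])
    note l = linear_functional_comp_mult(2)[OF linear_functional_trace J.corner_carrier(1)]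
    show "linear_functional N (\<lambda>X. 2 * trace_mat (?\<alpha> * X))"
      using l[of a b] by (simp add: linear_functional_def)
  qed
  from multilinear_image[OF this] have g: "multilinear m n g" unfolding g_def .
  have const: "g P = g P'"
    if P: "\<And>k. k < m \<Longrightarrow> P k \<in> pinned j a k" and P': "\<And>k. k < m \<Longrightarrow> P' k \<in> pinned j a k" for P P'
  proof (rule multilinear_unimodular_constant[OF g _ _ _ P P'])
    show "pinned j a k = rank_one_projections (n k) \<or> (\<exists>B\<in>carrier_mat (n k) (n k). pinned j a k = {B})" for k
      by (cases "k = j") (simp_all add: pinned_def)
    show "cmod (g P) = 1" if "\<And>k. k < m \<Longrightarrow> P k \<in> pinned j a k" for P
      using idem[OF that] p1(1)[OF that] unfolding g_def by auto
    show "g P = g Q" if "\<And>k. k < m \<Longrightarrow> P k = Q k" for P Q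
      unfolding g_def by (simp only: image_cong[OF that])
  qed
  have vanish: "J.G a a * J.G c d = 0\<^sub>m N N"
    if Z: "Z = J.G a a * (J.G c d * (J.G d c * J.G a a))" "Z * J.G a a = Z"
      and 0: "\<And>P. (\<And>k. k < m \<Longrightarrow> P k \<in> pinned j a k) \<Longrightarrow> trace_mat (Z * tensor_image P) = 0" for c d Z
  proof -
    have Zc: "Z \<in> carrier_mat N N" unfolding Z(1) by simp
    have "trace_mat Z = 0"
      by (rule trace_eq_0_if_pinned[OF j ab(1) Zc _ 0]) (use Z(2) in \<open>simp add: J.G_def\<close>)
    moreover have "Z = (J.G a a * J.G c d) * (J.G a a * J.G c d)\<^sup>\<dagger>"
      unfolding Z(1) by (simp add: adjoint_mult[of _ N N _ N] adj assoc)
    ultimately show ?thesis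
      by (intro trace_mult_adjoint_eq_0) simp_all
  qed
  show ?thesis
  proof (cases "\<exists>P. (\<forall>k<m. P k \<in> pinned j a k) \<and> trace_mat (?\<alpha> * tensor_image P) = 1")
    case True
    then obtain P0 where P0: "\<And>k. k < m \<Longrightarrow> P0 k \<in> pinned j a k" "trace_mat (?\<alpha> * tensor_image P0) = 1"
      by blast
    have zero: "trace_mat (?\<beta> * tensor_image P) = 0" if P: "\<And>k. k < m \<Longrightarrow> P k \<in> pinned j a k" for P
    proof -
      have "g P = g P0" by (rule const[OF P P0(1)])
      then have "trace_mat (?\<alpha> * tensor_image P) = 1"
        unfolding g_def by (simp add: p1(1)[OF P] p1(1)[OF P0(1)] P0(2))
      then show ?thesis using compl[OF P] by simp
    qed
    have "?e * ?y = 0\<^sub>m N N"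
      by (rule vanish[OF J.cocorner_def rel(6) zero])
    then have "(?e * ?y)\<^sup>\<dagger> = 0\<^sub>m N N" by simp
    then have "?x * ?e = 0\<^sub>m N N" by (simp add: adjoint_mult[of _ N N _ N] adj)
    then show ?thesis by (simp add: J.G_def)
  next
    case False
    then have zero: "trace_mat (?\<alpha> * tensor_image P) = 0" if "\<And>k. k < m \<Longrightarrow> P k \<in> pinned j a k" for P
      using idem[OF that] that by blast
    have "?e * ?x = 0\<^sub>m N N"
      by (rule vanish[OF J.corner_def rel(4) zero])
    then show ?thesis by (simp add: J.G_def)
  qed
qed

end

lemma linear_functional_comp_transpose:
  assumes l: "linear_functional n l"
  shows "linear_functional n (\<lambda>X. l (transpose_mat X))"
proof (rule linear_functionalI)
  fix X Y :: "complex mat" and c assume X: "X \<in> carrier_mat n n"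
  have "transpose_mat (c \<cdot>\<^sub>m X) = c \<cdot>\<^sub>m transpose_mat X" by (rule eq_matI) simp_all
  then show "l (transpose_mat (c \<cdot>\<^sub>m X)) = c * l (transpose_mat X)"
    using X by (simp add: linear_functional_smult[OF l])
  assume Y: "Y \<in> carrier_mat n n"
  have "transpose_mat (X + Y) = transpose_mat X + transpose_mat Y" by (rule eq_matI) (use X Y in simp_all)
  then show "l (transpose_mat (X + Y)) = l (transpose_mat X) + l (transpose_mat Y)"
    using X Y by (simp add: linear_functional_add[OF l])
qed

context jordan_map
begin

lemma transposed: "jordan_map n N (\<lambda>X. \<Phi> (transpose_mat X))"
proof (rule jordan_map.intro)
  show "\<Phi> (transpose_mat X) \<in> carrier_mat N N" if "X \<in> carrier_mat n n" for X
    using that by (intro car) simp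
  show "linear_functional n (\<lambda>X. l (\<Phi> (transpose_mat X)))" if "linear_functional N l" for l
    by (rule linear_functional_comp_transpose[OF lin[OF that]])
  fix X Y :: "complex mat" assume X: "X \<in> carrier_mat n n" and Y: "Y \<in> carrier_mat n n"
  have "transpose_mat (X * Y + Y * X)
      = transpose_mat (X * Y) + transpose_mat (Y * X)"
    by (rule eq_matI) (use X Y in simp_all)
  also have "\<dots> = transpose_mat Y * transpose_mat X + transpose_mat X * transpose_mat Y"
    by (simp only: transpose_mult[OF X Y] transpose_mult[OF Y X])
  also have "\<dots> = transpose_mat X * transpose_mat Y + transpose_mat Y * transpose_mat X"
    by (rule comm_add_mat[of _ n n]) (use X Y in simp_all)
  finally show "\<Phi> (transpose_mat X) * \<Phi> (transpose_mat Y) + \<Phi> (transpose_mat Y) * \<Phi> (transpose_mat X)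
      = \<Phi> (transpose_mat (X * Y + Y * X))"
    using jordan[of "transpose_mat X" "transpose_mat Y"] X Y by simp
qed

text \<open>If each pair of matrix units is treated multiplicatively or antimultiplicatively, then all pairs
  are treated alike: a mixed pair of pairs \<open>(a, b)\<close>, \<open>(b, c)\<close> would force \<open>G a c = 0\<close>.\<close>
lemma hom_or_antihom:
  assumes dich: "\<And>a b. a < n \<Longrightarrow> b < n \<Longrightarrow> a \<noteq> b \<Longrightarrow> G a a * G a b = 0\<^sub>m N N \<or> G a b * G a a = 0\<^sub>m N N"
    and nz: "\<And>a. a < n \<Longrightarrow> G a a \<noteq> 0\<^sub>m N N"
  shows "(\<forall>X\<in>carrier_mat n n. \<forall>Y\<in>carrier_mat n n. \<Phi> (X * Y) = \<Phi> X * \<Phi> Y) \<or>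
    (\<forall>X\<in>carrier_mat n n. \<forall>Y\<in>carrier_mat n n. \<Phi> (X * Y) = \<Phi> Y * \<Phi> X)"
proof -
  define R where "R a b \<longleftrightarrow> G a b * G a a = 0\<^sub>m N N" for a b
  define T where "T a b \<longleftrightarrow> G a a * G a b = 0\<^sub>m N N" for a b
  have RT: "R a b \<or> T a b" if "a < n" "b < n" "a \<noteq> b" for a b
    using dich[OF that] by (auto simp: R_def T_def)
  have Rf: "G a a * G a b = G a b \<and> G a b * G b b = G a b" if ab: "a < n" "b < n" "a \<noteq> b" "R a b" for a b
  proof
    show 1: "G a a * G a b = G a b"
      using off_diag_relations(1)[OF ab(1-3)] ab(4) by (simp add: R_def zero_simps)
    have "G b b * G a b = G b b * (G a a * G a b)" by (simp only: 1)
    also have "\<dots> = (G b b * G a a) * G a b" by (simp add: assoc)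
    finally have "G b b * G a b = 0\<^sub>m N N" using diag_orth[OF ab(2,1)] ab(3) by (simp add: zero_simps)
    then show "G a b * G b b = G a b"
      using off_diag_relations(2)[OF ab(1-3)] by (simp add: zero_simps)
  qed
  have Tf: "G a b * G a a = G a b \<and> G b b * G a b = G a b" if ab: "a < n" "b < n" "a \<noteq> b" "T a b" for a b
  proof
    show 1: "G a b * G a a = G a b"
      using off_diag_relations(1)[OF ab(1-3)] ab(4) by (simp add: T_def zero_simps)
    have "G a b * G b b = (G a b * G a a) * G b b" by (simp only: 1)
    also have "\<dots> = G a b * (G a a * G b b)" by (simp add: assoc)
    finally have "G a b * G b b = 0\<^sub>m N N" using diag_orth[OF ab(1-3)] by (simp add: zero_simps)
    then show "G b b * G a b = G a b"
      using off_diag_relations(2)[OF ab(1-3)] by (simp add: zero_simps)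
  qed
  have sum_nz: "G a a + G b b \<noteq> 0\<^sub>m N N" if ab: "a < n" "b < n" "a \<noteq> b" for a b
  proof
    assume "G a a + G b b = 0\<^sub>m N N"
    then have "G a a * (G a a + G b b) = 0\<^sub>m N N" by (simp add: zero_simps)
    then have "G a a = 0\<^sub>m N N"
      by (simp add: distrib diag_idem[OF ab(1)] diag_orth[OF ab] zero_simps)
    with nz[OF ab(1)] show False ..
  qed
  have kill: "A * B = 0\<^sub>m N N" if "A * G a a = A" "G b b * B = B" "a < n" "b < n" "a \<noteq> b"
    "A \<in> carrier_mat N N" "B \<in> carrier_mat N N" for A B a b
  proof -
    have "A * B = (A * G a a) * (G b b * B)" by (simp only: that(1,2))
    also have "\<dots> = A * ((G a a * G b b) * B)" using that(6,7) by (simp add: assoc)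
    also have "\<dots> = 0\<^sub>m N N" using diag_orth[OF that(3-5)] that(6,7) by (simp add: zero_simps)
    finally show ?thesis .
  qed
  have symm: "R b a" if ab: "a < n" "b < n" "a \<noteq> b" "R a b" for a b
  proof (rule ccontr)
    assume "\<not> R b a"
    then have T: "T b a" using RT[OF ab(2,1)] ab(3) by blast
    note x = Rf[OF ab] and y = Tf[OF ab(2,1) ab(3)[symmetric] T]
    have "G a b * G b a = 0\<^sub>m N N"
      by (rule kill[of _ b a]) (use x y ab in simp_all)
    moreover have "G b a * G a b = 0\<^sub>m N N"
      by (rule kill[of _ b a]) (use x y ab in simp_all)
    ultimately have "G a a + G b b = 0\<^sub>m N N"
      using off_diag_relations(4)[OF ab(1-3)] by (simp add: zero_simps)
    with sum_nz[OF ab(1-3)] show False ..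
  qed
  have step: "R b c" if ab: "a < n" "b < n" "a \<noteq> b" "R a b" and c: "c < n" "c \<noteq> a" "c \<noteq> b" for a b c
  proof (rule ccontr)
    assume "\<not> R b c"
    then have T: "T b c" using RT[OF ab(2) c(1)] c(3) by blast
    note x = Rf[OF ab] and z = Tf[OF ab(2) c(1) c(3)[symmetric] T]
    have "G a b * G b c = 0\<^sub>m N N"
      by (rule kill[of _ b c]) (use x z ab c in simp_all)
    moreover have "G b c * G a b = 0\<^sub>m N N"
      by (rule kill[of _ b a]) (use x z ab c in simp_all)
    ultimately have "G a c = 0\<^sub>m N N"
      using jordan_units[OF ab(1,2,2) c(1)] c(2) by (simp add: zero_simps)
    then have "G a a + G c c = 0\<^sub>m N N"
      using off_diag_relations(4)[OF ab(1) c(1) c(2)[symmetric]] by (simp add: zero_simps)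
    with sum_nz[OF ab(1) c(1) c(2)[symmetric]] show False ..
  qed
  show ?thesis
  proof (cases "\<exists>a b. a < n \<and> b < n \<and> a \<noteq> b \<and> \<not> R a b")
    case False
    then have "\<Phi> (X * Y) = \<Phi> X * \<Phi> Y" if "X \<in> carrier_mat n n" "Y \<in> carrier_mat n n" for X Y
      using multiplicative[OF _ that] unfolding R_def by blast
    then show ?thesis by blast
  next
    case True
    then obtain a0 b0 where nR: "a0 < n" "b0 < n" "a0 \<noteq> b0" "\<not> R a0 b0" by blast
    have noR: "\<not> R a b" if ab: "a < n" "b < n" "a \<noteq> b" for a b
    proof
      assume Rab: "R a b"
      have Rba: "R b a" by (rule symm[OF ab Rab])
      have "R c d" if cd: "c < n" "d < n" "c \<noteq> d" for c d
      proof -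
        consider "c = a" | "c = b" | "c \<noteq> a" "c \<noteq> b" by blast
        then show ?thesis
        proof cases
          case 1
          then show ?thesis using Rab step[OF ab(2,1) ab(3)[symmetric] Rba cd(2)] cd by blast
        next
          case 2
          then show ?thesis using Rba step[OF ab Rab cd(2)] cd by blast
        next
          case 3
          have ac: "R a c" by (rule step[OF ab(2,1) ab(3)[symmetric] Rba cd(1) 3(2,1)])
          show ?thesis
            using symm[OF ab(1) cd(1) 3(1)[symmetric] ac] step[OF ab(1) cd(1) 3(1)[symmetric] ac cd(2)] cd(3)
            by blast
        qed
      qed
      with nR show False by blast
    qed
    interpret J: jordan_map n N "\<lambda>X. \<Phi> (transpose_mat X)" by (rule transposed)
    have JG: "J.G a b = G b a" for a b by (simp add: J.G_def G_def)
    have "J.G a b * J.G a a = 0\<^sub>m N N" if ab: "a < n" "b < n" "a \<noteq> b" for a b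
    proof -
      have "T b a" using noR[OF ab(2,1)] RT[OF ab(2,1)] ab(3) by blast
      note y = Tf[OF ab(2,1) ab(3)[symmetric] this]
      have "G b a * G a a = 0\<^sub>m N N"
        by (rule kill[of _ b a]) (use y ab diag_idem in simp_all)
      then show ?thesis unfolding JG .
    qed
    note mult = J.multiplicative[OF this]
    have "\<Phi> (X * Y) = \<Phi> Y * \<Phi> X" if X: "X \<in> carrier_mat n n" and Y: "Y \<in> carrier_mat n n" for X Y
      using mult[of "transpose_mat Y" "transpose_mat X"] X Y transpose_mult[OF X Y, symmetric] by simp
    then show ?thesis by blast
  qed
qed

end

section \<open>Assembling the slots\<close>

context frame_map
begin

lemma slot_hom_or_antihom:
  assumes j: "j < m"
  shows "(\<forall>X\<in>carrier_mat (n j) (n j). \<forall>Y\<in>carrier_mat (n j) (n j). slot j (X * Y) = slot j X * slot j Y) \<or>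
    (\<forall>X\<in>carrier_mat (n j) (n j). \<forall>Y\<in>carrier_mat (n j) (n j). slot j (X * Y) = slot j Y * slot j X)"
proof -
  interpret J: jordan_map "n j" N "slot j" by (rule slot_jordan_map[OF j])
  show ?thesis
  proof (rule J.hom_or_antihom)
    show "J.G a a * J.G a b = 0\<^sub>m N N \<or> J.G a b * J.G a a = 0\<^sub>m N N" if "a < n j" "b < n j" "a \<noteq> b" for a b
      unfolding J.G_def by (rule slot_dichotomy[OF j that])
    show "J.G a a \<noteq> 0\<^sub>m N N" if a: "a < n j" for a
    proof
      assume 0: "J.G a a = 0\<^sub>m N N"
      define P where "P = (\<lambda>k. if k = j then unit_mat (n j) a a else unit_mat (n k) 0 0)"
      define A where "A = (\<lambda>k. if k = j then 1\<^sub>m (n j) else unit_mat (n k) 0 0)"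
      have A: "A \<in> families m n" "A j = 1\<^sub>m (n j)" by (simp_all add: A_def families_def)
      have "A(j := unit_mat (n j) a a) = P" by (auto simp: A_def P_def)
      then have "tensor_image P = J.G a a * tensor_image A"
        using slot_mult_image(1)[OF A unit_mat_carrier[of "n j" a a]] by (simp only: J.G_def)
      then have "tensor_image P = 0\<^sub>m N N"
        using image_carrier[OF A(1)] by (simp add: 0)
      moreover have "trace_mat (tensor_image P) = 1"
        by (rule image_rank_one(1)) (simp add: P_def unit_mat_rank_one a pos)
      ultimately show False by (simp add: trace_mat_def)
    qed
  qed
qed

lemma image_zero:
  assumes A: "A \<in> families m n" and j: "j < m" "A j = 0\<^sub>m (n j) (n j)"
  shows "tensor_image A = 0\<^sub>m N N"
proof (rule eq_matI)
  fix p q assume "p < dim_row (0\<^sub>m N N :: complex mat)" "q < dim_col (0\<^sub>m N N :: complex mat)"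
  then have pq: "p < N" "q < N" by simp_all
  have "A(j := 0\<^sub>m (n j) (n j)) = A" using j(2) by auto
  then show "tensor_image A $$ (p, q) = 0\<^sub>m N N $$ (p, q)"
    using linear_functional_zero[OF multilinearD[OF multilinear_image[OF linear_functional_index[OF pq]] A j(1)]] pq
    by simp
qed (use image_carrier[OF A] in simp_all)

text \<open>Transposing the slots that are mapped by an antihomomorphism turns all of them into homomorphisms.
  Their ranges commute, so the resulting map is multiplicative on Kronecker products, by induction on
  the set of slots in which both factors differ from the identity. A multiplicative map that preserves
  adjoints carries the matrix units to matrix units, and these are unitarily equivalent to the
  standard ones, the unitary having the columns \<open>W p 0 u\<close> for a unit vector \<open>u\<close> in the range of \<open>W 0 0\<close>.\<close>
lemma normal_form:
  "\<exists>U\<in>unitaries N. \<exists>\<tau>. (\<forall>j. \<tau> j = id \<or> \<tau> j = transpose_mat) \<and>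
    (\<forall>A\<in>families m n. tensor_image A = U * kronecker_family m (\<lambda>j. \<tau> j (A j)) * U\<^sup>\<dagger>)"
proof -
  let ?hom = "\<lambda>j. \<forall>X\<in>carrier_mat (n j) (n j). \<forall>Y\<in>carrier_mat (n j) (n j). slot j (X * Y) = slot j X * slot j Y"
  define \<tau> :: "nat \<Rightarrow> complex mat \<Rightarrow> complex mat" where "\<tau> j = (if ?hom j then id else transpose_mat)" for j
  have \<tau>: "\<tau> j = id \<or> \<tau> j = transpose_mat" for j by (simp add: \<tau>_def)
  have \<tau>c: "\<tau> j X \<in> carrier_mat k k" if "X \<in> carrier_mat k k" for j k X
    using \<tau>[of j] that by auto
  have \<tau>\<tau>: "\<tau> j (\<tau> j X) = X" for j X using \<tau>[of j] by auto
  have \<tau>1: "\<tau> j (1\<^sub>m k) = 1\<^sub>m k" for j k using \<tau>[of j] by auto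
  have \<tau>E: "\<tau> j (unit_mat k a a) = unit_mat k a a" for j k a using \<tau>[of j] by auto
  have \<tau>adj: "\<tau> j (X\<^sup>\<dagger>) = (\<tau> j X)\<^sup>\<dagger>" for j X using \<tau>[of j] by (auto simp: adjoint_transpose)
  have \<tau>lin: "linear_functional k (\<lambda>X. l (\<tau> j X))" if "linear_functional k l" for j k l
    using \<tau>[of j] that linear_functional_comp_transpose[OF that] by auto
  define \<tau>f where "\<tau>f A = (\<lambda>k. \<tau> k (A k))" for A
  define img where "img A = tensor_image (\<tau>f A)" for A
  have \<tau>fam: "\<tau>f A \<in> families m n" if "A \<in> families m n" for A
    using that \<tau>c by (simp add: families_def \<tau>f_def)
  have \<tau>upd: "\<tau>f (A(j := X)) = (\<tau>f A)(j := \<tau> j X)" for A j X by (auto simp: \<tau>f_def)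
  have img_car: "img A \<in> carrier_mat N N" if "A \<in> families m n" for A
    unfolding img_def by (rule image_carrier[OF \<tau>fam[OF that]])
  have img_cong: "img A = img B" if "\<And>j. j < m \<Longrightarrow> A j = B j" for A B
    unfolding img_def by (rule image_cong) (simp add: \<tau>f_def that)
  define sl where "sl j X = slot j (\<tau> j X)" for j X
  have sl_car: "sl j X \<in> carrier_mat N N" if "X \<in> carrier_mat (n j) (n j)" for j X
    unfolding sl_def by (rule slot_carrier[OF \<tau>c[OF that]])
  have sl_hom: "sl j (X * Y) = sl j X * sl j Y"
    if j: "j < m" and X: "X \<in> carrier_mat (n j) (n j)" and Y: "Y \<in> carrier_mat (n j) (n j)" for j X Y
  proof (cases "?hom j")
    case True
    then have "\<tau> j = id" unfolding \<tau>_def by (rule if_P)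
    then show ?thesis using True X Y by (simp add: sl_def)
  next
    case False
    then have t: "\<tau> j = transpose_mat" unfolding \<tau>_def by (rule if_not_P)
    have "\<forall>X\<in>carrier_mat (n j) (n j). \<forall>Y\<in>carrier_mat (n j) (n j). slot j (X * Y) = slot j Y * slot j X"
      using slot_hom_or_antihom[OF j] False by blast
    then have "slot j (transpose_mat Y * transpose_mat X) = slot j (transpose_mat X) * slot j (transpose_mat Y)"
      using X Y by simp
    then show ?thesis unfolding sl_def t transpose_mult[OF X Y] .
  qed
  have sl_img: "sl j X * img A = img (A(j := X)) \<and> img A * sl j X = img (A(j := X))"
    if A: "A \<in> families m n" "A j = 1\<^sub>m (n j)" and X: "X \<in> carrier_mat (n j) (n j)" for A j X
  proof -
    have "\<tau>f A j = 1\<^sub>m (n j)" by (simp add: \<tau>f_def A(2) \<tau>1)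
    from slot_mult_image[OF \<tau>fam[OF A(1)] this \<tau>c[OF X]]
    show ?thesis by (simp only: sl_def img_def \<tau>upd)
  qed
  have img_disjoint: "img A * img B = img (\<lambda>j. A j * B j)"
    if A: "A \<in> families m n" and B: "B \<in> families m n"
      and one: "\<And>j. j < m \<Longrightarrow> A j = 1\<^sub>m (n j) \<or> B j = 1\<^sub>m (n j)" for A B
  proof -
    define S where "S = {j. B j = 1\<^sub>m (n j)}"
    define C where "C = \<tau>f (\<lambda>j. A j * B j)"
    have AB: "(\<lambda>j. A j * B j) \<in> families m n" using A B by (simp add: families_def)
    have "tensor_image (\<lambda>j. if j \<in> S then C j else 1\<^sub>m (n j)) = img A"
      unfolding img_def
    proof (rule image_cong)
      fix j assume j: "j < m"
      note c = familiesD[OF A j] familiesD[OF B j]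
      show "(if j \<in> S then C j else 1\<^sub>m (n j)) = \<tau>f A j"
      proof (cases "j \<in> S")
        case True
        then have "B j = 1\<^sub>m (n j)" by (simp add: S_def)
        then show ?thesis using True c by (simp add: C_def \<tau>f_def)
      next
        case False
        then have "A j = 1\<^sub>m (n j)" using one[OF j] by (simp add: S_def)
        then show ?thesis using False by (simp add: \<tau>f_def \<tau>1)
      qed
    qed
    moreover have "tensor_image (\<lambda>j. if j \<in> S then 1\<^sub>m (n j) else C j) = img B"
      unfolding img_def
    proof (rule image_cong)
      fix j assume j: "j < m"
      note c = familiesD[OF A j] familiesD[OF B j]
      show "(if j \<in> S then 1\<^sub>m (n j) else C j) = \<tau>f B j"
      proof (cases "j \<in> S")
        case True
        then have "B j = 1\<^sub>m (n j)" by (simp add: S_def)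
        then show ?thesis using True by (simp add: \<tau>f_def \<tau>1)
      next
        case False
        then have "A j = 1\<^sub>m (n j)" using one[OF j] by (simp add: S_def)
        then show ?thesis using False c by (simp add: C_def \<tau>f_def)
      qed
    qed
    ultimately have "img A * img B = tensor_image C"
      using image_split[OF \<tau>fam[OF AB], of S] unfolding C_def[symmetric] by simp
    then show ?thesis by (simp only: C_def img_def)
  qed
  have img_mult_on: "\<forall>A\<in>families m n. \<forall>B\<in>families m n.
      (\<forall>j<m. j \<notin> S \<longrightarrow> A j = 1\<^sub>m (n j) \<or> B j = 1\<^sub>m (n j)) \<longrightarrow> img A * img B = img (\<lambda>j. A j * B j)"
    if "finite S" "S \<subseteq> {..<m}" for S
    using that
  proof (induction S rule: finite_induct)
    case empty
    then show ?case using img_disjoint by simp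
  next
    case (insert k S)
    then have k: "k < m" by simp
    show ?case
    proof (intro ballI impI)
      fix A B assume A: "A \<in> families m n" and B: "B \<in> families m n"
        and one: "\<forall>j<m. j \<notin> insert k S \<longrightarrow> A j = 1\<^sub>m (n j) \<or> B j = 1\<^sub>m (n j)"
      let ?A = "A(k := 1\<^sub>m (n k))" and ?B = "B(k := 1\<^sub>m (n k))" and ?C = "A(k := A k * B k)"
      note Ak = familiesD[OF A k] and Bk = familiesD[OF B k]
      have AkBk: "A k * B k \<in> carrier_mat (n k) (n k)" using Ak Bk by simp
      have fam: "?A \<in> families m n" "?B \<in> families m n" "?C \<in> families m n"
        by (rule families_update[OF A one_carrier_mat] families_update[OF B one_carrier_mat]
            families_update[OF A AkBk])+
      have upd: "?A(k := A k) = A" "?B(k := B k) = B" "?A(k := A k * B k) = ?C" by auto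
      have at: "?A k = 1\<^sub>m (n k)" "?B k = 1\<^sub>m (n k)" by simp_all
      note car = img_car[OF fam(1)] img_car[OF fam(2)] sl_car[OF Ak] sl_car[OF Bk]
      have eqA: "img A = img ?A * sl k (A k)" using sl_img[OF fam(1) at(1) Ak] by (simp only: upd)
      have eqB: "img B = sl k (B k) * img ?B" using sl_img[OF fam(2) at(2) Bk] by (simp only: upd)
      have "img A * img B = img ?A * (sl k (A k) * sl k (B k)) * img ?B"
        unfolding eqA eqB using car by (simp add: assoc_mult_mat[of _ N N _ N _ N])
      also have "sl k (A k) * sl k (B k) = sl k (A k * B k)" by (rule sl_hom[OF k Ak Bk, symmetric])
      also have "img ?A * sl k (A k * B k) = img ?C"
        using sl_img[OF fam(1) at(1) AkBk] by (simp only: upd)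
      also have "img ?C * img ?B = img (\<lambda>j. ?C j * ?B j)"
      proof -
        have "\<forall>j<m. j \<notin> S \<longrightarrow> ?C j = 1\<^sub>m (n j) \<or> ?B j = 1\<^sub>m (n j)"
          using one by simp
        then show ?thesis using insert.IH insert.prems fam(2,3) by blast
      qed
      also have "\<dots> = img (\<lambda>j. A j * B j)"
      proof (rule img_cong)
        fix j assume "j < m"
        show "?C j * ?B j = A j * B j"
          using AkBk by (cases "j = k") (simp_all add: right_mult_one_mat[of _ "n k" "n k"])
      qed
      finally show "img A * img B = img (\<lambda>j. A j * B j)" .
    qed
  qed
  have img_mult: "img A * img B = img (\<lambda>j. A j * B j)" if "A \<in> families m n" "B \<in> families m n" for A B
    using img_mult_on[of "{..<m}"] that by simp
  have img_adj: "(img A)\<^sup>\<dagger> = img (\<lambda>j. (A j)\<^sup>\<dagger>)" if "A \<in> families m n" for A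
    using image_adjoint[OF \<tau>fam[OF that]] by (simp add: img_def \<tau>f_def \<tau>adj)
  \<comment> \<open>The images of the matrix units form a system of matrix units, which is unitarily equivalent
    to the standard one.\<close>
  define E where "E p q = (\<lambda>j. unit_mat (n j) (digit m n p j) (digit m n q j))" for p q
  have E: "E p q \<in> families m n" for p q by (simp add: E_def families_def)
  define W where "W p q = img (E p q)" for p q
  have W: "W p q \<in> carrier_mat N N" for p q unfolding W_def by (rule img_car[OF E])
  have W_mult: "W p q * W r s = (if q = r then W p s else 0\<^sub>m N N)" if qr: "q < N" "r < N" for p q r s
  proof -
    have prod: "W p q * W r s = img (\<lambda>j. E p q j * E r s j)"
      unfolding W_def by (rule img_mult[OF E E])
    have dl: "digit m n t j < n j" if "j < m" for t j
      using digit_less[of m n j t] pos that by blast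
    show ?thesis
    proof (cases "q = r")
      case True
      have "img (\<lambda>j. E p q j * E r s j) = W p s"
        unfolding W_def by (rule img_cong) (simp add: E_def unit_mat_mult dl True)
      then show ?thesis using True prod by simp
    next
      case False
      then obtain j where j: "j < m" "digit m n q j \<noteq> digit m n r j"
        using digit_inject[of q n m r] qr unfolding N by blast
      have "E p q j * E r s j = 0\<^sub>m (n j) (n j)"
        using j by (simp add: E_def unit_mat_mult dl)
      moreover have "\<tau> j (0\<^sub>m (n j) (n j)) = 0\<^sub>m (n j) (n j)" using \<tau>[of j] by auto
      ultimately have "\<tau>f (\<lambda>j. E p q j * E r s j) j = 0\<^sub>m (n j) (n j)" by (simp add: \<tau>f_def)
      moreover have "\<tau>f (\<lambda>j. E p q j * E r s j) \<in> families m n"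
        by (rule \<tau>fam) (simp add: E_def families_def)
      ultimately have "img (\<lambda>j. E p q j * E r s j) = 0\<^sub>m N N"
        unfolding img_def by (intro image_zero[OF _ j(1)])
      then show ?thesis using False prod by simp
    qed
  qed
  have W_adj: "(W p q)\<^sup>\<dagger> = W q p" for p q
    unfolding W_def img_adj[OF E] by (rule img_cong) (simp add: E_def)
  have N0: "N > 0" unfolding N using pos by (intro prod_pos) simp
  obtain U0 where U0: "U0 \<in> unitaries N" and W00: "W 0 0 = U0 * unit_mat N 0 0 * U0\<^sup>\<dagger>"
  proof -
    have V: "\<And>j. j < m \<Longrightarrow> one_family j \<in> unitaries (n j)" by simp
    have K1: "kronecker_family m one_family = 1\<^sub>m N" unfolding N by (rule kronecker_family_one[OF pos])
    obtain U where U: "U \<in> unitaries N" and UI: "\<forall>I<N. \<psi> (1\<^sub>m N * unit_mat N I I * (1\<^sub>m N)\<^sup>\<dagger>) = U * unit_mat N I I * U\<^sup>\<dagger>"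
      using frame[OF V] unfolding K1 by blast
    have "W 0 0 = \<psi> (kronecker_family m (E 0 0))"
      unfolding W_def img_def tensor_image_def by (simp add: \<tau>f_def E_def \<tau>E)
    also have "kronecker_family m (E 0 0) = unit_mat N 0 0"
      unfolding E_def N by (rule kronecker_family_unit_mat[OF pos]) (use N0 N in simp_all)
    also have "\<psi> (unit_mat N 0 0) = \<psi> (1\<^sub>m N * unit_mat N 0 0 * (1\<^sub>m N)\<^sup>\<dagger>)"
      by (simp add: left_mult_one_mat[of _ N N] right_mult_one_mat[of _ N N])
    also have "\<dots> = U * unit_mat N 0 0 * U\<^sup>\<dagger>" using UI N0 by blast
    finally show ?thesis using that U by blast
  qed
  note U0c = unitariesD[OF U0]
  note assoc = assoc_mult_mat[of _ N N _ N _ N]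
  have core: "U0\<^sup>\<dagger> * (W 0 0 * U0) = unit_mat N 0 0"
    using unitary_conj_cancel(1)[OF U0, of "unit_mat N 0 0"] U0c W unfolding W00[symmetric] by (simp add: assoc)
  define U where "U = mat N N (\<lambda>(i, p). (W p 0 * U0) $$ (i, 0))"
  have Uc: "U \<in> carrier_mat N N" by (simp add: U_def)
  have Ui: "U $$ (i, p) = (W p 0 * U0) $$ (i, 0)" if "i < N" "p < N" for i p
    using that by (simp add: U_def del: index_mult_mat)
  have "U\<^sup>\<dagger> * U = 1\<^sub>m N"
  proof (rule eq_matI)
    fix p q assume "p < dim_row (1\<^sub>m N :: complex mat)" "q < dim_col (1\<^sub>m N :: complex mat)"
    then have pq: "p < N" "q < N" by simp_all
    have c: "W p 0 * U0 \<in> carrier_mat N N" "W q 0 * U0 \<in> carrier_mat N N" using W U0c by simp_all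
    have "(U\<^sup>\<dagger> * U) $$ (p, q) = (\<Sum>i<N. U\<^sup>\<dagger> $$ (p, i) * U $$ (i, q))"
      by (rule index_mult_sum[of _ N N _ N]) (use Uc pq in simp_all)
    also have "\<dots> = (\<Sum>i<N. (W p 0 * U0)\<^sup>\<dagger> $$ (0, i) * (W q 0 * U0) $$ (i, 0))"
      using Uc U0c(1) W[of p 0] W[of q 0] pq N0 by (intro sum.cong refl) (simp add: Ui del: index_mult_mat(1))
    also have "\<dots> = ((W p 0 * U0)\<^sup>\<dagger> * (W q 0 * U0)) $$ (0, 0)"
      by (rule index_mult_sum[of _ N N _ N, symmetric]) (use c N0 in simp_all)
    also have "(W p 0 * U0)\<^sup>\<dagger> * (W q 0 * U0) = U0\<^sup>\<dagger> * ((W 0 p * W q 0) * U0)"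
      using W U0c by (simp add: adjoint_mult[of _ N N _ N] W_adj assoc)
    also have "\<dots> = (if p = q then unit_mat N 0 0 else 0\<^sub>m N N)"
      using W U0c core by (simp add: W_mult[OF pq] left_mult_zero_mat[of _ N N] right_mult_zero_mat[of _ N N])
    finally show "(U\<^sup>\<dagger> * U) $$ (p, q) = 1\<^sub>m N $$ (p, q)" using pq N0 by simp
  qed (use Uc in simp_all)
  then have U: "U \<in> unitaries N" using Uc by (simp add: unitaries_def)
  note Ud = unitariesD[OF U]
  have WU: "W p q = U * unit_mat N p q * U\<^sup>\<dagger>" if pq: "p < N" "q < N" for p q
  proof -
    have "W p q * U = U * unit_mat N p q"
    proof (rule eq_matI)
      fix i r assume "i < dim_row (U * unit_mat N p q)" "r < dim_col (U * unit_mat N p q)"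
      then have ir: "i < N" "r < N" using Uc by simp_all
      have c: "W r 0 * U0 \<in> carrier_mat N N" using W U0c by simp
      have "(W p q * U) $$ (i, r) = (\<Sum>t<N. W p q $$ (i, t) * U $$ (t, r))"
        by (rule index_mult_sum[of _ N N _ N]) (use Uc W ir in simp_all)
      also have "\<dots> = (\<Sum>t<N. W p q $$ (i, t) * (W r 0 * U0) $$ (t, 0))"
        using ir by (intro sum.cong refl) (simp add: Ui del: index_mult_mat)
      also have "\<dots> = (W p q * (W r 0 * U0)) $$ (i, 0)"
        by (rule index_mult_sum[of _ N N _ N, symmetric]) (use W c ir N0 in simp_all)
      also have "W p q * (W r 0 * U0) = (W p q * W r 0) * U0" using W U0c by (simp add: assoc)
      also have "\<dots> = (if q = r then W p 0 else 0\<^sub>m N N) * U0" by (simp only: W_mult[OF pq(2) ir(2)])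
      also have "(\<dots>) $$ (i, 0) = U $$ (i, p) * (if q = r then 1 else 0)"
        using U0c ir pq N0 by (simp add: Ui left_mult_zero_mat[of _ N N] del: index_mult_mat(1))
      also have "\<dots> = (\<Sum>t<N. (U $$ (i, t) * (if q = r then 1 else 0)) * (if t = p then 1 else 0))"
        by (rule sum_mult_delta(1)[OF pq(1), symmetric])
      also have "\<dots> = (\<Sum>t<N. U $$ (i, t) * unit_mat N p q $$ (t, r))"
        using ir by (intro sum.cong refl) auto
      also have "\<dots> = (U * unit_mat N p q) $$ (i, r)"
        by (rule index_mult_sum[of _ N N _ N, symmetric]) (use Uc ir in simp_all)
      finally show "(W p q * U) $$ (i, r) = (U * unit_mat N p q) $$ (i, r)" .
    qed (use Uc W[of p q] in simp_all)
    then have "W p q * U * U\<^sup>\<dagger> = U * unit_mat N p q * U\<^sup>\<dagger>" by simp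
    moreover have "W p q * U * U\<^sup>\<dagger> = W p q * (U * U\<^sup>\<dagger>)" using W Ud by (simp add: assoc)
    ultimately show ?thesis using W by (simp add: Ud right_mult_one_mat[of _ N N])
  qed
  have img_eq: "img A = U * kronecker_family m A * U\<^sup>\<dagger>" if A: "A \<in> families m n" for A
  proof -
    have id: "linear_map_mat N (\<lambda>X. X)" unfolding linear_map_mat_iff by simp
    have Kc: "kronecker_family m A \<in> carrier_mat N N" if "A \<in> families m n" for A
      using kronecker_family_in_carrier[OF that] by (simp only: N)
    have entry: "img A $$ (p, q) - (U * kronecker_family m A * U\<^sup>\<dagger>) $$ (p, q) = 0" if pq: "p < N" "q < N" for p q
    proof (rule multilinear_eq_0[where m = m and n = n and A = A
          and B = "\<lambda>j. {unit_mat (n j) a b | a b. a < n j \<and> b < n j}"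
          and g = "\<lambda>A. img A $$ (p, q) - (U * kronecker_family m A * U\<^sup>\<dagger>) $$ (p, q)"])
      note l = linear_functional_index[OF pq]
      show "multilinear m n (\<lambda>A. img A $$ (p, q) - (U * kronecker_family m A * U\<^sup>\<dagger>) $$ (p, q))"
      proof (rule multilinear_diff)
        show "multilinear m n (\<lambda>A. img A $$ (p, q))"
          unfolding multilinear_def
        proof (intro ballI allI impI)
          fix A j assume A: "A \<in> families m n" and j: "j < m"
          show "linear_functional (n j) (\<lambda>X. img (A(j := X)) $$ (p, q))"
            unfolding img_def \<tau>upd
            by (rule \<tau>lin[OF multilinearD[OF multilinear_image[OF l] \<tau>fam[OF A] j]])
        qed
        show "multilinear m n (\<lambda>A. (U * kronecker_family m A * U\<^sup>\<dagger>) $$ (p, q))"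
          using linear_map_mat_comp_functional[OF linear_map_unitary_conj[OF id Uc] l] pos
          unfolding N by (intro multilinear_kronecker) simp_all
      qed
      fix A assume "\<And>j. j < m \<Longrightarrow> A j \<in> {unit_mat (n j) a b | a b. a < n j \<and> b < n j}"
      then have "\<forall>j\<in>{..<m}. \<exists>a b. A j = unit_mat (n j) a b \<and> a < n j \<and> b < n j" by blast
      then obtain a b where ab: "\<And>j. j < m \<Longrightarrow> A j = unit_mat (n j) (a j) (b j) \<and> a j < n j \<and> b j < n j"
        by (metis lessThan_iff)
      obtain r where r: "r < N" "\<forall>j<m. digit m n r j = a j" using digit_surject[of m a n] ab unfolding N by blast
      obtain s where s: "s < N" "\<forall>j<m. digit m n s j = b j" using digit_surject[of m b n] ab unfolding N by blast
      have AE: "A j = E r s j" if "j < m" for j using ab[OF that] r(2) s(2) that by (simp add: E_def)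
      have "img A = W r s" unfolding W_def by (rule img_cong[OF AE])
      moreover have "kronecker_family m A = kronecker_family m (E r s)" by (rule kronecker_family_cong[OF AE])
      moreover have "kronecker_family m (E r s) = unit_mat N r s"
        unfolding E_def N by (rule kronecker_family_unit_mat[OF pos]) (use r s N in simp_all)
      ultimately show "img A $$ (p, q) - (U * kronecker_family m A * U\<^sup>\<dagger>) $$ (p, q) = 0"
        using WU[OF r(1) s(1)] by simp
    next
      show "{unit_mat (n j) a b | a b. a < n j \<and> b < n j} \<subseteq> carrier_mat (n j) (n j)" for j by auto
    qed (use A spanning_unit_mats in simp_all)
    show ?thesis
    proof (rule eq_matI)
      note c = img_car[OF A] Kc[OF A]
      show "img A $$ (p, q) = (U * kronecker_family m A * U\<^sup>\<dagger>) $$ (p, q)"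
        if "p < dim_row (U * kronecker_family m A * U\<^sup>\<dagger>)" "q < dim_col (U * kronecker_family m A * U\<^sup>\<dagger>)" for p q
        using entry[of p q] that c Uc by (simp del: index_mult_mat(1))
    qed (use img_car[OF A] Kc[OF A] Uc in simp_all)
  qed
  have "tensor_image A = U * kronecker_family m (\<lambda>j. \<tau> j (A j)) * U\<^sup>\<dagger>" if A: "A \<in> families m n" for A
  proof -
    have "\<tau>f (\<tau>f A) = A" by (simp add: \<tau>f_def \<tau>\<tau>)
    then have "tensor_image A = img (\<tau>f A)" by (simp add: img_def)
    also have "\<dots> = U * kronecker_family m (\<tau>f A) * U\<^sup>\<dagger>" by (rule img_eq[OF \<tau>fam[OF A]])
    finally show ?thesis by (simp only: \<tau>f_def)
  qed
  with U \<tau> show ?thesis by blast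
qed

end

section \<open>Invariance of the numerical radius\<close>

lemma numerical_radius_le_if_form:
  assumes A: "A \<in> carrier_mat n n" and B: "B \<in> carrier_mat n n" and n: "n > 0"
    and f: "\<And>v. \<exists>w. normsq n w = normsq n v \<and> cmod (form n A v v) = cmod (form n B w w)"
  shows "numerical_radius A \<le> numerical_radius B"
proof (rule numerical_radius_leI[OF A n])
  fix v
  obtain w where "normsq n w = normsq n v" "cmod (form n A v v) = cmod (form n B w w)" using f by blast
  then show "cmod (form n A v v) \<le> numerical_radius B * normsq n v"
    using form_le_numerical_radius[OF B, of w] by simp
qed

lemma numerical_radius_unimodular_smult:
  assumes A: "A \<in> carrier_mat n n" and n: "n > 0" and c: "cmod c = 1"
  shows "numerical_radius (c \<cdot>\<^sub>m A) = numerical_radius A"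
proof (rule antisym)
  have "cmod (form n (c \<cdot>\<^sub>m A) v v) = cmod (form n A v v)" for v
    using c by (simp add: form_smult[OF A] norm_mult)
  then show "numerical_radius (c \<cdot>\<^sub>m A) \<le> numerical_radius A" "numerical_radius A \<le> numerical_radius (c \<cdot>\<^sub>m A)"
    by (intro numerical_radius_le_if_form[of _ n] smult_carrier_mat A n; metis)+
qed

lemma form_transpose:
  "A \<in> carrier_mat n n \<Longrightarrow> form n (transpose_mat A) v v = form n A (\<lambda>i. cnj (v i)) (\<lambda>i. cnj (v i))"
  unfolding form_def by (subst sum.swap) (simp add: mult_ac)

lemma numerical_radius_transpose:
  assumes A: "A \<in> carrier_mat n n" and n: "n > 0"
  shows "numerical_radius (transpose_mat A) = numerical_radius A"
proof (rule antisym)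
  have le: "numerical_radius (transpose_mat A) \<le> numerical_radius A" if A: "A \<in> carrier_mat n n" for A
  proof (rule numerical_radius_le_if_form[OF _ A n])
    show "transpose_mat A \<in> carrier_mat n n" using A by simp
    show "\<exists>w. normsq n w = normsq n v \<and> cmod (form n (transpose_mat A) v v) = cmod (form n A w w)" for v
      by (rule exI[of _ "\<lambda>i. cnj (v i)"]) (simp add: form_transpose[OF A] normsq_def)
  qed
  show "numerical_radius (transpose_mat A) \<le> numerical_radius A" by (rule le[OF A])
  show "numerical_radius A \<le> numerical_radius (transpose_mat A)"
    using le[of "transpose_mat A"] A by simp
qed

subsection \<open>A two-by-two matrix is unitarily similar to its transpose\<close>

text \<open>The coefficients are the two-by-two determinants of the real coordinates, unless these all vanish.\<close>
lemma real_linear_dependence: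
  fixes z1 z2 z3 :: complex
  shows "\<exists>x y k :: real. (x \<noteq> 0 \<or> y \<noteq> 0 \<or> k \<noteq> 0) \<and> of_real x * z1 + of_real y * z2 + of_real k * z3 = 0"
proof -
  define det where "det u v = Re u * Im v - Im u * Re v" for u v :: complex
  show ?thesis
  proof (cases "det z2 z3 = 0 \<and> det z3 z1 = 0 \<and> det z1 z2 = 0")
    case False
    have "of_real (det z2 z3) * z1 + of_real (det z3 z1) * z2 + of_real (det z1 z2) * z3 = 0"
      by (simp add: complex_eq_iff det_def algebra_simps)
    with False show ?thesis by blast
  next
    case True
    show ?thesis
    proof (cases "z1 = 0")
      case True
      then show ?thesis by (intro exI[of _ 1] exI[of _ 0]) simp
    next
      case False
      define x where "x = Re z1 * Re z2 + Im z1 * Im z2"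
      define y where "y = - ((Re z1)\<^sup>2 + (Im z1)\<^sup>2)"
      have "(Re z1)\<^sup>2 + (Im z1)\<^sup>2 \<noteq> 0"
        using False by (simp add: complex_eq_iff sum_power2_eq_zero_iff)
      then have "y \<noteq> 0" by (simp only: y_def neg_equal_0_iff_equal not_False_eq_True)
      moreover have d: "Re z1 * Im z2 = Im z1 * Re z2" using True by (simp add: det_def)
      have "x * Re z1 + y * Re z2 = Im z1 * (Re z1 * Im z2 - Im z1 * Re z2)"
        "x * Im z1 + y * Im z2 = Re z1 * (Im z1 * Re z2 - Re z1 * Im z2)"
        by (simp_all add: x_def y_def power2_eq_square algebra_simps)
      then have "of_real x * z1 + of_real y * z2 + of_real 0 * z3 = 0"
        by (simp add: complex_eq_iff d)
      ultimately show ?thesis by blast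
    qed
  qed
qed

text \<open>If \<open>V\<close> and \<open>V A\<close> are symmetric then \<open>V A = A\<^sup>t V\<close>. The symmetric unitaries with entries \<open>p, q, q, - cnj p\<close>,
  where \<open>q\<close> is real, form a three-dimensional real space up to scaling, and the symmetry of \<open>V A\<close> is one
  complex equation.\<close>
lemma transpose_unitarily_similar_2:
  assumes A: "A \<in> carrier_mat 2 2"
  shows "\<exists>V\<in>unitaries 2. transpose_mat A = V * A * V\<^sup>\<dagger>"
proof -
  let ?a = "A $$ (0, 0)" and ?b = "A $$ (0, 1)" and ?c = "A $$ (1, 0)" and ?d = "A $$ (1, 1)"
  obtain x y k :: real where nz: "x \<noteq> 0 \<or> y \<noteq> 0 \<or> k \<noteq> 0"
    and dep: "of_real x * (?b + ?c) + of_real y * (\<i> * (?b - ?c)) + of_real k * (?d - ?a) = 0"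
    using real_linear_dependence by blast
  define r where "r = sqrt (x\<^sup>2 + y\<^sup>2 + k\<^sup>2)"
  have "x\<^sup>2 + y\<^sup>2 + k\<^sup>2 > 0" using nz by (smt (verit) zero_le_power2 power2_eq_iff_nonneg zero_eq_power2)
  then have r: "r > 0" "r\<^sup>2 = x\<^sup>2 + y\<^sup>2 + k\<^sup>2" by (simp_all add: r_def)
  define p where "p = (of_real x + \<i> * of_real y) / of_real r"
  define q where "q = complex_of_real k / of_real r"
  have pq: "p * (?b) + q * (?d - ?a) + cnj p * ?c = 0"
  proof -
    have "p * (?b) + q * (?d - ?a) + cnj p * ?c
      = (of_real x * (?b + ?c) + of_real y * (\<i> * (?b - ?c)) + of_real k * (?d - ?a)) / of_real r"
      using r(1) by (simp add: p_def q_def field_simps)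
    then show ?thesis unfolding dep by simp
  qed
  have cq: "cnj q = q" by (simp add: q_def)
  have norm: "cnj p * p + q * q = 1"
  proof -
    have "cnj p * p + q * q = of_real ((x\<^sup>2 + y\<^sup>2 + k\<^sup>2) / r\<^sup>2)"
      by (simp add: p_def q_def power2_eq_square complex_eq_iff add_divide_distrib)
    then show ?thesis unfolding r(2)[symmetric] using r(1) by simp
  qed
  define V where "V = mat 2 2 (\<lambda>(i, j). if i = 0 then (if j = 0 then p else q) else (if j = 0 then q else - cnj p))"
  have V: "V \<in> carrier_mat 2 2" by (simp add: V_def)
  have Vi: "V $$ (0, 0) = p" "V $$ (0, 1) = q" "V $$ (1, 0) = q" "V $$ (1, 1) = - cnj p"
    by (simp_all add: V_def)
  have two: "(\<Sum>t<2. f t) = f 0 + f 1" for f :: "nat \<Rightarrow> complex"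
    by (simp add: numeral_2_eq_2)
  have cases2: "i = 0 \<or> i = 1" if "i < 2" for i :: nat using that by auto
  have "V\<^sup>\<dagger> * V = 1\<^sub>m 2"
  proof (rule eq_matI)
    fix i j assume "i < dim_row (1\<^sub>m 2 :: complex mat)" "j < dim_col (1\<^sub>m 2 :: complex mat)"
    then have ij: "i < 2" "j < 2" by simp_all
    have "(V\<^sup>\<dagger> * V) $$ (i, j) = V\<^sup>\<dagger> $$ (i, 0) * V $$ (0, j) + V\<^sup>\<dagger> $$ (i, 1) * V $$ (1, j)"
      using index_mult_sum[of "V\<^sup>\<dagger>" 2 2 V 2 i j] V ij by (simp only: two mat_adjoint_carrier)
    then show "(V\<^sup>\<dagger> * V) $$ (i, j) = 1\<^sub>m 2 $$ (i, j)"
      using cases2[OF ij(1)] cases2[OF ij(2)] V norm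
      by (auto simp: Vi[unfolded One_nat_def] cq algebra_simps simp del: index_mult_mat(1))
  qed (use V in simp_all)
  then have VU: "V \<in> unitaries 2" using V by (simp add: unitaries_def)
  have "V * A = transpose_mat A * V"
  proof (rule eq_matI)
    fix i j assume "i < dim_row (transpose_mat A * V)" "j < dim_col (transpose_mat A * V)"
    then have ij: "i < 2" "j < 2" using A V by simp_all
    have "(V * A) $$ (i, j) = V $$ (i, 0) * A $$ (0, j) + V $$ (i, 1) * A $$ (1, j)"
      "(transpose_mat A * V) $$ (i, j) = transpose_mat A $$ (i, 0) * V $$ (0, j) + transpose_mat A $$ (i, 1) * V $$ (1, j)"
      using index_mult_sum[of V 2 2 A 2 i j] index_mult_sum[of "transpose_mat A" 2 2 V 2 i j] V A ij
      by (simp_all only: two transpose_carrier_mat)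
    moreover have "p * ?b + q * ?d = q * ?a + - cnj p * ?c" using pq by (simp add: algebra_simps add_eq_0_iff)
    ultimately show "(V * A) $$ (i, j) = (transpose_mat A * V) $$ (i, j)"
      using cases2[OF ij(1)] cases2[OF ij(2)] A
      by (auto simp: Vi[unfolded One_nat_def] mult_ac simp del: index_mult_mat(1))
  qed (use V A in simp_all)
  then have "V * A * V\<^sup>\<dagger> = transpose_mat A * (V * V\<^sup>\<dagger>)"
    using A V by (simp add: assoc_mult_mat[of _ 2 2 _ 2 _ 2])
  also have "\<dots> = transpose_mat A"
    using A unitariesD(3)[OF VU] by (simp add: right_mult_one_mat[of _ 2 2])
  finally show ?thesis using VU by metis
qed

text \<open>Transposing factors of size two is a unitary similarity of the product, and transposing all other
  factors is, up to such a similarity, a transposition of the product.\<close>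
lemma numerical_radius_partial_transpose:
  assumes n: "\<And>j. j < m \<Longrightarrow> n j \<ge> 2" and \<psi>: "\<And>j. j < m \<Longrightarrow> \<psi> j = id \<or> \<psi> j = transpose_mat"
    and same: "(\<forall>j<m. n j \<ge> 3 \<longrightarrow> \<psi> j = id) \<or> (\<forall>j<m. n j \<ge> 3 \<longrightarrow> \<psi> j = transpose_mat)"
    and A: "A \<in> families m n"
  shows "numerical_radius (kronecker_family m (\<lambda>j. \<psi> j (A j))) = numerical_radius (kronecker_family m A)"
proof -
  let ?N = "\<Prod>j<m. n j"
  have pos: "n j > 0" if "j < m" for j using n[OF that] by simp
  have N0: "?N > 0" using pos by (intro prod_pos) simp
  have case_id: "numerical_radius (kronecker_family m (\<lambda>j. \<psi> j (A j))) = numerical_radius (kronecker_family m A)"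
    if \<psi>: "\<And>j. j < m \<Longrightarrow> \<psi> j = id \<or> \<psi> j = transpose_mat" and id: "\<And>j. j < m \<Longrightarrow> n j \<ge> 3 \<Longrightarrow> \<psi> j = id" for \<psi>
  proof -
    have "\<exists>V. V \<in> unitaries (n j) \<and> \<psi> j (A j) = V * A j * V\<^sup>\<dagger>" if j: "j < m" for j
    proof (cases "\<psi> j = id")
      case True
      then show ?thesis using familiesD[OF A j]
        by (intro exI[of _ "1\<^sub>m (n j)"]) (simp add: left_mult_one_mat[of _ "n j" "n j"] right_mult_one_mat[of _ "n j" "n j"])
    next
      case False
      then have "n j = 2" using id[OF j] n[OF j] by linarith
      moreover have "\<psi> j = transpose_mat" using \<psi>[OF j] False by blast
      ultimately show ?thesis using transpose_unitarily_similar_2[of "A j"] familiesD[OF A j] by auto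
    qed
    then obtain V where V: "\<And>j. j < m \<Longrightarrow> V j \<in> unitaries (n j) \<and> \<psi> j (A j) = V j * A j * (V j)\<^sup>\<dagger>"
      by metis
    have Vu: "\<And>j. j < m \<Longrightarrow> V j \<in> unitaries (n j)" using V by blast
    have "kronecker_family m (\<lambda>j. \<psi> j (A j)) = kronecker_family m (\<lambda>j. V j * A j * (V j)\<^sup>\<dagger>)"
      by (rule kronecker_family_cong) (use V in blast)
    also have "\<dots> = kronecker_family m V * kronecker_family m A * (kronecker_family m V)\<^sup>\<dagger>"
      by (rule kronecker_family_conj[OF unitariesD(1)[OF Vu] A pos])
    finally show ?thesis
      using numerical_radius_unitary_conj[OF kronecker_family_unitary[OF Vu pos] kronecker_family_in_carrier[OF A] N0]
      by simp
  qed
  from same show ?thesis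
  proof
    assume "\<forall>j<m. n j \<ge> 3 \<longrightarrow> \<psi> j = id"
    then show ?thesis using \<psi> by (intro case_id) blast+
  next
    assume T: "\<forall>j<m. n j \<ge> 3 \<longrightarrow> \<psi> j = transpose_mat"
    define \<psi>' :: "nat \<Rightarrow> complex mat \<Rightarrow> complex mat"
      where "\<psi>' j = (if \<psi> j = transpose_mat then id else transpose_mat)" for j
    have fam: "(\<lambda>j. \<psi> j (A j)) \<in> families m n"
      unfolding families_def using familiesD[OF A] \<psi> by fastforce
    have \<psi>\<psi>': "transpose_mat (\<psi> j (A j)) = \<psi>' j (A j)" if "j < m" for j
      using \<psi>[OF that] by (auto simp: \<psi>'_def)
    have "transpose_mat (kronecker_family m (\<lambda>j. \<psi> j (A j)))
        = kronecker_family m (\<lambda>j. transpose_mat (\<psi> j (A j)))"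
      by (rule kronecker_family_transpose[OF fam pos])
    also have "\<dots> = kronecker_family m (\<lambda>j. \<psi>' j (A j))"
      by (rule kronecker_family_cong) (rule \<psi>\<psi>')
    finally have "transpose_mat (kronecker_family m (\<lambda>j. \<psi> j (A j))) = kronecker_family m (\<lambda>j. \<psi>' j (A j))" .
    moreover have "numerical_radius (kronecker_family m (\<lambda>j. \<psi>' j (A j))) = numerical_radius (kronecker_family m A)"
      by (rule case_id) (use T in \<open>simp_all add: \<psi>'_def id_def\<close>)
    ultimately show ?thesis
      using numerical_radius_transpose[OF kronecker_family_in_carrier[OF fam] N0] by simp
  qed
qed

section \<open>Factors of size at least three are transposed together\<close>

lemma form_unit_mat:
  assumes "p < n" "q < n" shows "form n (unit_mat n p q) v u = cnj (v p) * u q"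
proof -
  have "form n (unit_mat n p q) v u
      = (\<Sum>i<n. (\<Sum>j<n. (cnj (v i) * u j) * (if j = q then 1 else 0)) * (if i = p then 1 else 0))"
    unfolding form_def sum_distrib_right by (intro sum.cong refl) auto
  also have "\<dots> = (\<Sum>j<n. (cnj (v p) * u j) * (if j = q then 1 else 0))"
    by (rule sum_mult_delta(1)[OF assms(1)])
  also have "\<dots> = cnj (v p) * u q" by (rule sum_mult_delta(1)[OF assms(2)])
  finally show ?thesis .
qed

text \<open>The weighted shift \<open>X = E 0 1 + 2 E 1 2\<close> detects a transposition in one of two factors:
  \<open>X \<otimes> X\<close> has a shift with weights 1 and 4 as a direct summand, of numerical radius
  greater than 2, whereas every direct summand of \<open>X \<otimes> X\<^sup>t\<close> has numerical radius at most 2.\<close>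
lemma partial_transpose_changes_radius:
  assumes n: "\<And>l. l < m \<Longrightarrow> n l > 0" and j: "j < m" "n j \<ge> 3" and k: "k < m" "n k \<ge> 3" and jk: "j \<noteq> k"
  shows "\<exists>A\<in>families m n. (\<forall>l. l \<noteq> j \<longrightarrow> l \<noteq> k \<longrightarrow> transpose_mat (A l) = A l) \<and>
    numerical_radius (kronecker_family m A)
      \<noteq> numerical_radius (kronecker_family m (A(k := transpose_mat (A k))))"
proof -
  define N where "N = (\<Prod>l<m. n l)"
  have N0: "N > 0" unfolding N_def using n by (intro prod_pos) simp
  have "\<exists>p<N. \<forall>l<m. digit m n p l = (if l = j then a else if l = k then b else 0)" if "a < 3" "b < 3" for a b
    unfolding N_def by (rule digit_surject) (use n j k that in auto)
  then have "\<forall>a b. \<exists>p. a < 3 \<longrightarrow> b < 3 \<longrightarrow> p < N \<and> (\<forall>l<m. digit m n p l = (if l = j then a else if l = k then b else 0))"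
    by blast
  then obtain enc where enc: "\<And>a b. a < 3 \<Longrightarrow> b < 3 \<Longrightarrow> enc a b < N \<and>
      (\<forall>l<m. digit m n (enc a b) l = (if l = j then a else if l = k then b else 0))"
    by metis
  have encN: "enc a b < N" if "a < 3" "b < 3" for a b using enc[OF that] by blast
  have dig: "digit m n (enc a b) l = (if l = j then a else if l = k then b else 0)"
    if "a < 3" "b < 3" "l < m" for a b l using enc[OF that(1,2)] that(3) by blast
  have enc_eq: "enc a b = enc c d \<longleftrightarrow> a = c \<and> b = d" if "a < 3" "b < 3" "c < 3" "d < 3" for a b c d
  proof
    assume e: "enc a b = enc c d"
    show "a = c \<and> b = d"
      using dig[OF that(1,2) j(1)] dig[OF that(3,4) j(1)] dig[OF that(1,2) k(1)] dig[OF that(3,4) k(1)] jk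
      unfolding e by simp
  qed simp
  define A0 where "A0 = (\<lambda>l. unit_mat (n l) 0 0)"
  have A0: "A0 \<in> families m n" by (simp add: A0_def families_def)
  define F where "F v X Y = form N (kronecker_family m (A0(j := X, k := Y))) v v" for v X Y
  have F_unit: "F v (unit_mat (n j) a c) (unit_mat (n k) b d) = cnj (v (enc a b)) * v (enc c d)"
    if "a < 3" "b < 3" "c < 3" "d < 3" for v a b c d
  proof -
    have "kronecker_family m (A0(j := unit_mat (n j) a c, k := unit_mat (n k) b d))
        = kronecker_family m (\<lambda>l. unit_mat (n l) (digit m n (enc a b) l) (digit m n (enc c d) l))"
      by (rule kronecker_family_cong) (use dig that jk in \<open>simp add: A0_def\<close>)
    also have "\<dots> = unit_mat N (enc a b) (enc c d)"
      unfolding N_def by (rule kronecker_family_unit_mat[OF n]) (use encN that in \<open>simp_all add: N_def[symmetric]\<close>)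
    finally show ?thesis unfolding F_def by (simp add: form_unit_mat encN that)
  qed
  have ml: "multilinear m n (\<lambda>A. form N (kronecker_family m A) v v)" for v
    using multilinear_kronecker[of n m "\<lambda>X. form N X v v"] linear_functional_form n by (simp add: N_def)
  have F1: "linear_functional (n j) (\<lambda>X. F v X Y)" if Y: "Y \<in> carrier_mat (n k) (n k)" for v Y
  proof -
    have "A0(j := X, k := Y) = A0(k := Y, j := X)" for X using jk by (rule fun_upd_twist)
    then show ?thesis
      using multilinearD[OF ml families_update[OF A0 Y] j(1)] by (simp only: F_def)
  qed
  have F2: "linear_functional (n k) (\<lambda>Y. F v X Y)" if X: "X \<in> carrier_mat (n j) (n j)" for v X
    using multilinearD[OF ml families_update[OF A0 X] k(1)] by (simp only: F_def)
  have F_sum: "F v (unit_mat (n j) 0 1 + 2 \<cdot>\<^sub>m unit_mat (n j) 1 2) (unit_mat (n k) a c + 2 \<cdot>\<^sub>m unit_mat (n k) b d)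
      = cnj (v (enc 0 a)) * v (enc 1 c) + 2 * (cnj (v (enc 0 b)) * v (enc 1 d))
        + 2 * (cnj (v (enc 1 a)) * v (enc 2 c)) + 4 * (cnj (v (enc 1 b)) * v (enc 2 d))"
    if "a < 3" "b < 3" "c < 3" "d < 3" for v a b c d
    using that
    by (simp add: linear_functional_add[OF F1] linear_functional_smult[OF F1]
        linear_functional_add[OF F2] linear_functional_smult[OF F2] F_unit)
  define X where "X = unit_mat (n j) 0 1 + 2 \<cdot>\<^sub>m unit_mat (n j) 1 2"
  define Y where "Y = unit_mat (n k) 0 1 + 2 \<cdot>\<^sub>m unit_mat (n k) 1 2"
  have YT: "transpose_mat Y = unit_mat (n k) 1 0 + 2 \<cdot>\<^sub>m unit_mat (n k) 2 1"
    unfolding Y_def by (rule eq_matI) auto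
  have XY: "X \<in> carrier_mat (n j) (n j)" "Y \<in> carrier_mat (n k) (n k)" by (simp_all add: X_def Y_def)
  define A where "A = A0(j := X, k := Y)"
  have A: "A \<in> families m n" unfolding A_def by (intro families_update A0 XY)
  have upd: "A(k := transpose_mat (A k)) = A0(j := X, k := transpose_mat Y)" by (simp add: A_def)
  have AT: "A(k := transpose_mat (A k)) \<in> families m n"
    unfolding upd by (intro families_update A0 XY) (use XY in simp)
  note car = kronecker_family_in_carrier[OF A, folded N_def] kronecker_family_in_carrier[OF AT, folded N_def]
  have upper: "numerical_radius (kronecker_family m (A(k := transpose_mat (A k)))) \<le> 2"
  proof (rule numerical_radius_leI[OF car(2) N0])
    fix v
    let ?r = "\<lambda>a b. cmod (v (enc a b))"
    have "form N (kronecker_family m (A(k := transpose_mat (A k)))) v v = F v X (transpose_mat Y)"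
      by (simp only: upd F_def)
    also have "\<dots> = cnj (v (enc 0 1)) * v (enc 1 0) + 2 * (cnj (v (enc 0 2)) * v (enc 1 1))
        + 2 * (cnj (v (enc 1 1)) * v (enc 2 0)) + 4 * (cnj (v (enc 1 2)) * v (enc 2 1))"
      unfolding X_def YT by (rule F_sum) simp_all
    also have "cmod \<dots> \<le> ?r 0 1 * ?r 1 0 + 2 * (?r 0 2 * ?r 1 1) + 2 * (?r 1 1 * ?r 2 0) + 4 * (?r 1 2 * ?r 2 1)"
      by (intro order.trans[OF norm_triangle_ineq] add_mono) (simp_all add: norm_mult)
    also have "\<dots> \<le> 2 * ((?r 0 1)\<^sup>2 + (?r 1 0)\<^sup>2 + (?r 0 2)\<^sup>2 + (?r 1 1)\<^sup>2 + (?r 2 0)\<^sup>2 + (?r 1 2)\<^sup>2 + (?r 2 1)\<^sup>2)"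
    proof -
      have "a * b + 2 * (c * d) + 2 * (d * e) + 4 * (f * g) \<le> 2 * (a\<^sup>2 + b\<^sup>2 + c\<^sup>2 + d\<^sup>2 + e\<^sup>2 + f\<^sup>2 + g\<^sup>2)"
        for a b c d e f g :: real
      proof -
        have "2 * (a\<^sup>2 + b\<^sup>2 + c\<^sup>2 + d\<^sup>2 + e\<^sup>2 + f\<^sup>2 + g\<^sup>2) - (a * b + 2 * (c * d) + 2 * (d * e) + 4 * (f * g))
          = ((a - b)\<^sup>2 + 3 * a\<^sup>2 + 3 * b\<^sup>2) / 2 + (2 * c - d)\<^sup>2 / 2 + (2 * e - d)\<^sup>2 / 2 + d\<^sup>2 + 2 * (f - g)\<^sup>2"
          by (simp add: power2_eq_square field_simps)
        moreover have "\<dots> \<ge> 0" by (intro add_nonneg_nonneg) simp_all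
        ultimately show ?thesis by linarith
      qed
      then show ?thesis .
    qed
    also have "(?r 0 1)\<^sup>2 + (?r 1 0)\<^sup>2 + (?r 0 2)\<^sup>2 + (?r 1 1)\<^sup>2 + (?r 2 0)\<^sup>2 + (?r 1 2)\<^sup>2 + (?r 2 1)\<^sup>2
        = (\<Sum>p\<in>{enc 0 1, enc 1 0, enc 0 2, enc 1 1, enc 2 0, enc 1 2, enc 2 1}. (cmod (v p))\<^sup>2)"
      by (simp add: enc_eq)
    also have "\<dots> \<le> normsq N v"
      unfolding normsq_def by (rule sum_mono2) (use encN in auto)
    finally show "cmod (form N (kronecker_family m (A(k := transpose_mat (A k)))) v v) \<le> 2 * normsq N v"
      by (simp del: fun_upd_apply)
  qed
  have lower: "68 \<le> numerical_radius (kronecker_family m A) * 33"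
  proof -
    \<comment> \<open>A rational approximation of the extremal vector of the shift with weights 1 and 4; the value
      68/33 of the quotient exceeds 2.\<close>
    define v :: "nat \<Rightarrow> complex" where "v p = (if p = enc 0 0 then 1 else if p = enc 1 1 \<or> p = enc 2 2 then 4 else 0)" for p
    have vv: "v (enc 0 0) = 1" "v (enc 1 1) = 4" "v (enc 2 2) = 4" "v (enc 0 1) = 0" "v (enc 1 0) = 0"
      by (simp_all add: v_def enc_eq)
    have "form N (kronecker_family m A) v v = F v X Y" by (simp only: A_def F_def)
    also have "\<dots> = cnj (v (enc 0 0)) * v (enc 1 1) + 2 * (cnj (v (enc 0 1)) * v (enc 1 2))
        + 2 * (cnj (v (enc 1 0)) * v (enc 2 1)) + 4 * (cnj (v (enc 1 1)) * v (enc 2 2))"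
      unfolding X_def Y_def by (rule F_sum) simp_all
    also have "\<dots> = 68" by (simp add: vv vv[unfolded One_nat_def])
    finally have form: "form N (kronecker_family m A) v v = 68" .
    have "normsq N v = (\<Sum>p\<in>{enc 0 0, enc 1 1, enc 2 2}. (cmod (v p))\<^sup>2)"
      unfolding normsq_def by (rule sum.mono_neutral_right) (use encN in \<open>auto simp: v_def\<close>)
    also have "\<dots> = 33" by (simp add: enc_eq vv vv[unfolded One_nat_def])
    finally have "normsq N v = 33" .
    then show ?thesis using form_le_numerical_radius[OF car(1), of v] by (simp add: form)
  qed
  have "numerical_radius (kronecker_family m A) \<noteq> numerical_radius (kronecker_family m (A(k := transpose_mat (A k))))"
    using upper lower by linarith
  moreover have "\<forall>l. l \<noteq> j \<longrightarrow> l \<noteq> k \<longrightarrow> transpose_mat (A l) = A l"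
    by (simp add: A_def A0_def)
  ultimately show ?thesis using A by blast
qed

lemma preserved_transpositions_agree:
  assumes n: "\<And>j. j < m \<Longrightarrow> n j > 0" and \<tau>: "\<And>j. \<tau> j = id \<or> \<tau> j = transpose_mat"
    and w: "\<And>A. A \<in> families m n \<Longrightarrow>
      numerical_radius (kronecker_family m (\<lambda>j. \<tau> j (A j))) = numerical_radius (kronecker_family m A)"
  shows "(\<forall>j<m. n j \<ge> 3 \<longrightarrow> \<tau> j = id) \<or> (\<forall>j<m. n j \<ge> 3 \<longrightarrow> \<tau> j = transpose_mat)"
proof (rule ccontr)
  assume "\<not> ?thesis"
  then obtain j k where j: "j < m" "n j \<ge> 3" "\<tau> j \<noteq> transpose_mat" and k: "k < m" "n k \<ge> 3" "\<tau> k \<noteq> id"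
    by blast
  have tj: "\<tau> j = id" and tk: "\<tau> k = transpose_mat" using j k \<tau> by blast+
  then have jk: "j \<noteq> k" using j(3) by auto
  \<comment> \<open>The witness has symmetric factors in the remaining slots, where \<open>\<tau>\<close> has no effect.\<close>
  obtain A where A: "A \<in> families m n" and sym: "\<And>l. l \<noteq> j \<Longrightarrow> l \<noteq> k \<Longrightarrow> transpose_mat (A l) = A l"
    and ne: "numerical_radius (kronecker_family m A) \<noteq> numerical_radius (kronecker_family m (A(k := transpose_mat (A k))))"
    using partial_transpose_changes_radius[OF n j(1,2) k(1,2) jk] by blast
  have "(\<lambda>l. \<tau> l (A l)) = A(k := transpose_mat (A k))"
  proof
    fix l
    show "\<tau> l (A l) = (A(k := transpose_mat (A k))) l"
      using \<tau>[of l] tj tk sym[of l] by (cases "l = k"; cases "l = j") auto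
  qed
  then show False using w[OF A] ne by simp
qed

section \<open>The preservers\<close>

theorem theorem3p2:
  fixes m :: nat and n :: "nat \<Rightarrow> nat" and N :: nat
    and \<phi> :: "complex mat \<Rightarrow> complex mat"
  assumes "m \<ge> 2"
    and "\<And>j. j < m \<Longrightarrow> n j \<ge> 2"
    and "N = (\<Prod>j<m. n j)"
    and "linear_map_mat N \<phi>"
  shows
    "(\<forall>A. (\<forall>j<m. A j \<in> carrier_mat (n j) (n j)) \<longrightarrow>
        numerical_radius (\<phi> (kronecker_family m A)) = numerical_radius (kronecker_family m A))
     \<longleftrightarrow>
     (\<exists>U \<xi> \<psi>. U \<in> carrier_mat N N \<and> unitary_mat U \<and> cmod \<xi> = 1 \<and>
        (\<forall>k<m. \<psi> k = id \<or> \<psi> k = transpose_mat) \<and>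
        (\<forall>A. (\<forall>j<m. A j \<in> carrier_mat (n j) (n j)) \<longrightarrow>
           \<phi> (kronecker_family m A) =
             \<xi> \<cdot>\<^sub>m (U * kronecker_family m (\<lambda>k. \<psi> k (A k)) * mat_adjoint U)) \<and>
        ((\<forall>j<m. n j \<ge> 3 \<longrightarrow> \<psi> j = id) \<or> (\<forall>j<m. n j \<ge> 3 \<longrightarrow> \<psi> j = transpose_mat)))"
proof -
  let ?K = "kronecker_family m"
  have pos: "n j > 0" if "j < m" for j using assms(2)[OF that] by simp
  have N: "N = (\<Prod>j<m. n j)" by (rule assms(3))
  have N0: "N > 0" unfolding N using pos by (intro prod_pos) simp
  have fam: "A \<in> families m n \<longleftrightarrow> (\<forall>j<m. A j \<in> carrier_mat (n j) (n j))" for A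
    by (simp add: families_def)
  have Kc: "?K A \<in> carrier_mat N N" if "A \<in> families m n" for A
    using kronecker_family_in_carrier[OF that] by (simp only: N)
  have conj: "numerical_radius (\<xi> \<cdot>\<^sub>m (U * X * U\<^sup>\<dagger>)) = numerical_radius X"
    if "cmod \<xi> = 1" "U \<in> unitaries N" "X \<in> carrier_mat N N" for \<xi> U X
    using numerical_radius_unimodular_smult[of "U * X * U\<^sup>\<dagger>" N \<xi>] that unitariesD(1)[OF that(2)] N0
      numerical_radius_unitary_conj[OF that(2,3) N0] by simp
  have twisted: "(\<lambda>k. \<psi> k (A k)) \<in> families m n"
    if "\<And>k. k < m \<Longrightarrow> \<psi> k = id \<or> \<psi> k = transpose_mat" "A \<in> families m n" for \<psi> A
    unfolding families_def using familiesD[OF that(2)] that(1) by fastforce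
  show ?thesis
    unfolding fam[symmetric]
  proof (intro iffI)
    assume "\<forall>A. A \<in> families m n \<longrightarrow> numerical_radius (\<phi> (?K A)) = numerical_radius (?K A)"
    then have w: "numerical_radius (\<phi> (?K A)) = numerical_radius (?K A)" if "A \<in> families m n" for A
      using that by blast
    then have "preserves_radius m n \<phi>" by (simp add: preserves_radius_def)
    then obtain \<xi> where \<xi>: "cmod \<xi> = 1" and frame: "frame_map m n N (\<lambda>X. inverse \<xi> \<cdot>\<^sub>m \<phi> X)"
      using preserver_scalar_frame_map[OF pos N assms(4)] by blast
    from frame_map.normal_form[OF frame]
    obtain U \<tau> where U: "U \<in> unitaries N" and \<tau>: "\<forall>j. \<tau> j = id \<or> \<tau> j = transpose_mat"
      and img: "\<forall>A\<in>families m n. inverse \<xi> \<cdot>\<^sub>m \<phi> (?K A) = U * ?K (\<lambda>j. \<tau> j (A j)) * U\<^sup>\<dagger>"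
      unfolding frame_map.tensor_image_def[OF frame] by (elim bexE exE conjE)
    have \<phi>: "\<phi> (?K A) = \<xi> \<cdot>\<^sub>m (U * ?K (\<lambda>j. \<tau> j (A j)) * U\<^sup>\<dagger>)" if A: "A \<in> families m n" for A
    proof -
      have "\<xi> \<noteq> 0" using \<xi> by auto
      then have "\<phi> (?K A) = \<xi> \<cdot>\<^sub>m (inverse \<xi> \<cdot>\<^sub>m \<phi> (?K A))"
        by (simp add: smult_smult_mat one_smult_mat)
      then show ?thesis using img A by simp
    qed
    have inv: "numerical_radius (?K (\<lambda>j. \<tau> j (A j))) = numerical_radius (?K A)" if A: "A \<in> families m n" for A
    proof -
      have "(\<lambda>j. \<tau> j (A j)) \<in> families m n" using twisted[of \<tau> A] \<tau> A by simp
      then have "?K (\<lambda>j. \<tau> j (A j)) \<in> carrier_mat N N" by (rule Kc)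
      from conj[OF \<xi> U this] show ?thesis using w[OF A] by (simp only: \<phi>[OF A])
    qed
    have same: "(\<forall>j<m. n j \<ge> 3 \<longrightarrow> \<tau> j = id) \<or> (\<forall>j<m. n j \<ge> 3 \<longrightarrow> \<tau> j = transpose_mat)"
    proof (rule preserved_transpositions_agree[of m n \<tau>])
      show "n j > 0" if "j < m" for j by (rule pos[OF that])
      show "\<tau> j = id \<or> \<tau> j = transpose_mat" for j using \<tau> by simp
      show "numerical_radius (?K (\<lambda>j. \<tau> j (A j))) = numerical_radius (?K A)" if "A \<in> families m n" for A
        by (rule inv[OF that])
    qed
    have Uc: "U \<in> carrier_mat N N" by (rule unitariesD(1)[OF U])
    have "unitary_mat U" using U unitaries_iff[OF Uc] by simp
    then show "\<exists>U \<xi> \<psi>. U \<in> carrier_mat N N \<and> unitary_mat U \<and> cmod \<xi> = 1 \<and>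
        (\<forall>k<m. \<psi> k = id \<or> \<psi> k = transpose_mat) \<and>
        (\<forall>A. A \<in> families m n \<longrightarrow> \<phi> (?K A) = \<xi> \<cdot>\<^sub>m (U * ?K (\<lambda>k. \<psi> k (A k)) * U\<^sup>\<dagger>)) \<and>
        ((\<forall>j<m. n j \<ge> 3 \<longrightarrow> \<psi> j = id) \<or> (\<forall>j<m. n j \<ge> 3 \<longrightarrow> \<psi> j = transpose_mat))"
      using Uc \<xi> \<tau> \<phi> same
      by (intro exI[of _ U] exI[of _ \<xi>] exI[of _ \<tau>] conjI allI impI) simp_all
  next
    assume "\<exists>U \<xi> \<psi>. U \<in> carrier_mat N N \<and> unitary_mat U \<and> cmod \<xi> = 1 \<and>
        (\<forall>k<m. \<psi> k = id \<or> \<psi> k = transpose_mat) \<and>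
        (\<forall>A. A \<in> families m n \<longrightarrow> \<phi> (?K A) = \<xi> \<cdot>\<^sub>m (U * ?K (\<lambda>k. \<psi> k (A k)) * U\<^sup>\<dagger>)) \<and>
        ((\<forall>j<m. n j \<ge> 3 \<longrightarrow> \<psi> j = id) \<or> (\<forall>j<m. n j \<ge> 3 \<longrightarrow> \<psi> j = transpose_mat))"
    then obtain U \<xi> \<psi> where U: "U \<in> carrier_mat N N" "unitary_mat U" and \<xi>: "cmod \<xi> = 1"
      and \<psi>: "\<forall>k<m. \<psi> k = id \<or> \<psi> k = transpose_mat"
      and \<phi>: "\<forall>A. A \<in> families m n \<longrightarrow> \<phi> (?K A) = \<xi> \<cdot>\<^sub>m (U * ?K (\<lambda>k. \<psi> k (A k)) * U\<^sup>\<dagger>)"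
      and same: "(\<forall>j<m. n j \<ge> 3 \<longrightarrow> \<psi> j = id) \<or> (\<forall>j<m. n j \<ge> 3 \<longrightarrow> \<psi> j = transpose_mat)"
      by (elim exE conjE)
    have Uu: "U \<in> unitaries N" using U unitaries_iff[OF U(1)] by simp
    show "\<forall>A. A \<in> families m n \<longrightarrow> numerical_radius (\<phi> (?K A)) = numerical_radius (?K A)"
    proof (intro allI impI)
      fix A assume A: "A \<in> families m n"
      have tw: "(\<lambda>k. \<psi> k (A k)) \<in> families m n"
        using twisted[of \<psi> A] \<psi> A by simp
      have \<phi>A: "\<phi> (?K A) = \<xi> \<cdot>\<^sub>m (U * ?K (\<lambda>k. \<psi> k (A k)) * U\<^sup>\<dagger>)"
        using \<phi> A by simp
      have "numerical_radius (\<phi> (?K A)) = numerical_radius (?K (\<lambda>k. \<psi> k (A k)))"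
        unfolding \<phi>A by (rule conj[OF \<xi> Uu Kc[OF tw]])
      also have "\<dots> = numerical_radius (?K A)"
      proof (rule numerical_radius_partial_transpose[of m n \<psi> A])
        show "n j \<ge> 2" if "j < m" for j using assms(2) that by simp
        show "\<psi> j = id \<or> \<psi> j = transpose_mat" if "j < m" for j using \<psi> that by simp
      qed (rule same, rule A)
      finally show "numerical_radius (\<phi> (?K A)) = numerical_radius (?K A)" .
    qed
  qed
qed

end
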